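(* Consider the extremum seeking system with feedback law $u_{i,1}(J(x),\tau)=\sqrt{2\omega_iJ(x)}\cos(\ln J(x)+\omega_i\tau)$, $u_{i,2}(J(x),\tau)=\sqrt{2\omega_iJ(x)}\sin(\ln J(x)+\omega_i\tau)$ when $J(x)>0$, and $u_{i,1}=u_{i,2}=0$ when $J(x)\le0$, written in shifted coordinates $\tilde x=x-x^\star$: $$\dot{\tilde x}=b_0(\tilde x+x^\star)+\varepsilon^{-1}\sum_{i=1}^r\sum_{j=1}^2b_{i,j}u_{i,j}(J(\tilde x+x^\star),\tau),\qquad\dot\tau=\varepsilon^{-2}.$$ Suppose the Excitation Assumption holds with constant $\gamma$ and the Regularity Assumption holds with constant $\kappa_3$, with $\gamma>\kappa_3$, and suppose $J$ is a radially unbounded $\mathcal{C}^2$ function for which there is $\alpha_J\in\mathcal{K}$ with $\alpha_J(|x-x^\star|)^2|x-x^\star|^2\le|\nabla J(x)|^2$ for all $x\in\mathbb{R}^n$. Then: (a) there exists $\Delta>0$ such that the origin $\tilde x=0$ is $\Delta$-uniformly globally ultimately bounded for this system; (b) if $J^\star\ge0$, the origin $\tilde x=0$ is uniformly globally practically asymptotically stable for this system.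
   Context: $|\cdot|$ is the Euclidean norm; $\mathcal{K},\mathcal{KL}$ standard comparison-function classes. Data: $n\ge1$, $r$ a positive integer with $r\ge n/2$, vectors $b_{i,j}\in\mathbb{R}^n$ ($i=1,\dots,r$, $j=1,2$), distinct positive rationals $\omega_1,\dots,\omega_r$, a map $b_0:\mathbb{R}^n\to\mathbb{R}^n$, a cost $J:\mathbb{R}^n\to\mathbb{R}$ with $J^\star:=\inf_xJ(x)>-\infty$ attained at a unique $x^\star$, and a parameter $\varepsilon>0$. Excitation Assumption: there is $\gamma>0$ with $\sum_{i=1}^r\sum_{j=1}^2(b_{i,j}^\top v)^2\ge\gamma|v|^2$ for all $v\in\mathbb{R}^n$. Regularity Assumption: (a) $J(x)>J(x^\star)$ for $x\ne x^\star$; (b) $\nabla J(x)=0$ iff $x=x^\star$; (c) there is $L_J>0$ with $|\nabla^2J(x)|\le L_J$ for all $x$; (d) there is $\kappa_3>0$ with $|b_0(x)|\le\kappa_3|\nabla J(x)|$ for all $x$; (e) there is $L_0>0$ with $|b_0(x_1)-b_0(x_2)|\le L_0|x_1-x_2|$ for all $x_1,x_2$. Solutions: for initial $(\tilde x_0,\tau_0)\in\mathbb{R}^n\times\mathbb{R}_{\ge0}$, a $\mathcal{C}^1$ function on $[0,t_s)$, $t_s\in(0,\infty]$, satisfying the ODE and initial condition. The origin is $\Delta$-uniformly globally ultimately bounded if there exist $\beta\in\mathcal{KL}$ and $\varepsilon^*>0$ such that for all $\varepsilon\in(0,\varepsilon^* )$ every solution from every initial condition is defined for all $t\ge0$ and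 satisfies $|\tilde x(t)|\le\beta(|\tilde x_0|,t)+\Delta$ for all $t\ge0$. It is uniformly globally practically asymptotically stable if there is $\beta\in\mathcal{KL}$ such that for every $\nu>0$ there is $\varepsilon^*>0$ such that for all $\varepsilon\in(0,\varepsilon^* )$ every solution is defined for all $t\ge0$ and satisfies $|\tilde x(t)|\le\beta(|\tilde x_0|,t)+\nu$. *)

theory Defs
  imports "HOL-Analysis.Analysis"
begin

definition class_K :: "(real \<Rightarrow> real) \<Rightarrow> bool" where
  "class_K \<alpha> \<longleftrightarrow> \<alpha> 0 = 0 \<and> continuous_on {0..} \<alpha> \<and> strict_mono_on {0..} \<alpha>"

definition class_KL :: "(real \<Rightarrow> real \<Rightarrow> real) \<Rightarrow> bool" where
  "class_KL \<beta> \<longleftrightarrow>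
     (\<forall>t\<ge>0. class_K (\<lambda>s. \<beta> s t)) \<and>
     (\<forall>s\<ge>0. (\<forall>t1 t2. 0 \<le> t1 \<and> t1 \<le> t2 \<longrightarrow> \<beta> s t2 \<le> \<beta> s t1) \<and>
             ((\<lambda>t. \<beta> s t) \<longlongrightarrow> 0) at_top)"

definition es_u :: "real \<Rightarrow> real \<Rightarrow> real \<Rightarrow> nat \<Rightarrow> real" where
  "es_u w Jv \<tau> j =
     (if Jv > 0 then sqrt (2 * w * Jv) *
        (if j = 1 then cos (ln Jv + w * \<tau>) else sin (ln Jv + w * \<tau>))
      else 0)"

definition es_rhs ::
  "nat \<Rightarrow> ('a::real_normed_vector \<Rightarrow> 'a) \<Rightarrow> (nat \<Rightarrow> nat \<Rightarrow> 'a) \<Rightarrow> (nat \<Rightarrow> real)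
   \<Rightarrow> ('a \<Rightarrow> real) \<Rightarrow> 'a \<Rightarrow> real \<Rightarrow> 'a \<Rightarrow> real \<Rightarrow> 'a" where
  "es_rhs r b0 b \<omega> J xs \<epsilon> xt \<tau> =
     b0 (xt + xs) + (1 / \<epsilon>) *\<^sub>R
       (\<Sum>i=1..r. \<Sum>j=1..2. es_u (\<omega> i) (J (xt + xs)) \<tau> j *\<^sub>R b i j)"

definition sol_dom :: "ereal \<Rightarrow> real set" where
  "sol_dom ts = {t. 0 \<le> t \<and> ereal t < ts}"

definition es_solution ::
  "nat \<Rightarrow> ('a::real_normed_vector \<Rightarrow> 'a) \<Rightarrow> (nat \<Rightarrow> nat \<Rightarrow> 'a) \<Rightarrow> (nat \<Rightarrow> real)
   \<Rightarrow> ('a \<Rightarrow> real) \<Rightarrow> 'a \<Rightarrow> real \<Rightarrow> 'a \<Rightarrow> real \<Rightarrow> ereal \<Rightarrow> (real \<Rightarrow> 'a) \<Rightarrow> (real \<Rightarrow> real) \<Rightarrow> bool"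
  where
  "es_solution r b0 b \<omega> J xs \<epsilon> x0 \<tau>0 ts x \<tau> \<longleftrightarrow>
     0 < ts \<and> x 0 = x0 \<and> \<tau> 0 = \<tau>0 \<and>
     continuous_on (sol_dom ts) (\<lambda>t. es_rhs r b0 b \<omega> J xs \<epsilon> (x t) (\<tau> t)) \<and>
     (\<forall>t\<in>sol_dom ts.
        (x has_vector_derivative es_rhs r b0 b \<omega> J xs \<epsilon> (x t) (\<tau> t)) (at t within sol_dom ts) \<and>
        (\<tau> has_vector_derivative 1 / \<epsilon>\<^sup>2) (at t within sol_dom ts))"

text \<open>Stability notions for a family (indexed by epsilon) of solution predicates
  sol eps x0 tau0 ts x tau.  "Defined for all t >= 0" is rendered as: every solution
  extends to a solution on [0, infinity).\<close>

definition sol_global ::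
  "(real \<Rightarrow> 'a \<Rightarrow> real \<Rightarrow> ereal \<Rightarrow> (real \<Rightarrow> 'a) \<Rightarrow> (real \<Rightarrow> real) \<Rightarrow> bool) \<Rightarrow> real \<Rightarrow> 'a \<Rightarrow> real
   \<Rightarrow> ereal \<Rightarrow> (real \<Rightarrow> 'a) \<Rightarrow> (real \<Rightarrow> real) \<Rightarrow> bool" where
  "sol_global sol \<epsilon> x0 \<tau>0 ts x \<tau> \<longleftrightarrow>
     (\<exists>x' \<tau>'. sol \<epsilon> x0 \<tau>0 \<infinity> x' \<tau>' \<and> (\<forall>t\<in>sol_dom ts. x' t = x t \<and> \<tau>' t = \<tau> t))"

definition UGUB ::
  "(real \<Rightarrow> 'a::real_normed_vector \<Rightarrow> real \<Rightarrow> ereal \<Rightarrow> (real \<Rightarrow> 'a) \<Rightarrow> (real \<Rightarrow> real) \<Rightarrow> bool)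
   \<Rightarrow> real \<Rightarrow> bool" where
  "UGUB sol \<Delta> \<longleftrightarrow>
     (\<exists>\<beta>. class_KL \<beta> \<and> (\<exists>\<epsilon>s>0. \<forall>\<epsilon>. 0 < \<epsilon> \<and> \<epsilon> < \<epsilon>s \<longrightarrow>
        (\<forall>x0 \<tau>0 ts x \<tau>. \<tau>0 \<ge> 0 \<and> sol \<epsilon> x0 \<tau>0 ts x \<tau> \<longrightarrow>
           sol_global sol \<epsilon> x0 \<tau>0 ts x \<tau> \<and>
           (\<forall>t\<in>sol_dom ts. norm (x t) \<le> \<beta> (norm x0) t + \<Delta>))))"

definition UGPAS ::
  "(real \<Rightarrow> 'a::real_normed_vector \<Rightarrow> real \<Rightarrow> ereal \<Rightarrow> (real \<Rightarrow> 'a) \<Rightarrow> (real \<Rightarrow> real) \<Rightarrow> bool)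
   \<Rightarrow> bool" where
  "UGPAS sol \<longleftrightarrow>
     (\<exists>\<beta>. class_KL \<beta> \<and> (\<forall>\<nu>>0. \<exists>\<epsilon>s>0. \<forall>\<epsilon>. 0 < \<epsilon> \<and> \<epsilon> < \<epsilon>s \<longrightarrow>
        (\<forall>x0 \<tau>0 ts x \<tau>. \<tau>0 \<ge> 0 \<and> sol \<epsilon> x0 \<tau>0 ts x \<tau> \<longrightarrow>
           sol_global sol \<epsilon> x0 \<tau>0 ts x \<tau> \<and>
           (\<forall>t\<in>sol_dom ts. norm (x t) \<le> \<beta> (norm x0) t + \<nu>))))"

end

theory Submission
  imports Defs "HOL-Complex_Analysis.Great_Picard"
begin

text \<open>The excess cost \<open>V = J - J xs\<close> is a practical Lyapunov function. Over a time window in which \<open>\<tau>\<close>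
  runs through one common period \<open>P\<close> of the excitations, the first-order displacement cancels; subtracting
  the corrector \<open>\<epsilon> sqrt J R(ln J, \<tau>)\<close> from the state leaves a derivative whose mean, tested against the gradient
  \<open>g\<close> at the start of the window, is \<open>g \<bullet> b0\<close> minus the sum of the \<open>(b i j \<bullet> g)\<^sup>2\<close>. Hence over one window \<open>V\<close>
  decreases by at least \<open>\<epsilon>\<^sup>2 P (\<gamma> - \<kappa>) |g|\<^sup>2\<close> up to an error \<open>O(\<epsilon>\<^sup>3 V)\<close>. Only the scalar \<open>J\<close> is
  differentiated in the controls, so no Hessian enters and Lipschitz continuity of the gradient suffices.
  The estimate needs \<open>J\<close> comparable to \<open>V\<close> from below, which holds for all \<open>V > 0\<close> if \<open>J xs \<ge> 0\<close>, and otherwise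
  once \<open>V\<close> is large. The lower bound on the gradient turns this into exponential decay above every level of \<open>V\<close>,
  with a rate depending on the level. The right-hand side is continuous with linear growth but, if \<open>J xs < 0\<close>,
  not Lipschitz where \<open>J\<close> vanishes, so solutions are continued by Peano's theorem.\<close>

section \<open>Functions with Lipschitz gradient\<close>

text \<open>The threshold for \<open>\<epsilon>\<close> must be the same for all initial states, so
  every estimate over a window has to be homogeneous. With \<open>v\<close> the value of
  \<open>V\<close> at its start, the gradient, \<open>b0\<close> and \<open>sqrt J\<close> are at
  most a constant times \<open>sqrt v\<close>, and the phase \<open>ln J\<close> responds only to
  relative changes of \<open>J\<close>. Hence all errors in \<open>J\<close> are a power of
  \<open>\<epsilon>\<close> times \<open>v\<close>, whatever the size of the state. The squares
  \<open>(b i j \<bullet> g)\<^sup>2\<close> are the mean of a product: the derivative of the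
  corrected state contains \<open>(G \<bullet> S) N\<close> with \<open>N = R/2 + R_y\<close>. With
  gradient and phase frozen, the part with \<open>R/2\<close> is a total derivative in
  \<open>\<tau>\<close> and averages out; in the part with \<open>R_y\<close> distinct frequencies
  are orthogonal and equal ones leave the squares. The gain beats the error only where the squared
  gradient dominates \<open>v\<close>, and this ratio may degenerate near \<open>xs\<close>. One
  comparison function still serves all accuracies: a threshold found for the accuracy
  \<open>\<nu>\<close> is valid at once for every coarser resolution \<open>d\<close>, and
  \<open>\<beta>\<close> is built from the infimum over all \<open>d\<close>.\<close>

lemma gradient_Lipschitz:
  fixes G :: "'a::euclidean_space \<Rightarrow> 'a"
  assumes "\<And>x. (G has_derivative blinfun_apply (H x)) (at x)" "\<And>x. norm (H x) \<le> L"
  shows "norm (G x - G y) \<le> L * norm (x - y)"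
proof -
  have "onorm (blinfun_apply (H z)) \<le> L" for z
    using assms(2)[of z] by (simp add: norm_blinfun.rep_eq)
  then show ?thesis
    using differentiable_bound[of UNIV G "\<lambda>z. blinfun_apply (H z)" L x y] assms(1) by simp
qed

text \<open>The function \<open>F z = J z - G x \<bullet> z\<close> has gradient
  \<open>G z - G x\<close>, of norm at most \<open>L * norm (y - x)\<close> on the segment. The mean
  value inequality yields \<open>L\<close> where integration along the segment would yield
  \<open>L / 2\<close>; only later constants are affected.\<close>

lemma descent_bound:
  fixes J :: "'a::euclidean_space \<Rightarrow> real"
  assumes J: "\<And>x. (J has_derivative (\<lambda>h. G x \<bullet> h)) (at x)"
    and G: "\<And>x y. norm (G x - G y) \<le> L * norm (x - y)"
  shows "\<bar>J y - J x - G x \<bullet> (y - x)\<bar> \<le> L * (norm (y - x))\<^sup>2"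
proof -
  define F where "F = (\<lambda>z. J z - G x \<bullet> z)"
  have dF: "(F has_derivative (\<lambda>h. (G z - G x) \<bullet> h)) (at z)" for z
    unfolding F_def inner_diff_left by (intro derivative_intros J)
  have L: "0 \<le> L * norm (y - x)" using G[of y x] norm_ge_zero order_trans by blast
  have "norm (F y - F x) \<le> (L * norm (y - x)) * norm (y - x)"
  proof (rule differentiable_bound[of "closed_segment x y" F "\<lambda>z h. (G z - G x) \<bullet> h"])
    fix z assume z: "z \<in> closed_segment x y"
    show "(F has_derivative (\<lambda>h. (G z - G x) \<bullet> h)) (at z within closed_segment x y)"
      using dF has_derivative_at_withinI by blast
    have "norm (z - x) \<le> norm (y - x)"
      using segment_bound(1)[OF z] by (simp add: norm_minus_commute)
    moreover have "0 \<le> L \<or> norm (y - x) = 0" using L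
      by (metis less_eq_real_def linorder_not_le mult_neg_pos norm_ge_zero)
    ultimately have "norm (G z - G x) \<le> L * norm (y - x)" using G[of z x]
      by (smt (verit) mult_left_mono norm_ge_zero norm_le_zero_iff)
    moreover have "\<bar>(G z - G x) \<bullet> h\<bar> \<le> norm (G z - G x) * norm h" for h
      by (rule Cauchy_Schwarz_ineq2)
    ultimately show "onorm (\<lambda>h. (G z - G x) \<bullet> h) \<le> L * norm (y - x)"
      by (intro onorm_le) (smt (verit, best) mult_right_mono norm_ge_zero real_norm_def)
  qed auto
  then show ?thesis
    by (simp add: F_def inner_diff_right power2_eq_square algebra_simps)
qed

text \<open>A gradient step from \<open>x\<close> cannot fall below the minimum. The step length
  \<open>1 / (2 * L)\<close> minimises the quadratic upper bound that \<open>descent\<close> gives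
  for the new value.\<close>

lemma gradient_sq_le:
  fixes J :: "'a::euclidean_space \<Rightarrow> real"
  assumes descent: "\<And>x y. \<bar>J y - J x - G x \<bullet> (y - x)\<bar> \<le> L * (norm (y - x))\<^sup>2"
    and min: "\<And>x. J xs \<le> J x" and L: "L > 0"
  shows "(norm (G x))\<^sup>2 \<le> 4 * L * (J x - J xs)"
proof -
  define y where "y = x - (1 / (2 * L)) *\<^sub>R G x"
  have "\<bar>J y - J x - G x \<bullet> (y - x)\<bar> \<le> L * (norm (y - x))\<^sup>2" by (rule descent)
  moreover have "G x \<bullet> (y - x) = - (norm (G x))\<^sup>2 / (2 * L)"
    by (simp add: y_def power2_norm_eq_inner)
  moreover have "L * (norm (y - x))\<^sup>2 = (norm (G x))\<^sup>2 / (4 * L)"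
    using L by (simp add: y_def power2_eq_square field_simps)
  moreover have "J xs \<le> J y" by (rule min)
  ultimately have "(norm (G x))\<^sup>2 / (2 * L) - (norm (G x))\<^sup>2 / (4 * L) \<le> J x - J xs"
    by linarith
  then show ?thesis using L by (simp add: field_simps)
qed

section \<open>Decay estimates\<close>

text \<open>An infimum of functions affine in \<open>s\<close>: taking it over the resolution \<open>d\<close> turns decay rates
  that degenerate as \<open>d\<close> tends to 0 into a single class KL function.\<close>

lemma class_KL_INF:
  fixes A k :: "real \<Rightarrow> real"
  assumes A: "\<And>d. d > 0 \<Longrightarrow> A d > 0" and k: "\<And>d. d > 0 \<Longrightarrow> k d > 0"
  shows "class_KL (\<lambda>s t. (INF d\<in>{0<..}. d + A d * s * exp (- k d * t)) + s * exp (- t))"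
proof -
  define f where "f = (\<lambda>s t d. d + A d * s * exp (- k d * t))"
  define \<phi> where "\<phi> = (\<lambda>s t. INF d\<in>{0<..}. f s t d)"
  have f_pos: "0 < f s t d" if "0 \<le> s" "0 < d" for s t d
    using A[OF that(2)] that by (simp add: f_def add_pos_nonneg)
  have bdd: "bdd_below (f s t ` {0<..})" if "0 \<le> s" for s t
    using f_pos[OF that] by (intro bdd_belowI2[where m=0]) (auto intro: less_imp_le)
  have lower: "\<phi> s t \<le> f s t d" if "0 \<le> s" "0 < d" for s t d
    unfolding \<phi>_def using bdd[OF that(1)] that by (intro cINF_lower) auto
  have greatest: "m \<le> \<phi> s t" if "\<And>d. 0 < d \<Longrightarrow> m \<le> f s t d" for m s t
    unfolding \<phi>_def using that by (intro cINF_greatest) auto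
  have nonneg: "0 \<le> \<phi> s t" if "0 \<le> s" for s t
    using f_pos[OF that] by (intro greatest) (auto intro: less_imp_le)
  have mono: "\<phi> s t \<le> \<phi> s' t" if "0 \<le> s" "s \<le> s'" for s s' t
  proof (rule greatest)
    fix d :: real assume d: "0 < d"
    have "f s t d \<le> f s' t d"
      using A[OF d] that by (simp add: f_def mult_left_mono mult_right_mono)
    then show "\<phi> s t \<le> f s' t d" using lower[OF that(1) d] order_trans by blast
  qed
  have zero: "\<phi> 0 t = 0" for t
  proof (rule antisym)
    show "\<phi> 0 t \<le> 0"
      by (rule field_le_epsilon) (use lower[of 0] in \<open>auto simp: f_def\<close>)
  qed (rule nonneg, simp)
  \<comment> \<open>Each affine function has a nonnegative constant term, so scaling
    \<open>s\<close> by \<open>c\<close> scales it by at most \<open>c\<close>. Together with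
    monotonicity this bounds the relative change of \<open>\<phi>\<close>, which is continuity away
    from 0.\<close>
  have scale: "\<phi> (c * s) t \<le> c * \<phi> s t" if "1 \<le> c" "0 \<le> s" for c s t
  proof -
    have "\<phi> (c * s) t / c \<le> \<phi> s t"
    proof (rule greatest)
      fix d :: real assume d: "0 < d"
      have "\<phi> (c * s) t \<le> f (c * s) t d" using that d by (intro lower) auto
      also have "\<dots> \<le> c * f s t d" using that d by (simp add: f_def algebra_simps)
      finally show "\<phi> (c * s) t / c \<le> f s t d" using that by (simp add: field_simps)
    qed
    then show ?thesis using that by (simp add: field_simps)
  qed
  have cont_pos: "((\<lambda>s. \<phi> s t) \<longlongrightarrow> \<phi> s t) (at s within {0..})" if s: "0 < s" for s t
  proof -
    have bound: "\<bar>\<phi> s' t - \<phi> s t\<bar> \<le> \<bar>s' - s\<bar> * (\<phi> s t / s)" if s': "0 < s'" for s'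
    proof (cases "s \<le> s'")
      case True
      have "\<phi> s' t \<le> (s' / s) * \<phi> s t" using scale[of "s' / s" s t] s True by simp
      then show ?thesis using mono[of s s' t] True s by (simp add: field_simps)
    next
      case False
      have "\<phi> s t \<le> (s / s') * \<phi> s' t" using scale[of "s / s'" s' t] s' False by simp
      then have "(s' / s) * \<phi> s t \<le> \<phi> s' t" using s s' by (simp add: field_simps)
      then show ?thesis using mono[of s' s t] False s s' by (simp add: field_simps)
    qed
    have ev: "eventually (\<lambda>s'. 0 < s') (at s within {0..})"
      using s order_tendstoD(1)[OF tendsto_ident_at] by blast
    have lim0: "((\<lambda>s'. \<bar>s' - s\<bar> * (\<phi> s t / s)) \<longlongrightarrow> \<bar>s - s\<bar> * (\<phi> s t / s)) (at s within {0..})"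
      by (intro tendsto_intros)
    have "((\<lambda>s'. \<phi> s' t - \<phi> s t) \<longlongrightarrow> 0) (at s within {0..})"
      by (rule Lim_null_comparison[where g="\<lambda>s'. \<bar>s' - s\<bar> * (\<phi> s t / s)"])
        (use eventually_mono[OF ev bound] lim0 in simp_all)
    then show ?thesis using LIM_zero_iff by blast
  qed
  \<comment> \<open>The relative bound needs \<open>s > 0\<close>. At 0 the infimum is instead
    bounded by its member with resolution \<open>a / 2\<close>.\<close>
  have cont_zero: "((\<lambda>s. \<phi> s t) \<longlongrightarrow> \<phi> 0 t) (at 0 within {0..})" for t
  proof (rule order_tendstoI)
    fix a assume "a < \<phi> 0 t"
    then show "eventually (\<lambda>s. a < \<phi> s t) (at 0 within {0..})"
      unfolding zero eventually_at_filter
      by (intro always_eventually allI impI) (use nonneg less_le_trans in blast)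
  next
    fix a assume "\<phi> 0 t < a"
    then have a: "0 < a" by (simp add: zero)
    have "((\<lambda>s. f s t (a/2)) \<longlongrightarrow> f 0 t (a/2)) (at 0 within {0..})"
      unfolding f_def by (intro tendsto_intros)
    then have "eventually (\<lambda>s. f s t (a/2) < a) (at 0 within {0..})"
      by (rule order_tendstoD(2)) (use a in \<open>simp add: f_def\<close>)
    moreover have "eventually (\<lambda>s. s \<in> {0..}) (at 0 within {0::real..})"
      by (simp add: eventually_at_filter)
    ultimately show "eventually (\<lambda>s. \<phi> s t < a) (at 0 within {0..})"
      by eventually_elim (use le_less_trans[OF lower] a in \<open>metis atLeast_iff half_gt_zero\<close>)
  qed
  have cont: "continuous_on {0..} (\<lambda>s. \<phi> s t)" for t
    unfolding continuous_on_def
  proof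
    fix s :: real assume "s \<in> {0..}"
    then show "((\<lambda>s. \<phi> s t) \<longlongrightarrow> \<phi> s t) (at s within {0..})"
      using cont_pos[of s t] cont_zero[of t] by (cases "s = 0") auto
  qed
  have antimono: "\<phi> s t2 \<le> \<phi> s t1" if "0 \<le> s" "0 \<le> t1" "t1 \<le> t2" for s t1 t2
  proof (rule greatest)
    fix d :: real assume d: "0 < d"
    have "f s t2 d \<le> f s t1 d" unfolding f_def using A[OF d] k[OF d] that
      by (intro add_left_mono mult_left_mono) auto
    then show "\<phi> s t2 \<le> f s t1 d" using lower[OF that(1) d] order_trans by blast
  qed
  have lim: "((\<lambda>t. \<phi> s t) \<longlongrightarrow> 0) at_top" if s: "0 \<le> s" for s
  proof (rule order_tendstoI)
    fix a :: real assume "a < 0"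
    then show "eventually (\<lambda>t. a < \<phi> s t) at_top"
      by (intro always_eventually allI) (use nonneg[OF s] less_le_trans in blast)
  next
    fix a :: real assume a: "0 < a"
    have "filterlim (\<lambda>t. - k (a/2) * t) at_bot at_top"
      using k[of "a/2"] a by (simp add: filterlim_uminus_at_bot filterlim_tendsto_pos_mult_at_top[OF tendsto_const _ filterlim_ident])
    then have "((\<lambda>t. exp (- k (a/2) * t)) \<longlongrightarrow> 0) at_top"
      using exp_at_bot filterlim_compose by blast
    then have "((\<lambda>t. f s t (a/2)) \<longlongrightarrow> a/2 + A (a/2) * s * 0) at_top"
      unfolding f_def by (intro tendsto_intros)
    then have "eventually (\<lambda>t. f s t (a/2) < a) at_top"
      by (rule order_tendstoD(2)) (use a in simp)
    then show "eventually (\<lambda>t. \<phi> s t < a) at_top"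
      by eventually_elim (use le_less_trans[OF lower[OF s]] a in \<open>metis half_gt_zero\<close>)
  qed
  have lim2: "((\<lambda>t. s * exp (- t)) \<longlongrightarrow> 0) at_top" for s :: real
  proof -
    have "((\<lambda>t::real. exp (- t)) \<longlongrightarrow> 0) at_top"
      using exp_at_bot filterlim_uminus_at_bot_at_top filterlim_compose by blast
    then show ?thesis using tendsto_mult_right_zero by blast
  qed
  \<comment> \<open>The infimum is only known to be nondecreasing in \<open>s\<close>; the added
    \<open>s * exp (- t)\<close> makes the sum strictly increasing.\<close>
  have "class_KL (\<lambda>s t. \<phi> s t + s * exp (- t))"
    unfolding class_KL_def class_K_def
  proof (intro conjI allI impI)
    fix t :: real
    show "continuous_on {0..} (\<lambda>s. \<phi> s t + s * exp (- t))"
      by (intro continuous_intros cont)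
    show "strict_mono_on {0..} (\<lambda>s. \<phi> s t + s * exp (- t))"
      by (intro strict_mono_onI add_le_less_mono mono) auto
  next
    fix s t1 t2 :: real assume "0 \<le> s" "0 \<le> t1 \<and> t1 \<le> t2"
    then show "\<phi> s t2 + s * exp (- t2) \<le> \<phi> s t1 + s * exp (- t1)"
      by (intro add_mono antimono mult_left_mono) auto
  next
    fix s :: real assume "0 \<le> s"
    then show "((\<lambda>t. \<phi> s t + s * exp (- t)) \<longlongrightarrow> 0) at_top"
      using tendsto_add[OF lim lim2] by simp
  qed (simp add: zero)
  then show ?thesis by (simp add: \<phi>_def f_def)
qed

text \<open>Complete windows contract by \<open>exp (- k * T)\<close>. The incomplete last window
  costs a factor 2 by \<open>growth\<close>, and expressing the decay by \<open>t - a\<close>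
  instead of the time covered by complete windows costs at most \<open>exp (k * T)\<close>, again at
  most 2; hence the 4.\<close>

lemma window_decay_iterate:
  fixes V :: "real \<Rightarrow> real"
  assumes T: "T > 0" and a: "a \<le> t"
    and growth: "\<And>s u. a \<le> s \<Longrightarrow> s \<le> u \<Longrightarrow> u \<le> t \<Longrightarrow> u \<le> s + T \<Longrightarrow> V u \<le> 2 * V s"
    and decay: "\<And>s. a \<le> s \<Longrightarrow> s + T \<le> t \<Longrightarrow> V (s + T) \<le> exp (- k * T) * V s"
    and V0: "V a \<ge> 0" and k: "k \<ge> 0" "exp (k * T) \<le> 2"
  shows "V t \<le> 2 * V a" "V t \<le> 4 * exp (- k * (t - a)) * V a"
proof -
  have step: "V (a + real n * T) \<le> exp (- k * (real n * T)) * V a" if "a + real n * T \<le> t" for n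
    using that
  proof (induction n)
    case (Suc n)
    have le: "a + real n * T + T \<le> t" using Suc.prems by (simp add: algebra_simps)
    have "V (a + real (Suc n) * T) = V (a + real n * T + T)" by (simp add: algebra_simps)
    also have "\<dots> \<le> exp (- k * T) * V (a + real n * T)"
      using T le by (intro decay) auto
    also have "\<dots> \<le> exp (- k * T) * (exp (- k * (real n * T)) * V a)"
      using Suc.IH le T by (intro mult_left_mono) auto
    also have "\<dots> = exp (- k * (real (Suc n) * T)) * V a"
      by (simp add: exp_add[symmetric] mult.assoc[symmetric] del: of_nat_Suc) (simp add: algebra_simps)
    finally show ?case .
  qed simp
  define n where "n = nat \<lfloor>(t - a) / T\<rfloor>"
  have "real n = real_of_int \<lfloor>(t - a) / T\<rfloor>" using T a by (simp add: n_def)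
  then have "real n \<le> (t - a) / T" "(t - a) / T < real n + 1" by linarith+
  then have n: "a + real n * T \<le> t" "t \<le> a + real n * T + T"
    using T by (simp_all add: field_simps)
  have "V t \<le> 2 * V (a + real n * T)" using n T by (intro growth) auto
  also have "\<dots> \<le> 2 * (exp (- k * (real n * T)) * V a)" using step[OF n(1)] by simp
  finally have *: "V t \<le> 2 * exp (- k * (real n * T)) * V a" by simp
  have "exp (- k * (real n * T)) \<le> 1" using k(1) T by simp
  then show "V t \<le> 2 * V a" using * V0 mult_right_mono[of "exp (- k * (real n * T))" 1 "V a"] by linarith
  have "- k * (real n * T) \<le> k * T + - k * (t - a)"
    using n(2) k(1) mult_left_mono[of "t - a" "real n * T + T" k] by (simp add: algebra_simps)
  then have "exp (- k * (real n * T)) \<le> exp (k * T) * exp (- k * (t - a))"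
    by (simp flip: exp_add)
  also have "\<dots> \<le> 2 * exp (- k * (t - a))" using k(2) by simp
  finally show "V t \<le> 4 * exp (- k * (t - a)) * V a"
    using * V0 mult_right_mono[of "exp (- k * (real n * T))" "2 * exp (- k * (t - a))" "V a"] by linarith
qed

text \<open>If \<open>V\<close> never drops to \<open>M\<close>, the exponential estimate runs from
  time 0. Otherwise it restarts at the last time \<open>a\<close> with \<open>V a \<le> M\<close>,
  and only the overshoot factor 2 above \<open>M\<close> remains.\<close>

lemma window_decay:
  fixes V :: "real \<Rightarrow> real"
  assumes T: "T > 0" and t: "0 \<le> t" and M: "M > 0"
    and cont: "continuous_on {0..t} V"
    and growth: "\<And>s u. 0 \<le> s \<Longrightarrow> s \<le> u \<Longrightarrow> u \<le> t \<Longrightarrow> u \<le> s + T \<Longrightarrow> M \<le> V s \<Longrightarrow> V u \<le> 2 * V s"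
    and decay: "\<And>s. 0 \<le> s \<Longrightarrow> s + T \<le> t \<Longrightarrow> M \<le> V s \<Longrightarrow> V (s + T) \<le> exp (- k * T) * V s"
    and k: "k \<ge> 0" "exp (k * T) \<le> 2"
  shows "V t \<le> 2 * M \<or> V t \<le> 4 * exp (- k * t) * V 0"
proof (cases "\<exists>s\<in>{0..t}. V s \<le> M")
  case True
  define S where "S = {0..t} \<inter> V -` {..M}"
  have "closed S" unfolding S_def
    using continuous_closed_preimage[OF cont] by auto
  then have "compact S" by (simp add: compact_eq_bounded_closed S_def bounded_Int)
  moreover have "S \<noteq> {}" using True by (auto simp: S_def)
  ultimately obtain a where a: "a \<in> S" "\<And>s. s \<in> S \<Longrightarrow> s \<le> a"
    using compact_attains_sup by metis
  then have aI: "0 \<le> a" "a \<le> t" "V a \<le> M" by (auto simp: S_def)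
  have above: "M < V s" if "a < s" "s \<le> t" for s
    using a(2)[of s] that aI by (force simp: S_def)
  show ?thesis
  proof (cases "a = t")
    case True then show ?thesis using aI M by simp
  next
    case False
    then have lt: "a < t" using aI by simp
    \<comment> \<open>Equality matters: \<open>growth\<close> and \<open>decay\<close> are available
      only from times with \<open>M \<le> V s\<close>, and the iteration has to start at
      \<open>a\<close> itself.\<close>
    have Ma: "V a = M"
    proof (rule ccontr)
      assume "V a \<noteq> M"
      then have "V a < M" using aI by simp
      moreover have "(V \<longlongrightarrow> V a) (at a within {0..t})"
        using cont aI by (simp add: continuous_on_def)
      ultimately have "eventually (\<lambda>s. V s < M) (at a within {0..t})"
        using order_tendstoD(2) by blast
      then have "eventually (\<lambda>s. V s < M) (at a within {a..t})"
        by (rule filter_leD[OF at_le, rotated]) (use aI in auto)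
      moreover have "eventually (\<lambda>s. a < s \<and> s \<le> t) (at a within {a..t})"
        by (auto simp: eventually_at_filter)
      ultimately have "eventually (\<lambda>s. False) (at a within {a..t})"
        by eventually_elim (use above in force)
      moreover have "at a within {a..t} \<noteq> bot"
        using lt by (simp add: at_within_Icc_at_right)
      ultimately show False by simp
    qed
    have ge: "M \<le> V s" if "a \<le> s" "s \<le> t" for s
      using above[of s] that Ma by (cases "s = a") auto
    have "V t \<le> 2 * V a"
      by (rule window_decay_iterate(1)[OF T aI(2), where k=k])
        (use aI ge T M k Ma growth decay in \<open>auto simp del: mult_minus_left\<close>)
    then show ?thesis using Ma by simp
  qed
next
  case False
  then have ge: "M \<le> V s" if "0 \<le> s" "s \<le> t" for s using that by (meson atLeastAtMost_iff le_cases)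
  have V0: "0 \<le> V 0" using ge[of 0] t M by linarith
  have "V t \<le> 4 * exp (- k * (t - 0)) * V 0"
    by (rule window_decay_iterate(2)[OF T t, where k=k])
      (use ge T M k t V0 growth decay in \<open>auto simp del: mult_minus_left\<close>)
  then show ?thesis by simp
qed

section \<open>Global solutions under linear growth\<close>

lemma continuous_on_comp_field:
  fixes f :: "real \<Rightarrow> 'a::euclidean_space \<Rightarrow> 'a"
  assumes "continuous_on UNIV (\<lambda>(t, x). f t x)" "continuous_on S z"
  shows "continuous_on S (\<lambda>s. f s (z s))"
proof -
  have "continuous_on S (\<lambda>s. (s, z s))" by (intro continuous_on_Pair continuous_on_id assms(2))
  from continuous_on_compose2[OF assms(1) this] show ?thesis by simp
qed

text \<open>Tonelli's delayed approximations: the iterates become stationary on \<open>[a, a + n \<eta>]\<close> after \<open>n\<close> steps.\<close>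

lemma delayed_solution:
  fixes f :: "real \<Rightarrow> 'a::euclidean_space \<Rightarrow> 'a"
  assumes cont: "continuous_on UNIV (\<lambda>(t, x). f t x)" and \<eta>: "\<eta> > 0"
  shows "\<exists>z. continuous_on {a..b} z \<and> (\<forall>t\<in>{a..b}. z t = p + integral {a..t} (\<lambda>s. f s (z (max a (s - \<eta>)))))"
proof -
  define y where "y = rec_nat (\<lambda>_. p) (\<lambda>n g t. p + integral {a..t} (\<lambda>s. f s (g (max a (s - \<eta>)))))"
  have y0: "y 0 = (\<lambda>_. p)" and ySuc: "y (Suc n) = (\<lambda>t. p + integral {a..t} (\<lambda>s. f s (y n (max a (s - \<eta>)))))" for n
    by (simp_all add: y_def)
  have c: "continuous_on {a..c} (y n)" for n c
  proof (induction n)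
    case 0 then show ?case by (simp add: y0)
  next
    case (Suc n)
    have "continuous_on {a..c} (\<lambda>s. y n (max a (s - \<eta>)))"
      by (rule continuous_on_compose2[OF Suc]) (use \<eta> in \<open>auto intro!: continuous_intros\<close>)
    then have "(\<lambda>s. f s (y n (max a (s - \<eta>)))) integrable_on {a..c}"
      by (intro integrable_continuous_real continuous_on_comp_field[OF cont])
    then show ?case unfolding ySuc
      by (intro continuous_intros indefinite_integral_continuous_1)
  qed
  have agree: "y (Suc n) t = y n t" if "a \<le> t" "t \<le> a + real n * \<eta>" for n t
    using that
  proof (induction n arbitrary: t)
    case 0 then show ?case by (simp add: ySuc y0)
  next
    case (Suc n)
    \<comment> \<open>The delay moves the argument back by \<open>\<eta>\<close>, into the interval
      on which the induction hypothesis already gives agreement.\<close>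
    have "y (Suc n) (max a (s - \<eta>)) = y n (max a (s - \<eta>))" if "s \<in> {a..t}" for s
      using that Suc.prems \<eta> by (intro Suc.IH) (auto simp: algebra_simps)
    then have "integral {a..t} (\<lambda>s. f s (y (Suc n) (max a (s - \<eta>)))) = integral {a..t} (\<lambda>s. f s (y n (max a (s - \<eta>))))"
      by (intro integral_cong) simp
    then show ?case by (simp only: ySuc[of "Suc n"] ySuc[of n])
  qed
  obtain N :: nat where N: "(b - a) / \<eta> \<le> real N" using real_arch_simple by blast
  have "y N t = p + integral {a..t} (\<lambda>s. f s (y N (max a (s - \<eta>))))" if "t \<in> {a..b}" for t
  proof -
    have "t \<le> a + real N * \<eta>" using N that \<eta> by (simp add: field_simps)
    then show ?thesis using agree[of t N] that by (simp add: ySuc)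
  qed
  then show ?thesis using c by blast
qed

text \<open>A short-time substitute for Gronwall: with \<open>m\<close> the maximum of the norm in
  \<open>grow\<close>, the condition \<open>C * (b - a) \<le> 1 / 2\<close> lets half of
  \<open>m\<close> be absorbed on the left. The premise \<open>grow\<close> is abstract so that the
  lemma serves both delayed approximations and a given solution.\<close>

lemma norm_bound_of_linear_growth:
  fixes z :: "real \<Rightarrow> 'a::real_normed_vector"
  assumes z: "continuous_on {a..b} z" and ab: "a \<le> b" and C: "C \<ge> 0" "C * (b - a) \<le> 1 / 2"
    and grow: "\<And>m s. (\<And>u. u \<in> {a..b} \<Longrightarrow> norm (z u) \<le> m) \<Longrightarrow> s \<in> {a..b} \<Longrightarrow> norm (z s) \<le> norm p + C * (1 + m) * (b - a)"
    and s: "s \<in> {a..b}"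
  shows "norm (z s) \<le> 2 * norm p + 1"
proof -
  have "continuous_on {a..b} (\<lambda>s. norm (z s))" using z by (intro continuous_intros)
  then obtain u where u: "u \<in> {a..b}" "\<And>v. v \<in> {a..b} \<Longrightarrow> norm (z v) \<le> norm (z u)"
    using continuous_attains_sup[of "{a..b}" "\<lambda>s. norm (z s)"] ab by auto
  define n where "n = norm (z u)"
  have "n \<le> norm p + C * (1 + n) * (b - a)" unfolding n_def using grow u by blast
  also have "C * (1 + n) * (b - a) = (C * (b - a)) * (1 + n)" by simp
  finally have 1: "n \<le> norm p + (C * (b - a)) * (1 + n)" .
  have "(C * (b - a)) * (1 + n) \<le> 1 / 2 * (1 + n)" using C by (intro mult_right_mono) (auto simp: n_def)
  with 1 have "n \<le> norm p + 1 / 2 * (1 + n)" using order_trans add_left_mono by meson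
  then have "norm (z u) \<le> 2 * norm p + 1" unfolding n_def by (simp add: field_simps)
  then show ?thesis using u(2)[OF s] by linarith
qed

text \<open>The delayed approximations are bounded and equi-Lipschitz, so a subsequence converges
  uniformly. The admissible length of the interval depends on \<open>C\<close> but not on
  \<open>p\<close>, and this makes indefinite continuation possible.\<close>

lemma Peano_local:
  fixes f :: "real \<Rightarrow> 'a::euclidean_space \<Rightarrow> 'a"
  assumes cont: "continuous_on UNIV (\<lambda>(t, x). f t x)"
    and growth: "\<And>t x. norm (f t x) \<le> C * (1 + norm x)" and C: "C > 0"
    and ab: "a \<le> b" "C * (b - a) \<le> 1 / 2"
  shows "\<exists>z. continuous_on {a..b} z \<and> (\<forall>t\<in>{a..b}. z t = p + integral {a..t} (\<lambda>s. f s (z s)))"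
proof -
  define \<eta> where "\<eta> = (\<lambda>n::nat. inverse (real (Suc n)))"
  have \<eta>: "\<eta> n > 0" for n by (simp add: \<eta>_def)
  obtain z where z: "\<And>n. continuous_on {a..b} (z n)"
    "\<And>n t. t \<in> {a..b} \<Longrightarrow> z n t = p + integral {a..t} (\<lambda>s. f s (z n (max a (s - \<eta> n))))"
    using delayed_solution[OF cont \<eta>, of a b p] by metis
  have cF: "continuous_on {a..b} (\<lambda>s. f s (z n (max a (s - \<eta> n))))" for n
    by (intro continuous_on_comp_field[OF cont] continuous_on_compose2[OF z(1)[of n]])
      (use \<eta>[of n] in \<open>auto intro!: continuous_intros\<close>)
  have del: "max a (s - \<eta> n) \<in> {a..b}" if "s \<in> {a..b}" for s n using that \<eta>[of n] by auto
  have bound: "norm (z n s) \<le> 2 * norm p + 1" if s: "s \<in> {a..b}" for n s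
  proof (rule norm_bound_of_linear_growth[OF z(1) ab(1) less_imp_le[OF C] ab(2) _ s])
    fix m s assume m: "\<And>u. u \<in> {a..b} \<Longrightarrow> norm (z n u) \<le> m" and s: "s \<in> {a..b}"
    have "norm (integral {a..s} (\<lambda>s. f s (z n (max a (s - \<eta> n))))) \<le> C * (1 + m) * (s - a)"
    proof (rule integral_bound)
      fix u assume u: "u \<in> {a..s}"
      have "norm (f u (z n (max a (u - \<eta> n)))) \<le> C * (1 + norm (z n (max a (u - \<eta> n))))" by (rule growth)
      also have "\<dots> \<le> C * (1 + m)" using C m[OF del[of u n]] u s by simp
      finally show "norm (f u (z n (max a (u - \<eta> n)))) \<le> C * (1 + m)" .
    qed (use s continuous_on_subset[OF cF] in auto)
    moreover have "0 \<le> m" using m[OF s] norm_ge_zero order_trans by blast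
    then have "C * (1 + m) * (s - a) \<le> C * (1 + m) * (b - a)" using s C by (intro mult_left_mono) auto
    ultimately show "norm (z n s) \<le> norm p + C * (1 + m) * (b - a)"
      unfolding z(2)[OF s] using norm_triangle_ineq[of p] by (smt (verit))
  qed
  define K where "K = C * (2 * norm p + 2)"
  have K: "0 < K" using C by (simp add: K_def add_nonneg_pos)
  have FK: "norm (f s (z n (max a (s - \<eta> n)))) \<le> K" if "s \<in> {a..b}" for s n
  proof -
    have "norm (f s (z n (max a (s - \<eta> n)))) \<le> C * (1 + norm (z n (max a (s - \<eta> n))))" by (rule growth)
    also have "\<dots> \<le> K" unfolding K_def using C bound[OF del[OF that], of n n] by (intro mult_left_mono) auto
    finally show ?thesis .
  qed
  have lip1: "norm (z n t - z n s) \<le> K * (t - s)" if "s \<in> {a..b}" "t \<in> {a..b}" "s \<le> t" for n s t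
  proof -
    have "integral {a..s} (\<lambda>s. f s (z n (max a (s - \<eta> n)))) + integral {s..t} (\<lambda>s. f s (z n (max a (s - \<eta> n))))
        = integral {a..t} (\<lambda>s. f s (z n (max a (s - \<eta> n))))"
      using that by (intro Henstock_Kurzweil_Integration.integral_combine integrable_continuous_real continuous_on_subset[OF cF]) auto
    then have "z n t - z n s = integral {s..t} (\<lambda>s. f s (z n (max a (s - \<eta> n))))"
      unfolding z(2)[OF that(1)] z(2)[OF that(2)] by (simp add: algebra_simps)
    moreover have "norm (integral {s..t} (\<lambda>s. f s (z n (max a (s - \<eta> n))))) \<le> K * (t - s)"
      using that by (intro integral_bound continuous_on_subset[OF cF] FK) auto
    ultimately show ?thesis by simp
  qed
  have lip: "norm (z n t - z n s) \<le> K * \<bar>t - s\<bar>" if "s \<in> {a..b}" "t \<in> {a..b}" for n s t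
    using lip1[of s t n] lip1[of t s n] that by (cases "s \<le> t") (auto simp: norm_minus_commute)
  obtain g k where g: "continuous_on {a..b} g" and k: "strict_mono (k :: nat \<Rightarrow> nat)"
    and conv: "\<And>e. 0 < e \<Longrightarrow> \<exists>N. \<forall>n x. n \<ge> N \<and> x \<in> {a..b} \<longrightarrow> norm (z (k n) x - g x) < e"
  proof (rule Arzela_Ascoli[of "{a..b}" z "2 * norm p + 1"])
    fix x e :: real assume x: "x \<in> {a..b}" and e: "0 < e"
    show "\<exists>d>0. \<forall>n y. y \<in> {a..b} \<and> norm (x - y) < d \<longrightarrow> norm (z n x - z n y) < e"
    proof (intro exI[of _ "e / K"] conjI allI impI)
      fix n y assume y: "y \<in> {a..b} \<and> norm (x - y) < e / K"
      then have "K * \<bar>x - y\<bar> < e" using K by (simp add: field_simps)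
      then show "norm (z n x - z n y) < e" using lip[of y x n] x y by simp
    qed (use e K in simp)
  qed (use bound in auto)
  have conv1: "(\<lambda>n. z (k n) s) \<longlonglongrightarrow> g s" if "s \<in> {a..b}" for s
    using conv that by (intro LIMSEQ_I) blast
  have \<eta>lim: "(\<lambda>n. \<eta> (k n)) \<longlonglongrightarrow> 0"
    using LIMSEQ_subseq_LIMSEQ[OF LIMSEQ_inverse_real_of_nat k] by (simp add: \<eta>_def o_def)
  \<comment> \<open>By the common Lipschitz constant \<open>K\<close> the vanishing delay displaces
    the approximations by at most \<open>K * \<eta> (k n)\<close>, so it does not affect the
    limit.\<close>
  have conv2: "(\<lambda>n. z (k n) (max a (s - \<eta> (k n)))) \<longlonglongrightarrow> g s" if s: "s \<in> {a..b}" for s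
  proof -
    have "(\<lambda>n. z (k n) (max a (s - \<eta> (k n))) - z (k n) s) \<longlonglongrightarrow> 0"
    proof (rule Lim_null_comparison)
      show "\<forall>\<^sub>F n in sequentially. norm (z (k n) (max a (s - \<eta> (k n))) - z (k n) s) \<le> K * \<eta> (k n)"
      proof (intro always_eventually allI)
        fix n
        have "\<bar>max a (s - \<eta> (k n)) - s\<bar> \<le> \<eta> (k n)" using s \<eta>[of "k n"] by auto
        then show "norm (z (k n) (max a (s - \<eta> (k n))) - z (k n) s) \<le> K * \<eta> (k n)"
          using lip[OF s del[OF s, of "k n"], of "k n"] K mult_left_mono[of _ "\<eta> (k n)" K] by (smt (verit))
      qed
      show "(\<lambda>n. K * \<eta> (k n)) \<longlonglongrightarrow> 0" using tendsto_mult_right_zero[OF \<eta>lim] by simp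
    qed
    from tendsto_add[OF this conv1[OF s]] show ?thesis by simp
  qed
  have "g t = p + integral {a..t} (\<lambda>s. f s (g s))" if t: "t \<in> {a..b}" for t
  proof -
    have "(\<lambda>n. integral {a..t} (\<lambda>s. f s (z (k n) (max a (s - \<eta> (k n)))))) \<longlonglongrightarrow> integral {a..t} (\<lambda>s. f s (g s))"
    proof (rule dominated_convergence(2)[where h="\<lambda>_. K"])
      fix n show "(\<lambda>s. f s (z (k n) (max a (s - \<eta> (k n))))) integrable_on {a..t}"
        using t by (intro integrable_continuous_real continuous_on_subset[OF cF]) auto
    next
      fix s assume s: "s \<in> {a..t}"
      have "continuous_on UNIV (f s)"
        using continuous_on_compose2[OF cont continuous_on_Pair[OF continuous_on_const[of UNIV s] continuous_on_id]] by simp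
      then have "isCont (f s) (g s)" by (simp add: continuous_on_eq_continuous_at)
      then show "(\<lambda>n. f s (z (k n) (max a (s - \<eta> (k n))))) \<longlonglongrightarrow> f s (g s)"
        using conv2[of s] s t by (intro isCont_tendsto_compose[of _ "f s"]) auto
    qed (use FK t in \<open>auto intro: integrable_const_ivl\<close>)
    then have "(\<lambda>n. p + integral {a..t} (\<lambda>s. f s (z (k n) (max a (s - \<eta> (k n)))))) \<longlonglongrightarrow> p + integral {a..t} (\<lambda>s. f s (g s))"
      by (intro tendsto_intros)
    then have "(\<lambda>n. z (k n) t) \<longlonglongrightarrow> p + integral {a..t} (\<lambda>s. f s (g s))"
      by (simp only: z(2)[OF t, symmetric])
    then show ?thesis using LIMSEQ_unique[OF conv1[OF t]] by blast
  qed
  then show ?thesis using g by blast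
qed

text \<open>The integral form lets two pieces be joined by additivity of the integral, without
  one-sided derivatives at the joint.\<close>

definition integral_solution :: "(real \<Rightarrow> 'a::euclidean_space \<Rightarrow> 'a) \<Rightarrow> real \<Rightarrow> (real \<Rightarrow> 'a) \<Rightarrow> bool" where
  "integral_solution f b x \<longleftrightarrow> continuous_on {0..b} x \<and> (\<forall>t\<in>{0..b}. x t = x 0 + integral {0..t} (\<lambda>s. f s (x s)))"

lemma integral_solution_cong:
  assumes "integral_solution f b x" "0 \<le> b" "\<And>t. t \<in> {0..b} \<Longrightarrow> y t = x t"
  shows "integral_solution f b y"
  unfolding integral_solution_def
proof (intro conjI ballI)
  show "continuous_on {0..b} y"
    by (subst continuous_on_cong[OF refl assms(3)]) (use assms(1) in \<open>auto simp: integral_solution_def\<close>)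
  fix t assume t: "t \<in> {0..b}"
  have "integral {0..t} (\<lambda>s. f s (y s)) = integral {0..t} (\<lambda>s. f s (x s))"
    using t assms(3) by (intro integral_cong) auto
  moreover have "x t = x 0 + integral {0..t} (\<lambda>s. f s (x s))"
    using assms(1) t unfolding integral_solution_def by blast
  moreover have "y t = x t" "y 0 = x 0" using assms(2,3) t by auto
  ultimately show "y t = y 0 + integral {0..t} (\<lambda>s. f s (y s))" by metis
qed

lemma integral_solution_extend:
  fixes f :: "real \<Rightarrow> 'a::euclidean_space \<Rightarrow> 'a"
  assumes cont: "continuous_on UNIV (\<lambda>(t, x). f t x)"
    and growth: "\<And>t x. norm (f t x) \<le> C * (1 + norm x)" and C: "C > 0"
    and x: "integral_solution f b x" and b: "0 \<le> b"
  shows "\<exists>y. integral_solution f (b + 1 / (2 * C)) y \<and> (\<forall>t\<in>{0..b}. y t = x t)"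
proof -
  define c where "c = b + 1 / (2 * C)"
  have bc: "b \<le> c" "C * (c - b) \<le> 1 / 2" using C by (simp_all add: c_def)
  obtain z where z: "continuous_on {b..c} z" "\<And>t. t \<in> {b..c} \<Longrightarrow> z t = x b + integral {b..t} (\<lambda>s. f s (z s))"
    using Peano_local[OF cont growth C bc, of "x b"] by blast
  have zb: "z b = x b" using z(2)[of b] bc by simp
  define y where "y = (\<lambda>t. if t \<le> b then x t else z t)"
  have yx: "y t = x t" if "t \<le> b" for t using that by (simp add: y_def)
  have yz: "y t = z t" if "b \<le> t" for t using that zb by (cases "t = b") (auto simp: y_def)
  have cy: "continuous_on {0..c} y"
  proof -
    have "{0..c} = {0..b} \<union> {b..c}" using b bc by auto
    moreover have "continuous_on {0..b} y" 
      by (subst continuous_on_cong[OF refl yx]) (use x in \<open>auto simp: integral_solution_def\<close>)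
    moreover have "continuous_on {b..c} y" 
      by (subst continuous_on_cong[OF refl yz]) (use z(1) in auto)
    ultimately show ?thesis using continuous_on_closed_Un[of "{0..b}" "{b..c}" y] by simp
  qed
  have xI: "x t = x 0 + integral {0..t} (\<lambda>s. f s (x s))" if "t \<in> {0..b}" for t
    using x that unfolding integral_solution_def by blast
  have "y t = y 0 + integral {0..t} (\<lambda>s. f s (y s))" if t: "t \<in> {0..c}" for t
  proof (cases "t \<le> b")
    case True
    have "integral {0..t} (\<lambda>s. f s (y s)) = integral {0..t} (\<lambda>s. f s (x s))"
      using True yx by (intro integral_cong) auto
    moreover have "x t = x 0 + integral {0..t} (\<lambda>s. f s (x s))" using True t by (intro xI) auto
    ultimately show ?thesis using yx[of t] yx[of 0] True b by metis
  next
    case False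
    have "integral {0..b} (\<lambda>s. f s (y s)) + integral {b..t} (\<lambda>s. f s (y s)) = integral {0..t} (\<lambda>s. f s (y s))"
      using False t b by (intro Henstock_Kurzweil_Integration.integral_combine integrable_continuous_real
        continuous_on_comp_field[OF cont] continuous_on_subset[OF cy]) auto
    moreover have "integral {0..b} (\<lambda>s. f s (y s)) = integral {0..b} (\<lambda>s. f s (x s))"
      using yx by (intro integral_cong) auto
    moreover have "integral {b..t} (\<lambda>s. f s (y s)) = integral {b..t} (\<lambda>s. f s (z s))"
      using yz by (intro integral_cong) auto
    moreover have "x b = x 0 + integral {0..b} (\<lambda>s. f s (x s))" using b by (intro xI) auto
    moreover have "z t = x b + integral {b..t} (\<lambda>s. f s (z s))" using False t by (intro z(2)) auto
    moreover have "y t = z t" "y 0 = x 0" using False yz[of t] yx[of 0] b by auto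
    ultimately show ?thesis by (metis add.assoc)
  qed
  then have "integral_solution f c y" using cy unfolding integral_solution_def by blast
  then show ?thesis using yx by (auto simp: c_def)
qed

lemma integral_solution_global:
  fixes f :: "real \<Rightarrow> 'a::euclidean_space \<Rightarrow> 'a"
  assumes cont: "continuous_on UNIV (\<lambda>(t, x). f t x)"
    and growth: "\<And>t x. norm (f t x) \<le> C * (1 + norm x)" and C: "C > 0"
    and x: "integral_solution f b x" and b: "0 \<le> b"
  shows "\<exists>y. (\<forall>t\<ge>0. (y has_vector_derivative f t (y t)) (at t within {0..})) \<and> (\<forall>t\<in>{0..b}. y t = x t)"
proof -
  define h where "h = 1 / (2 * C)"
  have h: "h > 0" using C by (simp add: h_def)
  \<comment> \<open>Solutions need not be unique, so those on longer intervals need not agree with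
    earlier ones by themselves. Dependent choice selects each as an extension of its predecessor,
    starting from \<open>x\<close>.\<close>
  have "\<exists>X. X 0 = x \<and> (\<forall>n. integral_solution f (b + real n * h) (X n) \<and> (\<forall>t\<in>{0..b + real n * h}. X (Suc n) t = X n t))"
  proof (rule exE[OF dependent_nat_choice[where P="\<lambda>n X. integral_solution f (b + real n * h) X \<and> (n = 0 \<longrightarrow> X = x)"
        and Q="\<lambda>n X Y. \<forall>t\<in>{0..b + real n * h}. Y t = X t"]])
    show "\<exists>X. integral_solution f (b + real 0 * h) X \<and> (0 = (0::nat) \<longrightarrow> X = x)" using x by auto
  next
    fix X and n :: nat assume X: "integral_solution f (b + real n * h) X \<and> (n = 0 \<longrightarrow> X = x)"
    have "0 \<le> b + real n * h" using b h by simp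
    from integral_solution_extend[OF cont growth C conjunct1[OF X] this]
    obtain Y where "integral_solution f (b + real n * h + h) Y" "\<forall>t\<in>{0..b + real n * h}. Y t = X t"
      by (auto simp: h_def)
    moreover have "b + real n * h + h = b + real (Suc n) * h" by (simp add: algebra_simps)
    ultimately show "\<exists>Y. (integral_solution f (b + real (Suc n) * h) Y \<and> (Suc n = 0 \<longrightarrow> Y = x)) \<and> (\<forall>t\<in>{0..b + real n * h}. Y t = X t)"
      by auto
  qed blast
  then obtain X where X0: "X 0 = x" and Xs: "\<And>n. integral_solution f (b + real n * h) (X n)"
    and Xag: "\<And>n t. t \<in> {0..b + real n * h} \<Longrightarrow> X (Suc n) t = X n t" by blast
  have ag: "X (n + m) t = X n t" if "t \<in> {0..b + real n * h}" for n m t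
  proof (induction m)
    case (Suc m)
    have "real n * h \<le> real (n + m) * h" using h by (intro mult_right_mono) auto
    then have "X (Suc (n + m)) t = X (n + m) t" using that by (intro Xag) auto
    then show ?case using Suc by simp
  qed simp
  \<comment> \<open>The index is the least \<open>n\<close> with
    \<open>t \<le> b + real n * h\<close>; it is 0 for \<open>t \<le> b\<close>.\<close>
  define y where "y = (\<lambda>t. X (nat \<lceil>(t - b) / h\<rceil>) t)"
  have yX: "y t = X n t" if t: "t \<in> {0..b + real n * h}" for n t
  proof -
    define m where "m = nat \<lceil>(t - b) / h\<rceil>"
    have "(t - b) / h \<le> real n" using t h by (simp add: field_simps)
    then have mn: "m \<le> n" unfolding m_def by (simp add: ceiling_le_iff nat_le_iff)
    have "(t - b) / h \<le> real m" unfolding m_def by (rule real_nat_ceiling_ge)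
    then have "t \<in> {0..b + real m * h}" using t h by (simp add: field_simps)
    from ag[OF this, of "n - m"] mn show ?thesis by (simp add: y_def m_def)
  qed
  have ysol: "integral_solution f (b + real n * h) y" for n
    by (rule integral_solution_cong[OF Xs]) (use yX b h in auto)
  have "(y has_vector_derivative f t (y t)) (at t within {0..})" if t: "0 \<le> t" for t
  proof -
    obtain n :: nat where n: "t / h < real n" using reals_Archimedean2 by blast
    define c where "c = b + real n * h"
    have tc: "t < c" using n h b by (simp add: c_def field_simps)
    have ys: "continuous_on {0..c} y" "\<And>s. s \<in> {0..c} \<Longrightarrow> y s = y 0 + integral {0..s} (\<lambda>s. f s (y s))"
      using ysol[of n] unfolding integral_solution_def c_def by blast+
    have "((\<lambda>u. integral {0..u} (\<lambda>s. f s (y s))) has_vector_derivative f t (y t)) (at t within {0..c})"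
      using integral_has_vector_derivative[OF continuous_on_comp_field[OF cont ys(1)]] t tc by simp
    then have "((\<lambda>u. y 0 + integral {0..u} (\<lambda>s. f s (y s))) has_vector_derivative 0 + f t (y t)) (at t within {0..c})"
      by (intro has_vector_derivative_add has_vector_derivative_const)
    then have "(y has_vector_derivative f t (y t)) (at t within {0..c})"
      unfolding add_0 by (rule has_vector_derivative_transform[rotated 2]) (use t tc in simp, rule ys(2))
    moreover have "at t within {0..c} = at t within {0..}"
      using tc by (intro at_within_nhd[of t "{..<c}"]) auto
    ultimately show ?thesis by simp
  qed
  moreover have "y t = x t" if "t \<in> {0..b}" for t using yX[of t 0] that X0 by simp
  ultimately show ?thesis by blast
qed

text \<open>Linear growth keeps a solution on a half-open interval bounded. Then its derivative is
  bounded, it is Lipschitz, and it extends continuously to the right endpoint.\<close>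

lemma integral_solution_closed_interval:
  fixes f :: "real \<Rightarrow> 'a::euclidean_space \<Rightarrow> 'a"
  assumes cont: "continuous_on UNIV (\<lambda>(t, x). f t x)"
    and growth: "\<And>t x. norm (f t x) \<le> C * (1 + norm x)" and C: "C > 0" and T: "T > 0"
    and x: "\<And>t. t \<in> {0..<T} \<Longrightarrow> (x has_vector_derivative f t (x t)) (at t within {0..<T})"
  shows "\<exists>y. integral_solution f T y \<and> (\<forall>t\<in>{0..<T}. y t = x t)"
proof -
  have cx: "continuous_on {0..<T} x"
    using x by (rule continuous_on_vector_derivative)
  have ftc: "((\<lambda>s. f s (x s)) has_integral x t - x s) {s..t}" if "0 \<le> s" "s \<le> t" "t < T" for s t
    using that by (intro fundamental_theorem_of_calculus has_vector_derivative_within_subset[OF x]) auto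
  \<comment> \<open>On \<open>[0, c]\<close> the solution is bounded by compactness; the last
    stretch is short enough for the absorption argument, with a bound uniform up to
    \<open>T\<close>.\<close>
  define c where "c = max 0 (T - 1 / (2 * C))"
  have c: "0 \<le> c" "c < T" "C * (T - c) \<le> 1 / 2" using T C by (auto simp: c_def field_simps max_def)
  have b1: "norm (x t) \<le> 2 * norm (x c) + 1" if t: "c \<le> t" "t < T" for t
  proof (rule norm_bound_of_linear_growth[of c t x C])
    show "continuous_on {c..t} x" using c t by (intro continuous_on_subset[OF cx]) auto
    show "C * (t - c) \<le> 1 / 2" using c(3) t C mult_left_mono[of "t - c" "T - c" C] by linarith
    fix m s assume m: "\<And>u. u \<in> {c..t} \<Longrightarrow> norm (x u) \<le> m" and s: "s \<in> {c..t}"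
    have m0: "0 \<le> m" using m[OF s] norm_ge_zero order_trans by blast
    have "norm (x s - x c) \<le> C * (1 + m) * (s - c)"
    proof -
      have eq: "x s - x c = integral {c..s} (\<lambda>s. f s (x s))" using ftc[of c s] c s t by (simp add: integral_unique)
      show ?thesis unfolding eq
      proof (rule integral_bound)
        show "continuous_on {c..s} (\<lambda>s. f s (x s))"
          using c s t by (intro continuous_on_comp_field[OF cont] continuous_on_subset[OF cx]) auto
        fix u assume "u \<in> {c..s}"
        then have "norm (x u) \<le> m" using s by (intro m) auto
        then have "C * (1 + norm (x u)) \<le> C * (1 + m)" using C by simp
        then show "norm (f u (x u)) \<le> C * (1 + m)" using growth order_trans by blast
      qed (use s in auto)
    qed
    also have "\<dots> \<le> C * (1 + m) * (t - c)" using m0 C s by (intro mult_left_mono) auto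
    finally show "norm (x s) \<le> norm (x c) + C * (1 + m) * (t - c)"
      using norm_triangle_ineq2[of "x s" "x c"] by linarith
  qed (use t C in auto)
  have "compact (x ` {0..c})" using c by (intro compact_continuous_image continuous_on_subset[OF cx]) auto
  then obtain B0 where B0: "\<And>t. t \<in> {0..c} \<Longrightarrow> norm (x t) \<le> B0"
    using compact_imp_bounded bounded_iff by (metis imageI)
  define B where "B = max B0 (2 * norm (x c) + 1)"
  have B: "norm (x t) \<le> B" if "t \<in> {0..<T}" for t
    using that B0[of t] b1[of t] by (cases "t \<le> c") (auto simp: B_def)
  have B1: "B \<ge> 0" unfolding B_def by (simp add: max.coboundedI2)
  have lip: "norm (x t - x s) \<le> C * (1 + B) * norm (t - s)" if "s \<in> {0..<T}" "t \<in> {0..<T}" for s t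
  proof (rule differentiable_bound[of "{0..<T}" x "\<lambda>u h. h *\<^sub>R f u (x u)"])
    fix u assume u: "u \<in> {0..<T}"
    show "(x has_derivative (\<lambda>h. h *\<^sub>R f u (x u))) (at u within {0..<T})"
      using x[OF u] by (simp add: has_vector_derivative_def)
    have "norm (f u (x u)) \<le> C * (1 + B)"
      using growth[of u "x u"] B[OF u] C mult_left_mono[of "1 + norm (x u)" "1 + B" C] by linarith
    then show "onorm (\<lambda>h. h *\<^sub>R f u (x u)) \<le> C * (1 + B)"
      by (intro onorm_le) (simp add: mult.commute mult_left_mono)
  qed (use that in auto)
  have "uniformly_continuous_on {0..<T} x"
    unfolding uniformly_continuous_on_def
  proof (intro allI impI)
    fix e :: real assume e: "e > 0"
    have CB: "C * (1 + B) > 0" using C B1 by simp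
    show "\<exists>d>0. \<forall>s\<in>{0..<T}. \<forall>t\<in>{0..<T}. dist t s < d \<longrightarrow> dist (x t) (x s) < e"
    proof (intro exI[of _ "e / (C * (1 + B))"] conjI ballI impI)
      fix s t assume st: "s \<in> {0..<T}" "t \<in> {0..<T}" "dist t s < e / (C * (1 + B))"
      then have "C * (1 + B) * norm (t - s) < e" using CB by (simp add: field_simps dist_norm)
      then show "dist (x t) (x s) < e" using lip[OF st(1,2)] by (simp add: dist_norm)
    qed (use e CB in simp)
  qed
  then obtain y where "uniformly_continuous_on (closure {0..<T}) y" and yx: "\<And>t. t \<in> {0..<T} \<Longrightarrow> x t = y t"
    using uniformly_continuous_on_extension_on_closure by metis
  then have cy: "continuous_on {0..T} y" using uniformly_continuous_imp_continuous T by force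
  \<comment> \<open>The defect in the integral equation is continuous on \<open>[0, T]\<close> and
    vanishes before \<open>T\<close>, hence also at \<open>T\<close>.\<close>
  define d where "d = (\<lambda>t. y t - y 0 - integral {0..t} (\<lambda>s. f s (y s)))"
  have "continuous_on {0..T} d" unfolding d_def
    by (intro continuous_intros cy indefinite_integral_continuous_1 integrable_continuous_real continuous_on_comp_field[OF cont])
  moreover have "d t = 0" if t: "t \<in> {0..<T}" for t
  proof -
    have "integral {0..t} (\<lambda>s. f s (y s)) = integral {0..t} (\<lambda>s. f s (x s))"
      using t yx by (intro integral_cong) auto
    also have "\<dots> = x t - x 0" using ftc[of 0 t] t by (simp add: integral_unique)
    finally show ?thesis using yx[OF t] yx[of 0] T by (simp add: d_def)
  qed
  ultimately have "d t = 0" if "t \<in> {0..T}" for t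
    using continuous_constant_on_closure[of "{0..<T}" d 0 t] that T by simp
  then have "y t = y 0 + integral {0..t} (\<lambda>s. f s (y s))" if "t \<in> {0..T}" for t
    using that unfolding d_def diff_diff_eq right_minus_eq by blast
  then have "integral_solution f T y" using cy unfolding integral_solution_def by blast
  then show ?thesis using yx by auto
qed

lemma solution_extends_globally:
  fixes f :: "real \<Rightarrow> 'a::euclidean_space \<Rightarrow> 'a"
  assumes cont: "continuous_on UNIV (\<lambda>(t, x). f t x)"
    and growth: "\<And>t x. norm (f t x) \<le> C * (1 + norm x)" and C: "C > 0" and T: "T > 0"
    and x: "\<And>t. t \<in> {0..<T} \<Longrightarrow> (x has_vector_derivative f t (x t)) (at t within {0..<T})"
  shows "\<exists>y. (\<forall>t\<ge>0. (y has_vector_derivative f t (y t)) (at t within {0..})) \<and> (\<forall>t\<in>{0..<T}. y t = x t)"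
proof -
  obtain z where z: "integral_solution f T z" "\<And>t. t \<in> {0..<T} \<Longrightarrow> z t = x t"
    using integral_solution_closed_interval[OF cont growth C T x] by blast
  obtain y where "\<forall>t\<ge>0. (y has_vector_derivative f t (y t)) (at t within {0..})" "\<And>t. t \<in> {0..T} \<Longrightarrow> y t = z t"
    using integral_solution_global[OF cont growth C z(1)] T by (meson less_imp_le)
  then show ?thesis using z(2) by (intro exI[of _ y]) auto
qed

section \<open>Averages of the excitation\<close>

text \<open>This family is closed under differentiation in \<open>y\<close> and in
  \<open>\<tau>\<close>: both exchange the cosine and sine coefficients up to sign, the latter with
  a factor \<open>\<omega> i\<close>. One bound and one Lipschitz estimate therefore cover all
  excitation terms.\<close>

definition trig :: "nat \<Rightarrow> (nat \<Rightarrow> real) \<Rightarrow> (nat \<Rightarrow> 'a::real_normed_vector) \<Rightarrow> (nat \<Rightarrow> 'a) \<Rightarrow> real \<Rightarrow> real \<Rightarrow> 'a"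
  where "trig r \<omega> c d y \<tau> = (\<Sum>i=1..r. cos (y + \<omega> i * \<tau>) *\<^sub>R c i + sin (y + \<omega> i * \<tau>) *\<^sub>R d i)"

lemma norm_trig_le: "norm (trig r \<omega> c d y \<tau>) \<le> (\<Sum>i=1..r. norm (c i) + norm (d i))"
  unfolding trig_def
  by (intro sum_norm_le norm_triangle_le add_mono) (simp_all add: mult_left_le_one_le)

lemma trig_has_vector_derivative:
  assumes "(y has_real_derivative y') (at s within A)" "(\<tau> has_real_derivative \<tau>') (at s within A)"
  shows "((\<lambda>s. trig r \<omega> c d (y s) (\<tau> s)) has_vector_derivative
    y' *\<^sub>R trig r \<omega> d (\<lambda>i. - c i) (y s) (\<tau> s) +
    \<tau>' *\<^sub>R trig r \<omega> (\<lambda>i. \<omega> i *\<^sub>R d i) (\<lambda>i. - (\<omega> i *\<^sub>R c i)) (y s) (\<tau> s)) (at s within A)"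
proof -
  have *: "((\<lambda>s. cos (y s + w * \<tau> s) *\<^sub>R v + sin (y s + w * \<tau> s) *\<^sub>R v') has_vector_derivative
     y' *\<^sub>R (cos (y s + w * \<tau> s) *\<^sub>R v' + sin (y s + w * \<tau> s) *\<^sub>R (- v)) +
     \<tau>' *\<^sub>R (cos (y s + w * \<tau> s) *\<^sub>R (w *\<^sub>R v') + sin (y s + w * \<tau> s) *\<^sub>R (- (w *\<^sub>R v)))) (at s within A)"
    for w and v v' :: 'a
  proof -
    have c: "((\<lambda>s. cos (y s + w * \<tau> s)) has_real_derivative - sin (y s + w * \<tau> s) * (y' + w * \<tau>')) (at s within A)"
      by (rule derivative_eq_intros assms refl | simp)+
    have s: "((\<lambda>s. sin (y s + w * \<tau> s)) has_real_derivative cos (y s + w * \<tau> s) * (y' + w * \<tau>')) (at s within A)"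
      by (rule derivative_eq_intros assms refl | simp)+
    have "((\<lambda>s. cos (y s + w * \<tau> s) *\<^sub>R v + sin (y s + w * \<tau> s) *\<^sub>R v') has_vector_derivative
      (cos (y s + w * \<tau> s) *\<^sub>R 0 + (- sin (y s + w * \<tau> s) * (y' + w * \<tau>')) *\<^sub>R v) +
      (sin (y s + w * \<tau> s) *\<^sub>R 0 + (cos (y s + w * \<tau> s) * (y' + w * \<tau>')) *\<^sub>R v')) (at s within A)"
      by (intro has_vector_derivative_add has_vector_derivative_scaleR c s has_vector_derivative_const)
    then show ?thesis
      by (rule has_vector_derivative_eq_rhs) (simp add: algebra_simps)
  qed
  show ?thesis unfolding trig_def scaleR_sum_right sum.distrib[symmetric]
    by (intro has_vector_derivative_sum *)
qed

lemma trig_Lipschitz: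
  fixes c :: "nat \<Rightarrow> 'a::euclidean_space"
  shows "norm (trig r \<omega> c d y \<tau> - trig r \<omega> c d y' \<tau>) \<le> (\<Sum>i=1..r. norm (c i) + norm (d i)) * \<bar>y - y'\<bar>"
proof -
  have "((\<lambda>s. trig r \<omega> c d s \<tau>) has_derivative (\<lambda>h. h *\<^sub>R trig r \<omega> d (\<lambda>i. - c i) s \<tau>)) (at s within UNIV)" for s
    using trig_has_vector_derivative[of "\<lambda>s. s" 1 s UNIV "\<lambda>s. \<tau>" 0 r \<omega> c d]
    by (simp add: has_vector_derivative_def)
  moreover have "onorm (\<lambda>h. h *\<^sub>R trig r \<omega> d (\<lambda>i. - c i) s \<tau>) \<le> (\<Sum>i=1..r. norm (c i) + norm (d i))" for s
  proof -
    have "norm (trig r \<omega> d (\<lambda>i. - c i) s \<tau>) \<le> (\<Sum>i=1..r. norm (c i) + norm (d i))"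
      using norm_trig_le[of r \<omega> d "\<lambda>i. - c i" s \<tau>] by (simp add: add.commute)
    then show ?thesis
      by (intro onorm_le) (simp add: mult.commute mult_left_mono)
  qed
  ultimately show ?thesis
    using differentiable_bound[of UNIV "\<lambda>s. trig r \<omega> c d s \<tau>" "\<lambda>s h. h *\<^sub>R trig r \<omega> d (\<lambda>i. - c i) s \<tau>" _ y y']
    by simp
qed

lemma sin_cos_add_period:
  assumes "w * P = 2 * pi * of_int m"
  shows "cos (y + w * (\<tau> + P)) = cos (y + w * \<tau>)" "sin (y + w * (\<tau> + P)) = sin (y + w * \<tau>)"
proof -
  have "y + w * (\<tau> + P) = (y + w * \<tau>) + 2 * pi * of_int m" using assms by (simp add: algebra_simps)
  moreover have "cos (z + 2 * pi * of_int m) = cos z" "sin (z + 2 * pi * of_int m) = sin z" for z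
    by (simp_all add: cos_add sin_add)
  ultimately show "cos (y + w * (\<tau> + P)) = cos (y + w * \<tau>)" "sin (y + w * (\<tau> + P)) = sin (y + w * \<tau>)"
    by (simp_all only:)
qed

lemma trig_periodic:
  assumes "\<And>i. i \<in> {1..r} \<Longrightarrow> \<exists>m::int. \<omega> i * P = 2 * pi * of_int m"
  shows "trig r \<omega> c d y (\<tau> + P) = trig r \<omega> c d y \<tau>"
  unfolding trig_def
proof (rule sum.cong)
  fix i assume "i \<in> {1..r}"
  then obtain m :: int where "\<omega> i * P = 2 * pi * of_int m" using assms by blast
  from sin_cos_add_period[OF this]
  show "cos (y + \<omega> i * (\<tau> + P)) *\<^sub>R c i + sin (y + \<omega> i * (\<tau> + P)) *\<^sub>R d i =
      cos (y + \<omega> i * \<tau>) *\<^sub>R c i + sin (y + \<omega> i * \<tau>) *\<^sub>R d i" by simp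
qed simp

text \<open>Multiplying \<open>n\<close> by the denominator of each further frequency makes all
  products \<open>\<omega> i * n\<close> integers; then \<open>2 * pi * n\<close> is a period of
  every excitation.\<close>

lemma common_period:
  fixes \<omega> :: "nat \<Rightarrow> real"
  assumes "finite I" "\<And>i. i \<in> I \<Longrightarrow> \<omega> i \<in> \<rat>"
  shows "\<exists>P>0. \<forall>i\<in>I. \<exists>m::int. \<omega> i * P = 2 * pi * of_int m"
proof -
  have "\<exists>n::nat. n > 0 \<and> (\<forall>i\<in>I. \<omega> i * real n \<in> \<int>)"
    using assms
  proof (induction I)
    case empty then show ?case by auto
  next
    case (insert k I)
    then obtain n :: nat where n: "n > 0" "\<And>i. i \<in> I \<Longrightarrow> \<omega> i * real n \<in> \<int>" by auto
    from insert.prems[of k] obtain p q :: int where q: "q > 0" "\<omega> k = of_int p / of_int q"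
      by (auto elim: Rats_cases')
    have "\<omega> i * real (n * nat q) \<in> \<int>" if "i \<in> insert k I" for i
    proof (cases "i = k")
      case True
      have "\<omega> k * real (n * nat q) = of_int (p * int n)" using q by simp
      then show ?thesis using True Ints_of_int by metis
    next
      case False
      then have "\<omega> i * real n \<in> \<int>" using n that by auto
      then have "\<omega> i * real n * of_int q \<in> \<int>" by (rule Ints_mult) auto
      moreover have "\<omega> i * real n * of_int q = \<omega> i * real (n * nat q)" using q by simp
      ultimately show ?thesis by (simp only:)
    qed
    then show ?case using n q by (intro exI[of _ "n * nat q"]) auto
  qed
  then obtain n :: nat where n: "n > 0" "\<And>i. i \<in> I \<Longrightarrow> \<omega> i * real n \<in> \<int>" by blast
  show ?thesis
  proof (intro exI[of _ "2 * pi * real n"] conjI ballI)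
    fix i assume i: "i \<in> I"
    show "\<exists>m::int. \<omega> i * (2 * pi * real n) = 2 * pi * of_int m"
    proof -
      obtain m :: int where "\<omega> i * real n = of_int m" using n(2)[OF i] by (auto elim: Ints_cases)
      then show ?thesis by (intro exI[of _ m]) (simp add: algebra_simps)
    qed
  qed (use n in simp)
qed

text \<open>The quadrature companion \<open>Y\<close> satisfies \<open>X' = \<omega> Y\<close> and
  \<open>Y' = - \<omega> X\<close>. For \<open>i = k\<close>, \<open>X Y\<close> has derivative
  \<open>\<omega> (Y\<^sup>2 - X\<^sup>2)\<close> while \<open>X\<^sup>2 + Y\<^sup>2\<close> is
  constant. For distinct indices, \<open>\<omega> i Y i X k - \<omega> k X i Y k\<close> has
  derivative \<open>((\<omega> k)\<^sup>2 - (\<omega> i)\<^sup>2) X i X k\<close>, and distinct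
  positive frequencies allow the division.\<close>

lemma sinusoid_product_antiderivative:
  fixes \<omega> p q :: "nat \<Rightarrow> real" and y P :: real
  assumes pos: "\<omega> i > 0" "\<omega> k > 0" and neq: "i \<noteq> k \<Longrightarrow> \<omega> i \<noteq> \<omega> k"
    and per: "\<exists>m::int. \<omega> i * P = 2 * pi * of_int m" "\<exists>m::int. \<omega> k * P = 2 * pi * of_int m"
  defines "X \<equiv> \<lambda>i \<tau>. p i * cos (y + \<omega> i * \<tau>) + q i * sin (y + \<omega> i * \<tau>)"
  shows "\<exists>E. (\<forall>\<tau>. (E has_real_derivative (X i \<tau> * X k \<tau> - (if i = k then ((p i)\<^sup>2 + (q i)\<^sup>2) / 2 else 0))) (at \<tau>)) \<and>
     (\<forall>\<tau>. E (\<tau> + P) = E \<tau>)"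
proof -
  define Y where "Y = (\<lambda>i \<tau>. - p i * sin (y + \<omega> i * \<tau>) + q i * cos (y + \<omega> i * \<tau>))"
  have dX: "(X i has_real_derivative \<omega> i * Y i \<tau>) (at \<tau>)" for i \<tau>
    unfolding X_def Y_def by (rule derivative_eq_intros refl | simp)+ (simp add: algebra_simps)
  have dY: "(Y i has_real_derivative - \<omega> i * X i \<tau>) (at \<tau>)" for i \<tau>
    unfolding X_def Y_def by (rule derivative_eq_intros refl | simp)+ (simp add: algebra_simps)
  obtain mi mk :: int where m: "\<omega> i * P = 2 * pi * of_int mi" "\<omega> k * P = 2 * pi * of_int mk"
    using per by blast
  have perX: "X i (\<tau> + P) = X i \<tau>" "X k (\<tau> + P) = X k \<tau>" "Y i (\<tau> + P) = Y i \<tau>" "Y k (\<tau> + P) = Y k \<tau>" for \<tau>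
    by (simp_all only: X_def Y_def sin_cos_add_period[OF m(1)] sin_cos_add_period[OF m(2)])
  show ?thesis
  proof (cases "i = k")
    case True
    have sq: "(X i \<tau>)\<^sup>2 + (Y i \<tau>)\<^sup>2 = (p i)\<^sup>2 + (q i)\<^sup>2" for \<tau>
    proof -
      have "(X i \<tau>)\<^sup>2 + (Y i \<tau>)\<^sup>2 = ((p i)\<^sup>2 + (q i)\<^sup>2) * ((cos (y + \<omega> i * \<tau>))\<^sup>2 + (sin (y + \<omega> i * \<tau>))\<^sup>2)"
        unfolding X_def Y_def by algebra
      then show ?thesis by simp
    qed
    have "((\<lambda>\<tau>. - (X i \<tau> * Y i \<tau>) / (2 * \<omega> i)) has_real_derivative
       - (X i \<tau> * (- \<omega> i * X i \<tau>) + \<omega> i * Y i \<tau> * Y i \<tau>) / (2 * \<omega> i)) (at \<tau>)" for \<tau>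
      by (rule derivative_eq_intros dX dY refl)+ (use pos in \<open>simp_all add: field_simps\<close>)
    moreover have "- (X i \<tau> * (- \<omega> i * X i \<tau>) + \<omega> i * Y i \<tau> * Y i \<tau>) / (2 * \<omega> i) = ((X i \<tau>)\<^sup>2 - (Y i \<tau>)\<^sup>2) / 2" for \<tau>
      using pos by (simp add: field_simps power2_eq_square)
    moreover have "((X i \<tau>)\<^sup>2 - (Y i \<tau>)\<^sup>2) / 2 = X i \<tau> * X i \<tau> - ((p i)\<^sup>2 + (q i)\<^sup>2) / 2" for \<tau>
      using sq[of \<tau>] by (simp add: field_simps power2_eq_square)
    ultimately have "((\<lambda>\<tau>. - (X i \<tau> * Y i \<tau>) / (2 * \<omega> i)) has_real_derivative
       X i \<tau> * X i \<tau> - ((p i)\<^sup>2 + (q i)\<^sup>2) / 2) (at \<tau>)" for \<tau> by simp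
    then show ?thesis using True perX by (intro exI[of _ "\<lambda>\<tau>. - (X i \<tau> * Y i \<tau>) / (2 * \<omega> i)"]) auto
  next
    case False
    have "\<omega> k - \<omega> i \<noteq> 0" "\<omega> k + \<omega> i \<noteq> 0" using pos neq[OF False] by auto
    then have w: "(\<omega> k)\<^sup>2 - (\<omega> i)\<^sup>2 \<noteq> 0" by (simp add: power2_eq_square square_diff_square_factored)
    have "((\<lambda>\<tau>. (\<omega> i * (Y i \<tau> * X k \<tau>) - \<omega> k * (X i \<tau> * Y k \<tau>)) / ((\<omega> k)\<^sup>2 - (\<omega> i)\<^sup>2)) has_real_derivative
       (\<omega> i * (Y i \<tau> * (\<omega> k * Y k \<tau>) + (- \<omega> i * X i \<tau>) * X k \<tau>) - \<omega> k * (X i \<tau> * (- \<omega> k * X k \<tau>) + \<omega> i * Y i \<tau> * Y k \<tau>))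
         / ((\<omega> k)\<^sup>2 - (\<omega> i)\<^sup>2)) (at \<tau>)" for \<tau>
      by (rule DERIV_cdivide, (rule derivative_eq_intros dX dY refl)+) (simp add: algebra_simps)
    moreover have "(\<omega> i * (Y i \<tau> * (\<omega> k * Y k \<tau>) + (- \<omega> i * X i \<tau>) * X k \<tau>) - \<omega> k * (X i \<tau> * (- \<omega> k * X k \<tau>) + \<omega> i * Y i \<tau> * Y k \<tau>))
         / ((\<omega> k)\<^sup>2 - (\<omega> i)\<^sup>2) = X i \<tau> * X k \<tau>" for \<tau>
      using w by (simp add: field_simps power2_eq_square)
    ultimately have "((\<lambda>\<tau>. (\<omega> i * (Y i \<tau> * X k \<tau>) - \<omega> k * (X i \<tau> * Y k \<tau>)) / ((\<omega> k)\<^sup>2 - (\<omega> i)\<^sup>2)) has_real_derivative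
       X i \<tau> * X k \<tau>) (at \<tau>)" for \<tau> by simp
    then show ?thesis using False perX
      by (intro exI[of _ "\<lambda>\<tau>. (\<omega> i * (Y i \<tau> * X k \<tau>) - \<omega> k * (X i \<tau> * Y k \<tau>)) / ((\<omega> k)\<^sup>2 - (\<omega> i)\<^sup>2)"]) auto
  qed
qed

text \<open>For positive \<open>J\<close> the control term is \<open>sqrt J * exc_S (ln J) \<tau>\<close>. \<open>exc_R\<close> is the periodic
  antiderivative of \<open>exc_S\<close> in \<open>\<tau>\<close>, and \<open>exc_Ry\<close> is its derivative in the phase \<open>y = ln J\<close>.\<close>

definition exc_S :: "nat \<Rightarrow> (nat \<Rightarrow> real) \<Rightarrow> (nat \<Rightarrow> nat \<Rightarrow> 'a::real_normed_vector) \<Rightarrow> real \<Rightarrow> real \<Rightarrow> 'a" where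
  "exc_S r \<omega> b = trig r \<omega> (\<lambda>i. sqrt (2 * \<omega> i) *\<^sub>R b i 1) (\<lambda>i. sqrt (2 * \<omega> i) *\<^sub>R b i 2)"

definition exc_R :: "nat \<Rightarrow> (nat \<Rightarrow> real) \<Rightarrow> (nat \<Rightarrow> nat \<Rightarrow> 'a::real_normed_vector) \<Rightarrow> real \<Rightarrow> real \<Rightarrow> 'a" where
  "exc_R r \<omega> b = trig r \<omega> (\<lambda>i. - (sqrt (2 / \<omega> i) *\<^sub>R b i 2)) (\<lambda>i. sqrt (2 / \<omega> i) *\<^sub>R b i 1)"

definition exc_Ry :: "nat \<Rightarrow> (nat \<Rightarrow> real) \<Rightarrow> (nat \<Rightarrow> nat \<Rightarrow> 'a::real_normed_vector) \<Rightarrow> real \<Rightarrow> real \<Rightarrow> 'a" where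
  "exc_Ry r \<omega> b = trig r \<omega> (\<lambda>i. sqrt (2 / \<omega> i) *\<^sub>R b i 1) (\<lambda>i. sqrt (2 / \<omega> i) *\<^sub>R b i 2)"

lemma exc_R_has_vector_derivative:
  assumes pos: "\<And>i. i \<in> {1..r} \<Longrightarrow> \<omega> i > 0"
    and d: "(y has_real_derivative y') (at s within A)" "(\<tau> has_real_derivative \<tau>') (at s within A)"
  shows "((\<lambda>s. exc_R r \<omega> b (y s) (\<tau> s)) has_vector_derivative
    y' *\<^sub>R exc_Ry r \<omega> b (y s) (\<tau> s) + \<tau>' *\<^sub>R exc_S r \<omega> b (y s) (\<tau> s)) (at s within A)"
proof -
  have w: "\<omega> i * sqrt (2 / \<omega> i) = sqrt (2 * \<omega> i)" if "i \<in> {1..r}" for i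
  proof -
    have "\<omega> i * sqrt (2 / \<omega> i) = sqrt ((\<omega> i)\<^sup>2) * sqrt (2 / \<omega> i)" using pos[OF that] by simp
    also have "\<dots> = sqrt ((\<omega> i)\<^sup>2 * (2 / \<omega> i))" by (rule real_sqrt_mult[symmetric])
    also have "(\<omega> i)\<^sup>2 * (2 / \<omega> i) = 2 * \<omega> i" using pos[OF that] by (simp add: power2_eq_square)
    finally show ?thesis .
  qed
  have "trig r \<omega> (\<lambda>i. \<omega> i *\<^sub>R sqrt (2 / \<omega> i) *\<^sub>R b i 1) (\<lambda>i. - (\<omega> i *\<^sub>R - (sqrt (2 / \<omega> i) *\<^sub>R b i 2))) = exc_S r \<omega> b"
    unfolding exc_S_def trig_def by (intro ext sum.cong) (simp_all add: w)
  then show ?thesis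
    using trig_has_vector_derivative[OF d, of r \<omega> "\<lambda>i. - (sqrt (2 / \<omega> i) *\<^sub>R b i 2)" "\<lambda>i. sqrt (2 / \<omega> i) *\<^sub>R b i 1"]
    by (simp add: exc_R_def exc_Ry_def)
qed

text \<open>The mean over a period is expressed by a periodic antiderivative \<open>A\<close> of the
  deviation from it, which can be added to a quantity along a trajectory without introducing
  integrals.\<close>

lemma excitation_average:
  fixes g :: "'a::euclidean_space"
  assumes pos: "\<And>i. i \<in> {1..r} \<Longrightarrow> \<omega> i > 0" and inj: "inj_on \<omega> {1..r}"
    and per: "\<And>i. i \<in> {1..r} \<Longrightarrow> \<exists>m::int. \<omega> i * P = 2 * pi * of_int m"
  shows "\<exists>A. (\<forall>\<tau>. (A has_real_derivative
      ((g \<bullet> exc_S r \<omega> b y \<tau>) * (g \<bullet> ((1/2) *\<^sub>R exc_R r \<omega> b y \<tau> + exc_Ry r \<omega> b y \<tau>))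
        - (\<Sum>i=1..r. \<Sum>j=1..2. (b i j \<bullet> g)\<^sup>2))) (at \<tau>)) \<and> (\<forall>\<tau>. A (\<tau> + P) = A \<tau>)"
proof -
  define p q where "p = (\<lambda>i. b i 1 \<bullet> g)" and "q = (\<lambda>i. b i 2 \<bullet> g)"
  define X where "X = (\<lambda>i \<tau>. p i * cos (y + \<omega> i * \<tau>) + q i * sin (y + \<omega> i * \<tau>))"
  define m where "m = (\<lambda>i k. if i = k then ((p i)\<^sup>2 + (q i)\<^sup>2) / 2 else 0)"
  have "\<forall>i\<in>{1..r}. \<forall>k\<in>{1..r}. \<exists>E. (\<forall>\<tau>. (E has_real_derivative (X i \<tau> * X k \<tau> - m i k)) (at \<tau>)) \<and> (\<forall>\<tau>. E (\<tau> + P) = E \<tau>)"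
  proof (intro ballI)
    fix i k assume ik: "i \<in> {1..r}" "k \<in> {1..r}"
    show "\<exists>E. (\<forall>\<tau>. (E has_real_derivative (X i \<tau> * X k \<tau> - m i k)) (at \<tau>)) \<and> (\<forall>\<tau>. E (\<tau> + P) = E \<tau>)"
      unfolding X_def m_def
      by (rule sinusoid_product_antiderivative)
        (use ik pos per inj in \<open>auto dest: inj_onD\<close>)
  qed
  then obtain E where E: "\<And>i k \<tau>. i \<in> {1..r} \<Longrightarrow> k \<in> {1..r} \<Longrightarrow> (E i k has_real_derivative (X i \<tau> * X k \<tau> - m i k)) (at \<tau>)"
    "\<And>i k \<tau>. i \<in> {1..r} \<Longrightarrow> k \<in> {1..r} \<Longrightarrow> E i k (\<tau> + P) = E i k \<tau>"
    by metis
  define \<rho> where "\<rho> = (\<lambda>\<tau>. g \<bullet> exc_R r \<omega> b y \<tau>)"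
  define c where "c = (\<lambda>i k. sqrt (2 * \<omega> i) * sqrt (2 / \<omega> k))"
  \<comment> \<open>The square accounts for the factor \<open>R / 2\<close>, because the derivative
    of \<open>\<rho>\<close> is \<open>g \<bullet> S\<close>; the double sum accounts for
    \<open>R_y\<close>, one pair of frequencies at a time.\<close>
  define A where "A = (\<lambda>\<tau>. (\<rho> \<tau>)\<^sup>2 / 4 + (\<Sum>i=1..r. \<Sum>k=1..r. c i k * E i k \<tau>))"
  have S: "g \<bullet> exc_S r \<omega> b y \<tau> = (\<Sum>i=1..r. sqrt (2 * \<omega> i) * X i \<tau>)" for \<tau>
    unfolding exc_S_def trig_def X_def p_def q_def
    by (simp add: inner_sum_right inner_add_right inner_commute algebra_simps)
  have Ry: "g \<bullet> exc_Ry r \<omega> b y \<tau> = (\<Sum>i=1..r. sqrt (2 / \<omega> i) * X i \<tau>)" for \<tau>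
    unfolding exc_Ry_def trig_def X_def p_def q_def
    by (simp add: inner_sum_right inner_add_right inner_commute algebra_simps)
  have d\<rho>: "(\<rho> has_real_derivative (g \<bullet> exc_S r \<omega> b y \<tau>)) (at \<tau>)" for \<tau>
  proof -
    have "(exc_R r \<omega> b y has_vector_derivative exc_S r \<omega> b y \<tau>) (at \<tau>)"
      using exc_R_has_vector_derivative[where r=r and y="\<lambda>_. y" and y'=0 and s=\<tau> and A=UNIV and \<tau>="\<lambda>\<tau>. \<tau>" and \<tau>'=1 and b=b and \<omega>=\<omega>] pos by simp
    then show ?thesis unfolding \<rho>_def has_real_derivative_iff_has_vector_derivative
      by (rule bounded_linear.has_vector_derivative[OF bounded_linear_inner_right])
  qed
  have cm: "(\<Sum>i=1..r. \<Sum>k=1..r. c i k * m i k) = (\<Sum>i=1..r. \<Sum>j=1..2. (b i j \<bullet> g)\<^sup>2)"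
  proof (rule sum.cong[OF refl])
    fix i assume i: "i \<in> {1..r}"
    \<comment> \<open>The amplitudes \<open>sqrt (2 * \<omega> i)\<close> of the controls are
      normalised for this: the weight 2 cancels the mean 1/2 of a squared sinusoid.\<close>
    have "c i i = 2" using pos[OF i] by (simp add: c_def flip: real_sqrt_mult)
    then show "(\<Sum>k=1..r. c i k * m i k) = (\<Sum>j=1..2. (b i j \<bullet> g)\<^sup>2)"
      using i by (simp add: m_def p_def q_def numeral_2_eq_2 if_distrib cong: if_cong)
  qed
  have "(A has_real_derivative
      ((g \<bullet> exc_S r \<omega> b y \<tau>) * (g \<bullet> ((1/2) *\<^sub>R exc_R r \<omega> b y \<tau> + exc_Ry r \<omega> b y \<tau>))
        - (\<Sum>i=1..r. \<Sum>j=1..2. (b i j \<bullet> g)\<^sup>2))) (at \<tau>)" for \<tau>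
  proof -
    have 1: "((\<lambda>\<tau>. (\<rho> \<tau>)\<^sup>2 / 4) has_real_derivative (g \<bullet> exc_S r \<omega> b y \<tau>) * (\<rho> \<tau> / 2)) (at \<tau>)"
      by (rule derivative_eq_intros d\<rho> refl)+ simp_all
    have 2: "((\<lambda>\<tau>. \<Sum>i=1..r. \<Sum>k=1..r. c i k * E i k \<tau>) has_real_derivative
        (\<Sum>i=1..r. \<Sum>k=1..r. c i k * (X i \<tau> * X k \<tau> - m i k))) (at \<tau>)"
      by (intro DERIV_sum DERIV_cmult E) auto
    have "(\<Sum>i=1..r. \<Sum>k=1..r. c i k * (X i \<tau> * X k \<tau> - m i k)) =
        (\<Sum>i=1..r. \<Sum>k=1..r. (sqrt (2 * \<omega> i) * X i \<tau>) * (sqrt (2 / \<omega> k) * X k \<tau>)) - (\<Sum>i=1..r. \<Sum>k=1..r. c i k * m i k)"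
      unfolding sum_subtractf[symmetric] by (intro sum.cong refl) (simp add: c_def algebra_simps)
    also have "(\<Sum>i=1..r. \<Sum>k=1..r. (sqrt (2 * \<omega> i) * X i \<tau>) * (sqrt (2 / \<omega> k) * X k \<tau>)) =
       (g \<bullet> exc_S r \<omega> b y \<tau>) * (g \<bullet> exc_Ry r \<omega> b y \<tau>)"
      unfolding S Ry by (rule sum_product[symmetric])
    finally have 3: "(\<Sum>i=1..r. \<Sum>k=1..r. c i k * (X i \<tau> * X k \<tau> - m i k)) =
       (g \<bullet> exc_S r \<omega> b y \<tau>) * (g \<bullet> exc_Ry r \<omega> b y \<tau>) - (\<Sum>i=1..r. \<Sum>j=1..2. (b i j \<bullet> g)\<^sup>2)"
      by (simp only: cm)
    show ?thesis unfolding A_def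
      by (rule DERIV_cong[OF DERIV_add[OF 1 2]]) (simp only: 3, simp add: \<rho>_def inner_add_right algebra_simps)
  qed
  moreover have "A (\<tau> + P) = A \<tau>" for \<tau>
  proof -
    have "\<rho> (\<tau> + P) = \<rho> \<tau>" unfolding \<rho>_def exc_R_def by (simp only: trig_periodic[OF per])
    then show ?thesis unfolding A_def using E(2) by simp
  qed
  ultimately show ?thesis by blast
qed

lemma sum_es_u_eq:
  assumes "v > 0" "\<And>i. i \<in> {1..r} \<Longrightarrow> \<omega> i > 0"
  shows "(\<Sum>i=1..r. \<Sum>j=1..2. es_u (\<omega> i) v \<tau> j *\<^sub>R b i j) = sqrt v *\<^sub>R exc_S r \<omega> b (ln v) \<tau>"
  unfolding exc_S_def trig_def scaleR_sum_right
  using assms(1) by (intro sum.cong refl) (simp add: es_u_def numeral_2_eq_2 real_sqrt_mult algebra_simps)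

section \<open>Averaging over one period\<close>

text \<open>At the first time at which \<open>\<phi>\<close> reaches \<open>h\<close> the weak bound
  holds up to that time, so \<open>step\<close> would make it strict there.\<close>

lemma continuity_bootstrap:
  fixes \<phi> :: "real \<Rightarrow> real"
  assumes cont: "continuous_on {a..c} \<phi>" and a: "\<phi> a < h"
    and step: "\<And>s. s \<in> {a..c} \<Longrightarrow> (\<And>r. r \<in> {a..s} \<Longrightarrow> \<phi> r \<le> h) \<Longrightarrow> \<phi> s < h"
    and s: "s \<in> {a..c}"
  shows "\<phi> s \<le> h"
proof (rule ccontr)
  assume "\<not> \<phi> s \<le> h"
  define S where "S = {a..s} \<inter> \<phi> -` {h..}"
  have cs: "continuous_on {a..s} \<phi>" using s by (intro continuous_on_subset[OF cont]) auto
  have "closed S" unfolding S_def using continuous_closed_preimage[OF cs] by auto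
  then have "compact S" by (simp add: compact_eq_bounded_closed S_def bounded_Int)
  moreover have "s \<in> S" using \<open>\<not> \<phi> s \<le> h\<close> s by (auto simp: S_def)
  ultimately obtain u where u: "u \<in> S" "\<And>v. v \<in> S \<Longrightarrow> u \<le> v"
    using compact_attains_inf[of S] by blast
  then have uI: "a \<le> u" "u \<le> s" "h \<le> \<phi> u" by (auto simp: S_def)
  have "continuous_on {a..u} \<phi>" using uI by (intro continuous_on_subset[OF cs]) auto
  then obtain v where v: "a \<le> v" "v \<le> u" "\<phi> v = h"
    using IVT'[of \<phi> a h u] a uI by auto
  then have "v \<in> S" using uI by (auto simp: S_def)
  then have "v = u" using u(2) v by fastforce
  then have hu: "\<phi> u = h" using v by simp
  have "\<phi> r \<le> h" if "r \<in> {a..u}" for r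
  proof (rule ccontr)
    assume "\<not> \<phi> r \<le> h"
    then have "r \<in> S" using that uI by (auto simp: S_def)
    then have "r = u" using u(2) that by fastforce
    then show False using hu \<open>\<not> \<phi> r \<le> h\<close> by simp
  qed
  then show False using step[of u] uI s hu by auto
qed

lemma norm_increment_le:
  fixes \<psi> :: "real \<Rightarrow> 'a::real_normed_vector"
  assumes d: "\<And>s. s \<in> {a..c} \<Longrightarrow> (\<psi> has_vector_derivative \<psi>' s) (at s within {a..c})"
    and B: "\<And>s. s \<in> {a..c} \<Longrightarrow> norm (\<psi>' s) \<le> B" and ac: "a \<le> c"
  shows "norm (\<psi> c - \<psi> a) \<le> B * (c - a)"
proof -
  have "norm (\<psi> c - \<psi> a) \<le> B * norm (c - a)"
  proof (rule differentiable_bound[of "{a..c}" \<psi> "\<lambda>u h. h *\<^sub>R \<psi>' u"])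
    fix u assume u: "u \<in> {a..c}"
    show "(\<psi> has_derivative (\<lambda>h. h *\<^sub>R \<psi>' u)) (at u within {a..c})"
      using d[OF u] by (simp add: has_vector_derivative_def)
    show "onorm (\<lambda>h. h *\<^sub>R \<psi>' u) \<le> B"
      using B[OF u] by (intro onorm_le) (simp add: mult.commute[of B] mult_left_mono)
  qed (use ac in auto)
  then show ?thesis using ac by simp
qed

lemma abs_ln_diff_le:
  fixes u v m :: real
  assumes "0 < m" "m \<le> u" "m \<le> v"
  shows "\<bar>ln u - ln v\<bar> \<le> \<bar>u - v\<bar> / m"
proof -
  have "ln u - ln v \<le> (u - v) / v" "ln v - ln u \<le> (v - u) / u"
    using assms by (auto intro!: ln_diff_le)
  moreover have "(u - v) / v \<le> \<bar>u - v\<bar> / m" "(v - u) / u \<le> \<bar>u - v\<bar> / m"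
    using assms by (auto intro!: frac_le)
  ultimately show ?thesis by linarith
qed

lemma abs_inner_le:
  assumes "norm u \<le> A" "norm v \<le> B"
  shows "\<bar>u \<bullet> v\<bar> \<le> A * B"
proof -
  have "0 \<le> A" using assms norm_ge_zero order_trans by blast
  then have "norm u * norm v \<le> A * B" using assms by (intro mult_mono) auto
  then show ?thesis using Cauchy_Schwarz_ineq2[of u v] by linarith
qed

text \<open>\<open>N = R/2 + R_y\<close> is the factor in the derivative of \<open>sqrt J * R (ln J) \<tau>\<close> with respect to \<open>J\<close>,
  which equals \<open>N / sqrt J\<close>.\<close>

locale averaging_data =
  fixes J :: "'a::euclidean_space \<Rightarrow> real" and G b0 :: "'a \<Rightarrow> 'a" and xs :: 'a
    and S R N :: "real \<Rightarrow> real \<Rightarrow> 'a" and Q :: "'a \<Rightarrow> real" and P K L L0 M \<kappa> \<gamma> :: real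
  assumes J_deriv: "(J has_derivative (\<lambda>h. G x \<bullet> h)) (at x)"
    and G_lip: "norm (G x - G z) \<le> L * norm (x - z)"
    and b0_lip: "norm (b0 x - b0 z) \<le> L0 * norm (x - z)"
    and L: "0 < L" and L0: "0 < L0" and P: "0 < P" and K: "1 \<le> K" and M: "0 < M"
    and S_le: "norm (S y \<tau>) \<le> K" and R_le: "norm (R y \<tau>) \<le> K" and N_le: "norm (N y \<tau>) \<le> K"
    and S_lip: "norm (S y \<tau> - S y' \<tau>) \<le> K * \<bar>y - y'\<bar>"
    and R_lip: "norm (R y \<tau> - R y' \<tau>) \<le> K * \<bar>y - y'\<bar>"
    and N_lip: "norm (N y \<tau> - N y' \<tau>) \<le> K * \<bar>y - y'\<bar>"
    and R_deriv: "\<And>y \<tau> y' \<tau>' s A. (y has_real_derivative y') (at s within A) \<Longrightarrow> (\<tau> has_real_derivative \<tau>') (at s within A) \<Longrightarrow>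
      ((\<lambda>s. R (y s) (\<tau> s)) has_vector_derivative
        y' *\<^sub>R (N (y s) (\<tau> s) - (1/2) *\<^sub>R R (y s) (\<tau> s)) + \<tau>' *\<^sub>R S (y s) (\<tau> s)) (at s within A)"
    and R_per: "R y (\<tau> + P) = R y \<tau>"
    and average: "\<exists>A. (\<forall>\<tau>. (A has_real_derivative ((g \<bullet> S y \<tau>) * (g \<bullet> N y \<tau>) - Q g)) (at \<tau>)) \<and> (\<forall>\<tau>. A (\<tau> + P) = A \<tau>)"
    and Q_ge: "\<gamma> * (norm g)\<^sup>2 \<le> Q g" and b0_le: "norm (b0 x) \<le> \<kappa> * norm (G x)"
    and region: "M \<le> v \<Longrightarrow> v / 2 \<le> J z - J xs \<Longrightarrow> J z - J xs \<le> 2 * v \<Longrightarrow>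
      norm (G z) \<le> K * sqrt v \<and> norm (b0 z) \<le> K * sqrt v \<and> 0 < J z \<and> sqrt (J z) \<le> K * sqrt v \<and> sqrt v \<le> K * sqrt (J z)"
begin

lemma descent: "\<bar>J y - J x - G x \<bullet> (y - x)\<bar> \<le> L * (norm (y - x))\<^sup>2"
  by (rule descent_bound[OF J_deriv G_lip])

text \<open>What matters about these constants is that they depend neither on \<open>\<epsilon>\<close> nor on the trajectory.\<close>

definition "c1 = (K + K * K) * P"
definition "c2 = K * c1 + L * c1\<^sup>2"
definition "c3 = K\<^sup>2 * c2"
definition "c4 = K + (K * K + K * K * K) * K"
definition "c5 = K * K + K * K * (K * K)"
definition "c6 = c4 * P + c5 * c2"
definition "c7 = K * c6 + L * c6\<^sup>2"
definition "c8 = K * (L0 * c1) + (K * K * K) * (K * K) + ((L * c1) * K + K * (K * c3)) * (K * K) + (K * K) * (K * (K * c3))"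
definition "c9 = c8 * P + K * (c5 * c7) + L * c6\<^sup>2"

lemma c_nonneg: "0 < c1" "0 < c2" "0 < c3" "0 < c4" "0 < c5" "0 < c6" "0 < c7" "0 < c8" "0 < c9"
proof -
  have K0: "0 < K" using K by simp
  show c1: "0 < c1" using K0 P by (simp add: c1_def add_pos_pos)
  show c2: "0 < c2" using K0 L c1 by (simp add: c2_def add_pos_pos)
  show c3: "0 < c3" using K0 c2 by (simp add: c3_def)
  show c4: "0 < c4" using K0 by (simp add: c4_def add_pos_pos)
  show c5: "0 < c5" using K0 by (simp add: c5_def add_pos_pos)
  show c6: "0 < c6" using c4 c5 c2 P by (simp add: c6_def add_pos_pos)
  show c7: "0 < c7" using K0 L c6 by (simp add: c7_def add_pos_pos)
  show c8: "0 < c8" unfolding c8_def using K0 L L0 c1 c3 by (intro add_pos_pos mult_pos_pos) auto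
  show "0 < c9" unfolding c9_def using c8 P K0 c5 c7 L c6 by (intro add_pos_pos mult_pos_pos) auto
qed

end

text \<open>The window may be shorter than a full period, since the growth bound is also needed on
  incomplete windows. The equation is assumed only where \<open>J\<close> is positive, because only
  there do the controls have the form \<open>sqrt J * S\<close>; positivity throughout the window
  has to be proved.\<close>

locale averaging_window = averaging_data J G b0 xs S R N Q P K L L0 M \<kappa> \<gamma>
  for J :: "'a::euclidean_space \<Rightarrow> real" and G b0 :: "'a \<Rightarrow> 'a" and xs :: 'a
    and S R N :: "real \<Rightarrow> real \<Rightarrow> 'a" and Q :: "'a \<Rightarrow> real" and P K L L0 M \<kappa> \<gamma> :: real +
  fixes \<epsilon> a c :: real and x :: "real \<Rightarrow> 'a" and \<tau> :: "real \<Rightarrow> real"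
  assumes eps: "0 < \<epsilon>" "\<epsilon> \<le> 1" "c2 * \<epsilon> \<le> 1/4"
    and ac: "a \<le> c" "c \<le> a + \<epsilon>\<^sup>2 * P"
    and V_ge: "M \<le> J (x a) - J xs"
    and tau: "s \<in> {a..c} \<Longrightarrow> \<tau> s = \<tau> a + (s - a) / \<epsilon>\<^sup>2"
    and x_cont: "continuous_on {a..c} x"
    and x_deriv: "s \<in> {a..c} \<Longrightarrow> 0 < J (x s) \<Longrightarrow>
      (x has_vector_derivative b0 (x s) + (1/\<epsilon>) *\<^sub>R (sqrt (J (x s)) *\<^sub>R S (ln (J (x s))) (\<tau> s))) (at s within {a..c})"
begin

text \<open>The natural units of the window: displacements are measured in \<open>\<rho>\<close> and
  changes of \<open>J\<close> in \<open>v\<close>. The term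
  \<open>\<epsilon> *\<^sub>R \<theta> s\<close> is the corrector, the fast oscillation of the state
  to first order.\<close>

definition "v = J (x a) - J xs"
definition "\<rho> = sqrt v"
definition "\<theta> s = sqrt (J (x s)) *\<^sub>R R (ln (J (x s))) (\<tau> s)"

lemma rho: "0 < \<rho>" "\<rho> * \<rho> = v" "0 < v"
  using M V_ge by (auto simp: \<rho>_def v_def)

lemma region_at:
  assumes "\<bar>J (x s) - J (x a)\<bar> \<le> v / 2"
  shows "norm (G (x s)) \<le> K * \<rho>" "norm (b0 (x s)) \<le> K * \<rho>" "0 < J (x s)" "sqrt (J (x s)) \<le> K * \<rho>" "\<rho> \<le> K * sqrt (J (x s))"
  using region[of v "x s"] assms V_ge rho unfolding \<rho>_def v_def by (auto simp: abs_if split: if_splits)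

text \<open>A velocity of order \<open>\<rho> / \<epsilon>\<close> acts for a time of order
  \<open>\<epsilon>\<^sup>2\<close>. The premise \<open>reg\<close> is provisional: it is what the
  second conclusion allows to be recovered with a strictly better constant.\<close>

lemma displacement_of_region:
  assumes s: "s \<in> {a..c}" and reg: "\<And>r. r \<in> {a..s} \<Longrightarrow> \<bar>J (x r) - J (x a)\<bar> \<le> v / 2"
  shows "norm (x s - x a) \<le> c1 * \<epsilon> * \<rho>" "\<bar>J (x s) - J (x a)\<bar> \<le> c2 * \<epsilon> * v"
proof -
  have "norm (x s - x a) \<le> ((K + K * K) * \<rho> / \<epsilon>) * (s - a)"
  proof (rule norm_increment_le)
    fix r assume r: "r \<in> {a..s}"
    note reg' = region_at[OF reg[OF r]]
    show "(x has_vector_derivative b0 (x r) + (1/\<epsilon>) *\<^sub>R (sqrt (J (x r)) *\<^sub>R S (ln (J (x r))) (\<tau> r))) (at r within {a..s})"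
      using r s reg' by (intro has_vector_derivative_within_subset[OF x_deriv]) auto
    have "norm (sqrt (J (x r)) *\<^sub>R S (ln (J (x r))) (\<tau> r)) \<le> (K * \<rho>) * K"
      unfolding norm_scaleR using reg' S_le K rho by (intro mult_mono) auto
    then have "norm ((1/\<epsilon>) *\<^sub>R (sqrt (J (x r)) *\<^sub>R S (ln (J (x r))) (\<tau> r))) \<le> K * \<rho> * K / \<epsilon>"
      using eps by (simp add: divide_right_mono)
    moreover have "K * \<rho> \<le> K * \<rho> / \<epsilon>" using eps K rho by (simp add: field_simps)
    ultimately show "norm (b0 (x r) + (1/\<epsilon>) *\<^sub>R (sqrt (J (x r)) *\<^sub>R S (ln (J (x r))) (\<tau> r))) \<le> (K + K * K) * \<rho> / \<epsilon>"
      using reg'(2) norm_triangle_ineq[of "b0 (x r)" "(1/\<epsilon>) *\<^sub>R (sqrt (J (x r)) *\<^sub>R S (ln (J (x r))) (\<tau> r))"]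
      by (simp add: add_divide_distrib algebra_simps)
  qed (use s in auto)
  also have "\<dots> \<le> ((K + K * K) * \<rho> / \<epsilon>) * (\<epsilon>\<^sup>2 * P)"
    using s ac K rho eps by (intro mult_left_mono) auto
  also have "\<dots> = c1 * \<epsilon> * \<rho>" using eps by (simp add: c1_def power2_eq_square field_simps)
  finally show 1: "norm (x s - x a) \<le> c1 * \<epsilon> * \<rho>" .
  have "norm (G (x a)) \<le> K * \<rho>" using region_at(1)[of a] rho by simp
  from abs_inner_le[OF this 1] have "\<bar>G (x a) \<bullet> (x s - x a)\<bar> \<le> K * \<rho> * (c1 * \<epsilon> * \<rho>)" .
  also have "\<dots> = K * c1 * \<epsilon> * v" using rho by (simp add: algebra_simps)
  finally have g: "\<bar>G (x a) \<bullet> (x s - x a)\<bar> \<le> K * c1 * \<epsilon> * v" .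
  have "(norm (x s - x a))\<^sup>2 \<le> (c1 * \<epsilon> * \<rho>)\<^sup>2" using 1 by (intro power_mono) auto
  also have "\<dots> = \<epsilon> * (c1\<^sup>2 * \<epsilon> * v)" using rho by (simp add: power2_eq_square algebra_simps flip: rho(2))
  also have "\<dots> \<le> 1 * (c1\<^sup>2 * \<epsilon> * v)" using eps rho by (intro mult_right_mono) auto
  finally have "L * (norm (x s - x a))\<^sup>2 \<le> L * (c1\<^sup>2 * \<epsilon> * v)" using L by simp
  then show "\<bar>J (x s) - J (x a)\<bar> \<le> c2 * \<epsilon> * v"
    using descent[of "x s" "x a"] g by (simp add: c2_def algebra_simps)
qed

text \<open>The condition \<open>c2 * \<epsilon> \<le> 1/4\<close> sharpens the provisional bound
  \<open>v / 2\<close> to \<open>v / 4\<close>, which closes the bootstrap and, through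
  \<open>region_at\<close>, gives positivity of \<open>J\<close>.\<close>

lemma J_close: assumes s: "s \<in> {a..c}" shows "\<bar>J (x s) - J (x a)\<bar> \<le> v / 2"
proof (rule continuity_bootstrap[where \<phi>="\<lambda>s. \<bar>J (x s) - J (x a)\<bar>", OF _ _ _ s])
  have "continuous_on UNIV J" using J_deriv has_derivative_continuous continuous_at_imp_continuous_on by blast
  then show "continuous_on {a..c} (\<lambda>s. \<bar>J (x s) - J (x a)\<bar>)"
    by (intro continuous_intros continuous_on_compose2[OF _ x_cont]) auto
  fix s assume "s \<in> {a..c}" "\<And>r. r \<in> {a..s} \<Longrightarrow> \<bar>J (x r) - J (x a)\<bar> \<le> v / 2"
  then have "\<bar>J (x s) - J (x a)\<bar> \<le> (c2 * \<epsilon>) * v" using displacement_of_region(2) by blast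
  also have "\<dots> \<le> 1/4 * v" using eps rho by (intro mult_right_mono) auto
  finally show "\<bar>J (x s) - J (x a)\<bar> < v / 2" using rho by simp
qed (use rho in simp)

lemma displacement:
  assumes "s \<in> {a..c}"
  shows "norm (x s - x a) \<le> c1 * \<epsilon> * \<rho>" "\<bar>J (x s) - J (x a)\<bar> \<le> c2 * \<epsilon> * v"
  using displacement_of_region[OF assms] J_close assms by auto

lemmas at_point = region_at[OF J_close]

lemma start: "norm (G (x a)) \<le> K * \<rho>" "norm (b0 (x a)) \<le> K * \<rho>" "0 < J (x a)" "sqrt (J (x a)) \<le> K * \<rho>" "\<rho> \<le> K * sqrt (J (x a))"
  using at_point[of a] ac by auto

lemma inverse_sqrt_J: assumes "s \<in> {a..c}" shows "1 / sqrt (J (x s)) \<le> K / \<rho>"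
  using at_point[OF assms] rho K by (simp add: field_simps)

lemma J_ge: assumes "s \<in> {a..c}" shows "v / K\<^sup>2 \<le> J (x s)"
proof -
  have "\<rho>\<^sup>2 \<le> (K * sqrt (J (x s)))\<^sup>2" using at_point(5)[OF assms] rho by (intro power_mono) auto
  also have "\<dots> = K\<^sup>2 * J (x s)" using at_point(3)[OF assms] by (simp add: power_mult_distrib)
  finally show ?thesis using K rho by (simp add: field_simps power2_eq_square)
qed

lemma ln_J_diff:
  assumes "s \<in> {a..c}"
  shows "\<bar>ln (J (x s)) - ln (J (x a))\<bar> \<le> \<bar>J (x s) - J (x a)\<bar> / (v / K\<^sup>2)"
  by (rule abs_ln_diff_le) (use J_ge assms ac rho K in auto)

text \<open>The logarithm sees only the relative change of \<open>J\<close>, so the phase drifts by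
  order \<open>\<epsilon>\<close> independently of \<open>v\<close>.\<close>

lemma ln_J_close:
  assumes s: "s \<in> {a..c}"
  shows "\<bar>ln (J (x s)) - ln (J (x a))\<bar> \<le> c3 * \<epsilon>"
proof -
  have "\<bar>J (x s) - J (x a)\<bar> / (v / K\<^sup>2) \<le> c2 * \<epsilon> * v / (v / K\<^sup>2)"
    using displacement(2)[OF s] rho K by (intro divide_right_mono) auto
  also have "\<dots> = c3 * \<epsilon>" using rho K by (simp add: c3_def field_simps)
  finally show ?thesis using ln_J_diff[OF s] by linarith
qed

lemma tau_deriv:
  assumes s: "s \<in> {a..c}"
  shows "(\<tau> has_real_derivative 1 / \<epsilon>\<^sup>2) (at s within {a..c})"
proof -
  have "((\<lambda>s. \<tau> a + (s - a) / \<epsilon>\<^sup>2) has_real_derivative 0 + (1 - 0) / \<epsilon>\<^sup>2) (at s within {a..c})"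
    by (intro DERIV_add DERIV_const DERIV_cdivide DERIV_diff DERIV_ident)
  then have "(\<tau> has_real_derivative 0 + (1 - 0) / \<epsilon>\<^sup>2) (at s within {a..c})"
    by (rule has_field_derivative_transform_within[OF _ zero_less_one s]) (simp add: tau[symmetric])
  then show ?thesis by simp
qed

text \<open>Since \<open>R\<close> has \<open>\<tau>\<close>-derivative \<open>S\<close> and
  \<open>\<tau>\<close> moves with speed \<open>1 / \<epsilon>\<^sup>2\<close>, the fast control
  term cancels. The corrector still varies through \<open>J\<close>: its rate is
  \<open>\<epsilon> * j' / sqrt J\<close> times \<open>N\<close>, and the
  \<open>1 / \<epsilon>\<close> in \<open>j'\<close> turns this into the bounded term with
  \<open>G \<bullet> S\<close>.\<close>

lemma corrected_has_derivative:
  assumes s: "s \<in> {a..c}"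
  shows "((\<lambda>s. x s - \<epsilon> *\<^sub>R \<theta> s) has_vector_derivative
    b0 (x s) - (G (x s) \<bullet> S (ln (J (x s))) (\<tau> s) + \<epsilon> * (G (x s) \<bullet> b0 (x s)) / sqrt (J (x s))) *\<^sub>R N (ln (J (x s))) (\<tau> s))
    (at s within {a..c})"
proof -
  define j where "j = J (x s)"
  define \<sigma> where "\<sigma> = sqrt j"
  define S' N' R' where "S' = S (ln j) (\<tau> s)" and "N' = N (ln j) (\<tau> s)" and "R' = R (ln j) (\<tau> s)"
  define X where "X = b0 (x s) + (1/\<epsilon>) *\<^sub>R (\<sigma> *\<^sub>R S')"
  define j' where "j' = G (x s) \<bullet> X"
  have j0: "0 < j" using at_point[OF s] by (simp add: j_def)
  have s0: "0 < \<sigma>" "\<sigma> * \<sigma> = j" using j0 by (auto simp: \<sigma>_def)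
  have dx: "(x has_vector_derivative X) (at s within {a..c})"
    using x_deriv[OF s] j0 by (simp add: X_def S'_def \<sigma>_def j_def)
  have dj: "((\<lambda>s. J (x s)) has_real_derivative j') (at s within {a..c})"
    using has_derivative_compose[OF dx[unfolded has_vector_derivative_def] J_deriv]
    by (simp add: has_real_derivative_iff_has_vector_derivative has_vector_derivative_def j'_def)
  have dsq: "((\<lambda>s. sqrt (J (x s))) has_real_derivative j' / (2 * \<sigma>)) (at s within {a..c})"
    by (rule DERIV_cong[OF DERIV_chain2[OF DERIV_real_sqrt dj]]) (use j0 in \<open>auto simp: j_def \<sigma>_def field_simps\<close>)
  have dln: "((\<lambda>s. ln (J (x s))) has_real_derivative j' / j) (at s within {a..c})"
    by (rule DERIV_cong[OF DERIV_chain2[OF DERIV_ln dj]]) (use j0 in \<open>auto simp: j_def field_simps\<close>)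
  note dtau = tau_deriv[OF s]
  have "(\<theta> has_vector_derivative \<sigma> *\<^sub>R ((j' / j) *\<^sub>R (N' - (1/2) *\<^sub>R R') + (1 / \<epsilon>\<^sup>2) *\<^sub>R S') + (j' / (2 * \<sigma>)) *\<^sub>R R') (at s within {a..c})"
    using has_vector_derivative_scaleR[OF dsq R_deriv[OF dln dtau]]
    by (simp add: \<theta>_def[abs_def] \<sigma>_def j_def N'_def R'_def S'_def)
  \<comment> \<open>The derivative of \<open>sqrt J\<close> contributes exactly the half of
    \<open>R\<close> that was subtracted from \<open>N\<close>.\<close>
  also have "\<sigma> *\<^sub>R ((j' / j) *\<^sub>R (N' - (1/2) *\<^sub>R R') + (1 / \<epsilon>\<^sup>2) *\<^sub>R S') + (j' / (2 * \<sigma>)) *\<^sub>R R' = (j' / \<sigma>) *\<^sub>R N' + (\<sigma> / \<epsilon>\<^sup>2) *\<^sub>R S'"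
    using s0 by (simp add: scaleR_right_distrib scaleR_right_diff_distrib flip: s0(2))
  finally have d\<theta>: "(\<theta> has_vector_derivative (j' / \<sigma>) *\<^sub>R N' + (\<sigma> / \<epsilon>\<^sup>2) *\<^sub>R S') (at s within {a..c})" .
  have "((\<lambda>s. x s - \<epsilon> *\<^sub>R \<theta> s) has_vector_derivative X - \<epsilon> *\<^sub>R ((j' / \<sigma>) *\<^sub>R N' + (\<sigma> / \<epsilon>\<^sup>2) *\<^sub>R S')) (at s within {a..c})"
    by (intro has_vector_derivative_diff dx bounded_linear.has_vector_derivative[OF bounded_linear_scaleR_right] d\<theta>)
  moreover have "\<epsilon> *\<^sub>R ((j' / \<sigma>) *\<^sub>R N' + (\<sigma> / \<epsilon>\<^sup>2) *\<^sub>R S') = (\<epsilon> * j' / \<sigma>) *\<^sub>R N' + (1/\<epsilon>) *\<^sub>R (\<sigma> *\<^sub>R S')"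
    using eps by (simp add: scaleR_right_distrib power2_eq_square)
  moreover have "\<epsilon> * j' / \<sigma> = G (x s) \<bullet> S' + \<epsilon> * (G (x s) \<bullet> b0 (x s)) / \<sigma>"
    using eps s0 by (simp add: j'_def X_def inner_add_right field_simps)
  ultimately show ?thesis
    by (simp add: X_def S'_def N'_def \<sigma>_def j_def)
qed

lemma correction_small:
  assumes s: "s \<in> {a..c}"
  shows "\<bar>\<epsilon> * (G (x s) \<bullet> b0 (x s)) / sqrt (J (x s))\<bar> \<le> \<epsilon> * (K * K * K) * \<rho>"
proof -
  have "\<bar>G (x s) \<bullet> b0 (x s)\<bar> \<le> (K * \<rho>) * (K * \<rho>)" by (intro abs_inner_le at_point s)
  then have "\<bar>G (x s) \<bullet> b0 (x s)\<bar> * (1 / sqrt (J (x s))) \<le> (K * \<rho>) * (K * \<rho>) * (K / \<rho>)"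
    using K rho at_point(3)[OF s] by (intro mult_mono inverse_sqrt_J s) auto
  also have "\<dots> = (K * K * K) * \<rho>" using rho by simp
  finally have "\<epsilon> * (\<bar>G (x s) \<bullet> b0 (x s)\<bar> * (1 / sqrt (J (x s)))) \<le> \<epsilon> * ((K * K * K) * \<rho>)" using eps by (intro mult_left_mono) auto
  moreover have "\<bar>\<epsilon> * (G (x s) \<bullet> b0 (x s)) / sqrt (J (x s))\<bar> = \<epsilon> * (\<bar>G (x s) \<bullet> b0 (x s)\<bar> * (1 / sqrt (J (x s))))"
    using eps at_point(3)[OF s] by (simp add: abs_mult)
  ultimately show ?thesis by (simp only: mult.assoc)
qed

text \<open>Over a full window \<open>\<tau>\<close> advances by one period, so \<open>\<theta>\<close> changes only through \<open>J\<close>.\<close>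

lemma theta_diff:
  assumes full: "c = a + \<epsilon>\<^sup>2 * P"
  shows "norm (\<theta> c - \<theta> a) \<le> c5 * (\<bar>J (x c) - J (x a)\<bar> / \<rho>)"
proof -
  have c: "c \<in> {a..c}" and a: "a \<in> {a..c}" using ac by auto
  define d where "d = \<bar>J (x c) - J (x a)\<bar>"
  have tc: "\<tau> c = \<tau> a + P" using tau[OF c] full eps by simp
  have Rc: "\<theta> c = sqrt (J (x c)) *\<^sub>R R (ln (J (x c))) (\<tau> a)" unfolding \<theta>_def tc R_per ..
  have "\<theta> c - \<theta> a = (sqrt (J (x c)) - sqrt (J (x a))) *\<^sub>R R (ln (J (x c))) (\<tau> a)
      + sqrt (J (x a)) *\<^sub>R (R (ln (J (x c))) (\<tau> a) - R (ln (J (x a))) (\<tau> a))"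
    unfolding Rc \<theta>_def[of a] by (simp add: algebra_simps)
  then have "norm (\<theta> c - \<theta> a) \<le> \<bar>sqrt (J (x c)) - sqrt (J (x a))\<bar> * norm (R (ln (J (x c))) (\<tau> a))
      + \<bar>sqrt (J (x a))\<bar> * norm (R (ln (J (x c))) (\<tau> a) - R (ln (J (x a))) (\<tau> a))"
    by (metis norm_scaleR norm_triangle_ineq)
  moreover have "\<bar>sqrt (J (x c)) - sqrt (J (x a))\<bar> * norm (R (ln (J (x c))) (\<tau> a)) \<le> (d * (K / \<rho>)) * K"
  proof (rule mult_mono)
    have "(sqrt (J (x c)) - sqrt (J (x a))) * (sqrt (J (x c)) + sqrt (J (x a))) = J (x c) - J (x a)"
      using at_point(3)[OF c] at_point(3)[OF a] by (simp add: algebra_simps)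
    then have "\<bar>sqrt (J (x c)) - sqrt (J (x a))\<bar> * (sqrt (J (x c)) + sqrt (J (x a))) = d"
      unfolding d_def using at_point(3)[OF c] at_point(3)[OF a]
      by (metis abs_mult abs_of_pos add_pos_pos real_sqrt_gt_zero)
    then have "\<bar>sqrt (J (x c)) - sqrt (J (x a))\<bar> * sqrt (J (x a)) \<le> d"
      using at_point(3)[OF c] mult_left_mono[of "sqrt (J (x a))" "sqrt (J (x c)) + sqrt (J (x a))" "\<bar>sqrt (J (x c)) - sqrt (J (x a))\<bar>"] by simp
    then have "\<bar>sqrt (J (x c)) - sqrt (J (x a))\<bar> \<le> d * (1 / sqrt (J (x a)))"
      using at_point(3)[OF a] by (simp add: field_simps)
    also have "\<dots> \<le> d * (K / \<rho>)" by (intro mult_left_mono inverse_sqrt_J a) (simp add: d_def)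
    finally show "\<bar>sqrt (J (x c)) - sqrt (J (x a))\<bar> \<le> d * (K / \<rho>)" .
  qed (use R_le K rho in \<open>auto simp: d_def\<close>)
  moreover have "\<bar>sqrt (J (x a))\<bar> * norm (R (ln (J (x c))) (\<tau> a) - R (ln (J (x a))) (\<tau> a)) \<le> (K * \<rho>) * (K * (d / (v / K\<^sup>2)))"
  proof (rule mult_mono)
    have "norm (R (ln (J (x c))) (\<tau> a) - R (ln (J (x a))) (\<tau> a)) \<le> K * \<bar>ln (J (x c)) - ln (J (x a))\<bar>" by (rule R_lip)
    also have "\<dots> \<le> K * (d / (v / K\<^sup>2))" unfolding d_def using K by (intro mult_left_mono ln_J_diff c) auto
    finally show "norm (R (ln (J (x c))) (\<tau> a) - R (ln (J (x a))) (\<tau> a)) \<le> K * (d / (v / K\<^sup>2))" .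
  qed (use start K rho in auto)
  moreover have "(d * (K / \<rho>)) * K = (K * K) * (d / \<rho>)" by simp
  moreover have "(K * \<rho>) * (K * (d / (v / K\<^sup>2))) = (K * K * (K * K)) * (d / \<rho>)"
    using rho by (simp add: power2_eq_square field_simps flip: rho(2))
  ultimately show ?thesis unfolding d_def[symmetric] c5_def by (simp add: algebra_simps)
qed

text \<open>Bootstrap: the change of \<open>J\<close> over a window, a priori of order \<open>\<epsilon>\<close>, bounds that of \<open>\<epsilon> \<theta>\<close> by order
  \<open>\<epsilon>\<^sup>2\<close>, which improves the displacement, hence the change of \<open>J\<close>, to order \<open>\<epsilon>\<^sup>2\<close>.\<close>

lemma full_displacement:
  assumes full: "c = a + \<epsilon>\<^sup>2 * P"
  shows "norm (x c - x a) \<le> c6 * \<epsilon>\<^sup>2 * \<rho>" "\<bar>J (x c) - J (x a)\<bar> \<le> c7 * \<epsilon>\<^sup>2 * v" "norm (\<theta> c - \<theta> a) \<le> c5 * c7 * \<epsilon>\<^sup>2 * \<rho>"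
proof -
  have c: "c \<in> {a..c}" and a: "a \<in> {a..c}" using ac by auto
  \<comment> \<open>After the cancellation the velocity is of order \<open>\<rho>\<close> instead of
    \<open>\<rho> / \<epsilon>\<close>, so the corrected state moves only by order
    \<open>\<epsilon>\<^sup>2 * \<rho>\<close>.\<close>
  have "norm ((x c - \<epsilon> *\<^sub>R \<theta> c) - (x a - \<epsilon> *\<^sub>R \<theta> a)) \<le> (c4 * \<rho>) * (c - a)"
  proof (rule norm_increment_le[OF corrected_has_derivative _ ac(1)])
    fix s assume s: "s \<in> {a..c}"
    have "\<bar>G (x s) \<bullet> S (ln (J (x s))) (\<tau> s)\<bar> \<le> (K * \<rho>) * K" by (intro abs_inner_le at_point s S_le)
    moreover have "\<epsilon> * (K * K * K) * \<rho> \<le> 1 * (K * K * K) * \<rho>" using eps K rho by (intro mult_right_mono) auto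
    ultimately have "\<bar>G (x s) \<bullet> S (ln (J (x s))) (\<tau> s) + \<epsilon> * (G (x s) \<bullet> b0 (x s)) / sqrt (J (x s))\<bar> \<le> (K * K + K * K * K) * \<rho>"
      using correction_small[OF s] by (simp only: distrib_right mult.assoc mult_1 mult.commute[of \<rho>])
    then have "norm ((G (x s) \<bullet> S (ln (J (x s))) (\<tau> s) + \<epsilon> * (G (x s) \<bullet> b0 (x s)) / sqrt (J (x s))) *\<^sub>R N (ln (J (x s))) (\<tau> s)) \<le> (K * K + K * K * K) * \<rho> * K"
      unfolding norm_scaleR using N_le K rho by (intro mult_mono) auto
    then show "norm (b0 (x s) - (G (x s) \<bullet> S (ln (J (x s))) (\<tau> s) + \<epsilon> * (G (x s) \<bullet> b0 (x s)) / sqrt (J (x s))) *\<^sub>R N (ln (J (x s))) (\<tau> s)) \<le> c4 * \<rho>"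
      using norm_triangle_ineq4[of "b0 (x s)"] at_point(2)[OF s] unfolding c4_def by (smt (verit) distrib_right mult.assoc mult.commute)
  qed
  then have A: "norm ((x c - \<epsilon> *\<^sub>R \<theta> c) - (x a - \<epsilon> *\<^sub>R \<theta> a)) \<le> c4 * P * \<epsilon>\<^sup>2 * \<rho>"
    using full by (simp add: algebra_simps)
  have split: "norm (x c - x a) \<le> norm ((x c - \<epsilon> *\<^sub>R \<theta> c) - (x a - \<epsilon> *\<^sub>R \<theta> a)) + \<epsilon> * norm (\<theta> c - \<theta> a)"
  proof -
    have "x c - x a = ((x c - \<epsilon> *\<^sub>R \<theta> c) - (x a - \<epsilon> *\<^sub>R \<theta> a)) + \<epsilon> *\<^sub>R (\<theta> c - \<theta> a)" by (simp add: algebra_simps)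
    then show ?thesis using norm_triangle_ineq eps by (metis abs_of_pos norm_scaleR)
  qed
  have B: "c5 * (d / \<rho>) \<le> c5 * (e * \<rho>)" if "d \<le> e * v" for d e
    using that rho c_nonneg by (intro mult_left_mono) (auto simp: field_simps)
  have "norm (\<theta> c - \<theta> a) \<le> c5 * (c2 * \<epsilon> * \<rho>)"
    using theta_diff[OF full] B[OF displacement(2)[OF c]] by linarith
  then have "\<epsilon> * norm (\<theta> c - \<theta> a) \<le> \<epsilon> * (c5 * (c2 * \<epsilon> * \<rho>))" using eps by simp
  then show 1: "norm (x c - x a) \<le> c6 * \<epsilon>\<^sup>2 * \<rho>"
    using A split by (simp add: c6_def power2_eq_square algebra_simps)
  have g: "\<bar>G (x a) \<bullet> (x c - x a)\<bar> \<le> K * \<rho> * (c6 * \<epsilon>\<^sup>2 * \<rho>)" by (intro abs_inner_le start 1)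
  have "(norm (x c - x a))\<^sup>2 \<le> (c6 * \<epsilon>\<^sup>2 * \<rho>)\<^sup>2" using 1 by (intro power_mono) auto
  also have "\<dots> = \<epsilon>\<^sup>2 * (c6\<^sup>2 * \<epsilon>\<^sup>2 * v)" by (simp add: power2_eq_square algebra_simps flip: rho(2))
  also have "\<dots> \<le> 1 * (c6\<^sup>2 * \<epsilon>\<^sup>2 * v)" using eps rho by (intro mult_right_mono power_le_one) auto
  finally have "L * (norm (x c - x a))\<^sup>2 \<le> L * (c6\<^sup>2 * \<epsilon>\<^sup>2 * v)" using L by simp
  then show 2: "\<bar>J (x c) - J (x a)\<bar> \<le> c7 * \<epsilon>\<^sup>2 * v"
    using descent[of "x c" "x a"] g by (simp add: c7_def algebra_simps flip: rho(2))
  show "norm (\<theta> c - \<theta> a) \<le> c5 * c7 * \<epsilon>\<^sup>2 * \<rho>"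
    using theta_diff[OF full] B[OF 2] by (simp add: algebra_simps)
qed

lemma window_growth: assumes "s \<in> {a..c}" shows "J (x s) - J xs \<le> 2 * (J (x a) - J xs)"
  using J_close[OF assms] rho by (simp add: v_def abs_if split: if_splits)

text \<open>The first-order part of the change of \<open>J\<close> is
  \<open>g \<bullet> (x c - x a)\<close>, computed through the corrected state with all coefficients
  frozen at \<open>a\<close>. The quadratic remainder of \<open>descent\<close> is harmless only
  because the displacement over a full window is of order \<open>\<epsilon>\<^sup>2\<close>.\<close>

lemma window_decrease:
  assumes full: "c = a + \<epsilon>\<^sup>2 * P"
  shows "J (x c) - J xs \<le> (J (x a) - J xs) - \<epsilon>\<^sup>2 * P * (\<gamma> - \<kappa>) * (norm (G (x a)))\<^sup>2 + c9 * \<epsilon> ^ 3 * (J (x a) - J xs)"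
proof -
  have c: "c \<in> {a..c}" and a: "a \<in> {a..c}" using ac by auto
  define g where "g = G (x a)"
  define y where "y = ln (J (x a))"
  have g: "norm g \<le> K * \<rho>" using start by (simp add: g_def)
  obtain A where A: "\<And>t. (A has_real_derivative ((g \<bullet> S y t) * (g \<bullet> N y t) - Q g)) (at t)" "\<And>t. A (t + P) = A t"
    using average[of g y] by blast
  define w where "w = (\<lambda>s. g \<bullet> (x s - \<epsilon> *\<^sub>R \<theta> s) + \<epsilon>\<^sup>2 * A (\<tau> s) - (s - a) * (g \<bullet> b0 (x a) - Q g))"
  define w' where "w' = (\<lambda>s. g \<bullet> (b0 (x s) - (G (x s) \<bullet> S (ln (J (x s))) (\<tau> s) + \<epsilon> * (G (x s) \<bullet> b0 (x s)) / sqrt (J (x s))) *\<^sub>R N (ln (J (x s))) (\<tau> s))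
     + \<epsilon>\<^sup>2 * (((g \<bullet> S y (\<tau> s)) * (g \<bullet> N y (\<tau> s)) - Q g) * (1 / \<epsilon>\<^sup>2)) - (g \<bullet> b0 (x a) - Q g))"
  have dw: "(w has_vector_derivative w' s) (at s within {a..c})" if s: "s \<in> {a..c}" for s
  proof -
    note dtau = tau_deriv[OF s]
    have d1: "((\<lambda>s. g \<bullet> (x s - \<epsilon> *\<^sub>R \<theta> s)) has_real_derivative g \<bullet> (b0 (x s) - (G (x s) \<bullet> S (ln (J (x s))) (\<tau> s) + \<epsilon> * (G (x s) \<bullet> b0 (x s)) / sqrt (J (x s))) *\<^sub>R N (ln (J (x s))) (\<tau> s))) (at s within {a..c})"
      unfolding has_real_derivative_iff_has_vector_derivative
      by (rule bounded_linear.has_vector_derivative[OF bounded_linear_inner_right corrected_has_derivative[OF s]])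
    have d2: "((\<lambda>s. \<epsilon>\<^sup>2 * A (\<tau> s)) has_real_derivative \<epsilon>\<^sup>2 * (((g \<bullet> S y (\<tau> s)) * (g \<bullet> N y (\<tau> s)) - Q g) * (1 / \<epsilon>\<^sup>2))) (at s within {a..c})"
      by (intro DERIV_cmult DERIV_chain2[OF A(1) dtau])
    have d3: "((\<lambda>s. (s - a) * (g \<bullet> b0 (x a) - Q g)) has_real_derivative (g \<bullet> b0 (x a) - Q g)) (at s within {a..c})"
      by (rule derivative_eq_intros refl | simp)+
    show ?thesis unfolding w_def w'_def has_real_derivative_iff_has_vector_derivative[symmetric]
      by (intro DERIV_diff DERIV_add d1 d2 d3)
  qed
  have bw: "norm (w' s) \<le> c8 * \<epsilon> * v" if s: "s \<in> {a..c}" for s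
  proof -
    define S1 N1 S0 N0 where "S1 = S (ln (J (x s))) (\<tau> s)" and "N1 = N (ln (J (x s))) (\<tau> s)" and "S0 = S y (\<tau> s)" and "N0 = N y (\<tau> s)"
    define e where "e = \<epsilon> * (G (x s) \<bullet> b0 (x s)) / sqrt (J (x s))"
    have eq: "w' s = g \<bullet> (b0 (x s) - b0 (x a)) - e * (g \<bullet> N1)
        - (((G (x s) - g) \<bullet> S1 + g \<bullet> (S1 - S0)) * (g \<bullet> N1) + (g \<bullet> S0) * (g \<bullet> (N1 - N0)))"
      unfolding w'_def e_def[symmetric] S1_def[symmetric] N1_def[symmetric] S0_def[symmetric] N0_def[symmetric]
      using eps by (simp add: inner_diff_right inner_diff_left algebra_simps)
    have y': "\<bar>ln (J (x s)) - y\<bar> \<le> c3 * \<epsilon>" using ln_J_close[OF s] by (simp add: y_def)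
    have KK: "0 \<le> K" using K by simp
    have "norm (b0 (x s) - b0 (x a)) \<le> L0 * (c1 * \<epsilon> * \<rho>)"
      using b0_lip[of "x s" "x a"] displacement(1)[OF s] L0 mult_left_mono[OF displacement(1)[OF s], of L0] by linarith
    then have t1: "\<bar>g \<bullet> (b0 (x s) - b0 (x a))\<bar> \<le> (K * \<rho>) * (L0 * (c1 * \<epsilon> * \<rho>))" by (intro abs_inner_le g)
    have gN: "\<bar>g \<bullet> N1\<bar> \<le> (K * \<rho>) * K" unfolding N1_def by (intro abs_inner_le g N_le)
    have t2: "\<bar>e * (g \<bullet> N1)\<bar> \<le> (\<epsilon> * (K * K * K) * \<rho>) * ((K * \<rho>) * K)"
      unfolding abs_mult using correction_small[OF s] gN K rho eps by (intro mult_mono) (auto simp: e_def)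
    have "norm (G (x s) - g) \<le> L * (c1 * \<epsilon> * \<rho>)"
      using G_lip[of "x s" "x a"] mult_left_mono[OF displacement(1)[OF s] less_imp_le[OF L]] unfolding g_def by linarith
    then have t3: "\<bar>(G (x s) - g) \<bullet> S1\<bar> \<le> (L * (c1 * \<epsilon> * \<rho>)) * K" unfolding S1_def by (intro abs_inner_le S_le)
    have "norm (S1 - S0) \<le> K * (c3 * \<epsilon>)"
      using S_lip[of "ln (J (x s))" "\<tau> s" y] mult_left_mono[OF y' KK] by (simp add: S1_def S0_def)
    then have t4: "\<bar>g \<bullet> (S1 - S0)\<bar> \<le> (K * \<rho>) * (K * (c3 * \<epsilon>))" by (intro abs_inner_le g)
    have "norm (N1 - N0) \<le> K * (c3 * \<epsilon>)"
      using N_lip[of "ln (J (x s))" "\<tau> s" y] mult_left_mono[OF y' KK] by (simp add: N1_def N0_def)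
    then have t5: "\<bar>g \<bullet> (N1 - N0)\<bar> \<le> (K * \<rho>) * (K * (c3 * \<epsilon>))" by (intro abs_inner_le g)
    have gS: "\<bar>g \<bullet> S0\<bar> \<le> (K * \<rho>) * K" unfolding S0_def by (intro abs_inner_le g S_le)
    have t6: "\<bar>((G (x s) - g) \<bullet> S1 + g \<bullet> (S1 - S0)) * (g \<bullet> N1)\<bar>
        \<le> ((L * (c1 * \<epsilon> * \<rho>)) * K + (K * \<rho>) * (K * (c3 * \<epsilon>))) * ((K * \<rho>) * K)"
      unfolding abs_mult
    proof (rule mult_mono)
      show "\<bar>(G (x s) - g) \<bullet> S1 + g \<bullet> (S1 - S0)\<bar> \<le> (L * (c1 * \<epsilon> * \<rho>)) * K + (K * \<rho>) * (K * (c3 * \<epsilon>))"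
        using t3 t4 by linarith
      then show "0 \<le> (L * (c1 * \<epsilon> * \<rho>)) * K + (K * \<rho>) * (K * (c3 * \<epsilon>))" by linarith
    qed (use gN in auto)
    have t7: "\<bar>(g \<bullet> S0) * (g \<bullet> (N1 - N0))\<bar> \<le> ((K * \<rho>) * K) * ((K * \<rho>) * (K * (c3 * \<epsilon>)))"
      unfolding abs_mult using gS t5 K rho by (intro mult_mono) auto
    \<comment> \<open>The four summands of \<open>c8\<close> are the variation of \<open>b0\<close>,
      the correction \<open>e\<close>, the variation of gradient and phase in the factor with
      \<open>S\<close>, and the variation of phase in \<open>N\<close>.\<close>
    have "\<bar>w' s\<bar> \<le> (K * \<rho>) * (L0 * (c1 * \<epsilon> * \<rho>)) + (\<epsilon> * (K * K * K) * \<rho>) * ((K * \<rho>) * K)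
        + ((L * (c1 * \<epsilon> * \<rho>)) * K + (K * \<rho>) * (K * (c3 * \<epsilon>))) * ((K * \<rho>) * K) + ((K * \<rho>) * K) * ((K * \<rho>) * (K * (c3 * \<epsilon>)))"
      unfolding eq using t1 t2 t6 t7 by linarith
    also have "\<dots> = c8 * \<epsilon> * (\<rho> * \<rho>)" unfolding c8_def by (simp add: algebra_simps)
    finally show ?thesis using rho by simp
  qed
  have "norm (w c - w a) \<le> c8 * \<epsilon> * v * (c - a)"
    by (rule norm_increment_le[OF dw bw ac(1)])
  then have wb: "w c - w a \<le> c8 * P * \<epsilon> ^ 3 * v" using full by (simp add: power2_eq_square power3_eq_cube algebra_simps)
  \<comment> \<open>A full window is exactly one period of \<open>A\<close>, so the averaging term
    leaves no boundary contribution.\<close>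
  have "\<tau> c = \<tau> a + P" using tau[OF c] full eps by simp
  then have "A (\<tau> c) = A (\<tau> a)" by (simp only: A(2))
  then have "w c - w a = g \<bullet> (x c - x a) - \<epsilon> * (g \<bullet> (\<theta> c - \<theta> a)) - \<epsilon>\<^sup>2 * P * (g \<bullet> b0 (x a) - Q g)"
    using full by (simp add: w_def inner_diff_right algebra_simps)
  moreover have "\<epsilon> * (g \<bullet> (\<theta> c - \<theta> a)) \<le> K * (c5 * c7) * \<epsilon> ^ 3 * v"
  proof -
    have "\<bar>g \<bullet> (\<theta> c - \<theta> a)\<bar> \<le> (K * \<rho>) * (c5 * c7 * \<epsilon>\<^sup>2 * \<rho>)" by (intro abs_inner_le g full_displacement(3)[OF full])
    then have "\<epsilon> * (g \<bullet> (\<theta> c - \<theta> a)) \<le> \<epsilon> * ((K * \<rho>) * (c5 * c7 * \<epsilon>\<^sup>2 * \<rho>))" using eps by (intro mult_left_mono) auto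
    then show ?thesis by (simp add: power2_eq_square power3_eq_cube algebra_simps flip: rho(2))
  qed
  moreover have "\<epsilon>\<^sup>2 * P * (g \<bullet> b0 (x a) - Q g) \<le> \<epsilon>\<^sup>2 * P * (- (\<gamma> - \<kappa>) * (norm g)\<^sup>2)"
  proof (rule mult_left_mono)
    have "g \<bullet> b0 (x a) \<le> norm g * (\<kappa> * norm g)"
      using abs_inner_le[OF order_refl b0_le[of "x a"], of g] by (simp add: g_def)
    then show "g \<bullet> b0 (x a) - Q g \<le> - (\<gamma> - \<kappa>) * (norm g)\<^sup>2"
      using Q_ge[of g] by (simp add: power2_eq_square algebra_simps)
  qed (use eps P in simp)
  moreover have "J (x c) - J (x a) \<le> g \<bullet> (x c - x a) + L * (norm (x c - x a))\<^sup>2"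
    using descent[of "x c" "x a"] by (simp add: g_def)
  moreover have "L * (norm (x c - x a))\<^sup>2 \<le> L * c6\<^sup>2 * \<epsilon> ^ 3 * v"
  proof -
    have "(norm (x c - x a))\<^sup>2 \<le> (c6 * \<epsilon>\<^sup>2 * \<rho>)\<^sup>2" using full_displacement(1)[OF full] by (intro power_mono) auto
    also have "\<dots> = \<epsilon> * (c6\<^sup>2 * \<epsilon> ^ 3 * v)" by (simp add: power2_eq_square power3_eq_cube algebra_simps flip: rho(2))
    also have "\<dots> \<le> 1 * (c6\<^sup>2 * \<epsilon> ^ 3 * v)" using eps rho by (intro mult_right_mono) auto
    finally show ?thesis using L by (simp add: mult.assoc)
  qed
  ultimately have "J (x c) - J (x a) \<le> c8 * P * \<epsilon> ^ 3 * v + K * (c5 * c7) * \<epsilon> ^ 3 * v + \<epsilon>\<^sup>2 * P * (- (\<gamma> - \<kappa>) * (norm g)\<^sup>2) + L * c6\<^sup>2 * \<epsilon> ^ 3 * v"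
    using wb by linarith
  also have "\<dots> = c9 * \<epsilon> ^ 3 * v - \<epsilon>\<^sup>2 * P * (\<gamma> - \<kappa>) * (norm g)\<^sup>2" unfolding c9_def by (simp add: algebra_simps)
  finally show ?thesis by (simp add: v_def g_def)
qed

end

section \<open>The extremum seeking system\<close>

lemma abs_es_u_le:
  assumes "w > 0"
  shows "\<bar>es_u w v \<tau> j\<bar> \<le> sqrt (2 * w * max v 0)"
proof -
  have "\<bar>sqrt (2 * w * v)\<bar> * \<bar>if j = 1 then cos (ln v + w * \<tau>) else sin (ln v + w * \<tau>)\<bar> \<le> sqrt (2 * w * v) * 1" if "v > 0"
    using that assms by (intro mult_mono) auto
  then show ?thesis by (auto simp: es_u_def abs_mult max_def)
qed

text \<open>At \<open>v \<le> 0\<close> the phase \<open>ln v\<close> gives no control of the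
  oscillation; the amplitude bound squeezes the control to 0.\<close>

lemma es_u_continuous:
  assumes w: "w > 0"
  shows "continuous_on UNIV (\<lambda>(v, \<tau>). es_u w v \<tau> j)"
proof -
  have "isCont (\<lambda>(v, \<tau>). es_u w v \<tau> j) (v, \<tau>)" for v \<tau>
  proof (cases "v > 0")
    case True
    define U where "U = {p :: real \<times> real. 0 < fst p}"
    have "open U" unfolding U_def by (intro open_Collect_less continuous_intros)
    have "continuous_on U (\<lambda>p. sqrt (2 * w * fst p) * (if j = 1 then cos (ln (fst p) + w * snd p) else sin (ln (fst p) + w * snd p)))"
      by (cases "j = 1") (auto simp: U_def intro!: continuous_intros)
    then have "continuous_on U (\<lambda>(v, \<tau>). es_u w v \<tau> j)"
      by (rule continuous_on_eq) (auto simp: U_def es_u_def)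
    then show ?thesis using True continuous_on_eq_continuous_at[OF \<open>open U\<close>] by (auto simp: U_def)
  next
    case False
    have "((\<lambda>p. sqrt (2 * w * max (fst p) 0)) \<longlongrightarrow> sqrt (2 * w * max (fst (v, \<tau>)) 0)) (at (v, \<tau>))"
      by (intro tendsto_intros)
    then have lim: "((\<lambda>p. sqrt (2 * w * max (fst p) 0)) \<longlongrightarrow> 0) (at (v, \<tau>))" using False by (simp add: max_def)
    have "((\<lambda>(v, \<tau>). es_u w v \<tau> j) \<longlongrightarrow> 0) (at (v, \<tau>))"
      by (rule Lim_null_comparison[OF _ lim]) (use abs_es_u_le[OF w] in \<open>auto intro!: always_eventually\<close>)
    then show ?thesis using False by (simp add: isCont_def es_u_def)
  qed
  then show ?thesis by (auto simp: continuous_on_eq_continuous_at)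
qed

text \<open>Eliminating \<open>\<tau>\<close> reduces the system to a nonautonomous equation in
  \<open>x\<close> alone, the form treated by the continuation results.\<close>

lemma es_solution_tau:
  assumes sol: "es_solution r b0 b \<omega> J xs \<epsilon> x0 \<tau>0 ts x \<tau>" and t: "t \<in> sol_dom ts"
  shows "\<tau> t = \<tau>0 + t / \<epsilon>\<^sup>2"
proof -
  have sub: "{0..t} \<subseteq> sol_dom ts"
    using t by (auto simp: sol_dom_def) (meson ereal_less_eq(3) le_less_trans)
  have "norm ((\<tau> t - t * (1 / \<epsilon>\<^sup>2)) - (\<tau> 0 - 0 * (1 / \<epsilon>\<^sup>2))) \<le> 0 * (t - 0)"
  proof (rule norm_increment_le[where \<psi>'="\<lambda>_. 1 / \<epsilon>\<^sup>2 - 1 / \<epsilon>\<^sup>2" and \<psi>="\<lambda>s. \<tau> s - s * (1 / \<epsilon>\<^sup>2)"])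
    fix s assume s: "s \<in> {0..t}"
    have "(\<tau> has_vector_derivative 1 / \<epsilon>\<^sup>2) (at s within sol_dom ts)"
      using sol s sub by (auto simp: es_solution_def)
    then have 1: "(\<tau> has_vector_derivative 1 / \<epsilon>\<^sup>2) (at s within {0..t})"
      using sub has_vector_derivative_within_subset by blast
    have 2: "((\<lambda>s. s * (1 / \<epsilon>\<^sup>2)) has_vector_derivative 1 / \<epsilon>\<^sup>2) (at s within {0..t})"
      unfolding has_real_derivative_iff_has_vector_derivative[symmetric]
      using DERIV_cmult_right[OF DERIV_ident, of "1 / \<epsilon>\<^sup>2" s "{0..t}"] by simp
    show "((\<lambda>s. \<tau> s - s * (1 / \<epsilon>\<^sup>2)) has_vector_derivative 1 / \<epsilon>\<^sup>2 - 1 / \<epsilon>\<^sup>2) (at s within {0..t})"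
      by (rule has_vector_derivative_diff[OF 1 2])
  qed (use t in \<open>auto simp: sol_dom_def\<close>)
  then show ?thesis using sol by (simp add: es_solution_def)
qed

locale extremum_seeking =
  fixes r :: nat and b :: "nat \<Rightarrow> nat \<Rightarrow> 'a::euclidean_space" and \<omega> :: "nat \<Rightarrow> real"
    and b0 :: "'a \<Rightarrow> 'a" and J :: "'a \<Rightarrow> real" and G :: "'a \<Rightarrow> 'a" and xs :: 'a
    and \<gamma> \<kappa> L L0 :: real and \<alpha> :: "real \<Rightarrow> real"
  assumes omega_rat: "i \<in> {1..r} \<Longrightarrow> \<omega> i \<in> \<rat>" and omega_pos: "i \<in> {1..r} \<Longrightarrow> 0 < \<omega> i"
    and omega_inj: "inj_on \<omega> {1..r}"
    and J_deriv: "(J has_derivative (\<lambda>h. G x \<bullet> h)) (at x)"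
    and G_lip: "norm (G x - G y) \<le> L * norm (x - y)" and L: "0 < L"
    and J_min: "J xs \<le> J x" and G_xs: "G xs = 0"
    and excitation: "\<gamma> * (norm g)\<^sup>2 \<le> (\<Sum>i=1..r. \<Sum>j=1..2. (b i j \<bullet> g)\<^sup>2)"
    and kappa: "0 < \<kappa>" "\<kappa> < \<gamma>"
    and b0_le: "norm (b0 x) \<le> \<kappa> * norm (G x)"
    and b0_lip: "norm (b0 x - b0 y) \<le> L0 * norm (x - y)" and L0: "0 < L0"
    and alpha_K: "class_K \<alpha>"
    and alpha_le: "(\<alpha> (norm (x - xs)))\<^sup>2 * (norm (x - xs))\<^sup>2 \<le> (norm (G x))\<^sup>2"
begin

section \<open>Comparison of the excess cost, the distance to the minimiser and the gradient\<close>

abbreviation V :: "'a \<Rightarrow> real" where "V x \<equiv> J x - J xs"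

lemma descent: "\<bar>J y - J x - G x \<bullet> (y - x)\<bar> \<le> L * (norm (y - x))\<^sup>2"
  by (rule descent_bound[OF J_deriv G_lip])

lemma J_continuous: "continuous_on UNIV J"
  using J_deriv has_derivative_continuous continuous_at_imp_continuous_on by blast

lemma V_nonneg: "0 \<le> V x" using J_min by simp

lemma V_le: "V x \<le> L * (norm (x - xs))\<^sup>2"
  using descent[of x xs] by (simp add: G_xs)

lemma grad_sq_le: "(norm (G x))\<^sup>2 \<le> 4 * L * V x"
  by (rule gradient_sq_le[OF descent J_min L])

lemma alpha_mono: "0 \<le> s \<Longrightarrow> s \<le> t \<Longrightarrow> \<alpha> s \<le> \<alpha> t"
  using alpha_K strict_mono_on_leD[of "{0..}" \<alpha> s t] by (auto simp: class_K_def)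

lemma alpha_pos: "0 < s \<Longrightarrow> 0 < \<alpha> s"
  using alpha_K strict_mono_onD[of "{0..}" \<alpha> 0 s] by (auto simp: class_K_def)

lemma alpha_nonneg: "0 \<le> s \<Longrightarrow> 0 \<le> \<alpha> s"
  using alpha_pos[of s] alpha_K by (cases "s = 0") (auto simp: class_K_def)

text \<open>Below the level \<open>2 * level d\<close> of \<open>V\<close> the distance to \<open>xs\<close> is at most \<open>d\<close>, while above \<open>level d\<close>
  the squared gradient dominates \<open>rate_const d * V\<close>.\<close>

definition level :: "real \<Rightarrow> real" where "level d = (d * \<alpha> d)\<^sup>2 / (8 * L)"
definition rate_const :: "real \<Rightarrow> real" where "rate_const d = (\<alpha> (sqrt (level d / L)))\<^sup>2 / L"
text \<open>Half of the averaged decrease is reserved for absorbing errors. The cap at 1 ensures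
  \<open>exp (rate d * T) \<le> 2\<close> as soon as \<open>T \<le> ln 2\<close>.\<close>

definition rate :: "real \<Rightarrow> real" where "rate d = min 1 ((\<gamma> - \<kappa>) * rate_const d / 2)"
definition gain :: "real \<Rightarrow> real" where "gain d = 4 * L / \<alpha> d"

lemma level_pos: "0 < d \<Longrightarrow> 0 < level d"
  using alpha_pos[of d] L by (simp add: level_def)

lemma level_mono: "0 \<le> d \<Longrightarrow> d \<le> e \<Longrightarrow> level d \<le> level e"
  unfolding level_def using L alpha_mono[of d e] alpha_nonneg[of d]
  by (intro divide_right_mono power_mono mult_mono) auto

lemma rate_const_pos: "0 < d \<Longrightarrow> 0 < rate_const d"
  using alpha_pos[of "sqrt (level d / L)"] level_pos[of d] L by (simp add: rate_const_def)

lemma rate_const_mono: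
  assumes "0 < d" "d \<le> e" shows "rate_const d \<le> rate_const e"
proof -
  have "sqrt (level d / L) \<le> sqrt (level e / L)"
    using level_mono[of d e] assms L by (simp add: divide_right_mono)
  moreover have "0 \<le> sqrt (level d / L)" using level_pos[OF assms(1)] L by simp
  ultimately show ?thesis unfolding rate_const_def
    using L alpha_mono alpha_nonneg by (intro divide_right_mono power_mono) auto
qed

lemma rate_pos: "0 < d \<Longrightarrow> 0 < rate d"
  using rate_const_pos[of d] kappa by (simp add: rate_def)

lemma rate_mono: "0 < d \<Longrightarrow> d \<le> e \<Longrightarrow> rate d \<le> rate e"
  unfolding rate_def using rate_const_mono[of d e] kappa
  by (intro min.mono divide_right_mono mult_left_mono) auto

lemma gain_pos: "0 < d \<Longrightarrow> 0 < gain d"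
  using alpha_pos[of d] L by (simp add: gain_def)

lemma gain_antimono: "0 < d \<Longrightarrow> d \<le> e \<Longrightarrow> gain e \<le> gain d"
  unfolding gain_def using alpha_pos[of d] alpha_mono[of d e] L by (intro divide_left_mono) auto

text \<open>Quadratic growth of \<open>V\<close> outside a ball: the lower gradient bound with
  \<open>\<alpha>\<close> frozen at radius \<open>d\<close>, set against the upper bound
  \<open>grad_sq_le\<close>.\<close>

lemma alpha_dist_le:
  assumes "0 < d" "d < norm (x - xs)"
  shows "(\<alpha> d)\<^sup>2 * (norm (x - xs))\<^sup>2 \<le> 4 * L * V x"
proof -
  have "(\<alpha> d)\<^sup>2 * (norm (x - xs))\<^sup>2 \<le> (\<alpha> (norm (x - xs)))\<^sup>2 * (norm (x - xs))\<^sup>2"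
    using assms alpha_mono[of d] alpha_nonneg[of d] by (intro mult_right_mono power_mono) auto
  then show ?thesis using alpha_le[of x] grad_sq_le[of x] by linarith
qed

text \<open>Beyond distance \<open>d\<close> the quadratic growth forces \<open>4 * L * V x\<close>
  above \<open>(d * \<alpha> d)\<^sup>2\<close>, that is, \<open>V x\<close> above
  \<open>2 * level d\<close>. The factor 2 is the overshoot allowed by
  \<open>window_decay\<close>.\<close>

lemma dist_le_of_level:
  assumes d: "0 < d" and V: "V x \<le> 2 * level d"
  shows "norm (x - xs) \<le> d"
proof (rule ccontr)
  assume "\<not> norm (x - xs) \<le> d"
  then have lt: "d < norm (x - xs)" by simp
  have "(\<alpha> d)\<^sup>2 * d\<^sup>2 < (\<alpha> d)\<^sup>2 * (norm (x - xs))\<^sup>2"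
    using lt d alpha_pos[OF d] by (intro mult_strict_left_mono power_strict_mono) auto
  also have "\<dots> \<le> 4 * L * V x" by (rule alpha_dist_le[OF d lt])
  also have "\<dots> \<le> 4 * L * (2 * level d)" using V L by (intro mult_left_mono) auto
  also have "\<dots> = (\<alpha> d)\<^sup>2 * d\<^sup>2" using L by (simp add: level_def power_mult_distrib)
  finally show False by simp
qed

text \<open>Passing from \<open>V\<close> to the distance takes a square root, which halves the
  rate. The constant \<open>gain d\<close> collects \<open>4 * L\<close> from
  \<open>alpha_dist_le\<close>, the 4 of the decay estimate and \<open>L\<close> from
  \<open>V_le\<close>.\<close>

lemma dist_le_of_decay:
  assumes d: "0 < d" and V: "V x \<le> 4 * exp (- k * t) * V y"
  shows "norm (x - xs) \<le> d + gain d * norm (y - xs) * exp (- (k / 2) * t)"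
proof (cases "norm (x - xs) \<le> d")
  case True
  then show ?thesis using gain_pos[OF d] by (simp add: add_increasing2)
next
  case False
  have e: "exp (- k * t) = (exp (- (k / 2) * t))\<^sup>2" by (simp add: power2_eq_square flip: exp_add)
  have "(\<alpha> d * norm (x - xs))\<^sup>2 \<le> 4 * L * V x"
    using alpha_dist_le[OF d] False by (simp add: power_mult_distrib)
  also have "\<dots> \<le> 4 * L * (4 * exp (- k * t) * V y)" using V L by (intro mult_left_mono) auto
  also have "\<dots> \<le> 4 * L * (4 * exp (- k * t) * (L * (norm (y - xs))\<^sup>2))"
    using V_le[of y] L by (intro mult_left_mono) auto
  also have "\<dots> = (4 * L * norm (y - xs) * exp (- (k / 2) * t))\<^sup>2"
    unfolding e by (simp add: power2_eq_square algebra_simps)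
  finally have "\<alpha> d * norm (x - xs) \<le> 4 * L * norm (y - xs) * exp (- (k / 2) * t)"
    by (rule power2_le_imp_le) (use L in simp)
  then have "norm (x - xs) \<le> gain d * norm (y - xs) * exp (- (k / 2) * t)"
    using alpha_pos[OF d] by (simp add: gain_def field_simps)
  then show ?thesis using d by simp
qed

text \<open>Since \<open>V\<close> is at most \<open>L\<close> times the squared distance, a point
  above \<open>level d\<close> has distance at least \<open>sqrt (level d / L)\<close>. Evaluating
  \<open>\<alpha>\<close> there and replacing the squared distance by \<open>V / L\<close> gives the
  constant.\<close>

lemma gradient_ge_of_level:
  assumes d: "0 < d" and V: "level d \<le> V x"
  shows "rate_const d * V x \<le> (norm (G x))\<^sup>2"
proof -
  have "level d / L \<le> (norm (x - xs))\<^sup>2" using V V_le[of x] L by (simp add: field_simps)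
  then have "sqrt (level d / L) \<le> norm (x - xs)" by (rule real_le_lsqrt[OF norm_ge_zero])
  then have "\<alpha> (sqrt (level d / L)) \<le> \<alpha> (norm (x - xs))"
    using level_pos[OF d] L by (intro alpha_mono) auto
  moreover have "0 \<le> \<alpha> (sqrt (level d / L))" using level_pos[OF d] L by (intro alpha_nonneg) auto
  ultimately have "(\<alpha> (sqrt (level d / L)))\<^sup>2 * (norm (x - xs))\<^sup>2 \<le> (\<alpha> (norm (x - xs)))\<^sup>2 * (norm (x - xs))\<^sup>2"
    by (intro mult_right_mono power_mono) auto
  moreover have "rate_const d * V x \<le> rate_const d * (L * (norm (x - xs))\<^sup>2)"
    using V_le[of x] rate_const_pos[OF d] by (intro mult_left_mono) auto
  moreover have "rate_const d * (L * (norm (x - xs))\<^sup>2) = (\<alpha> (sqrt (level d / L)))\<^sup>2 * (norm (x - xs))\<^sup>2"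
    using L by (simp add: rate_const_def)
  ultimately show ?thesis using alpha_le[of x] by linarith
qed

text \<open>The condition on \<open>M\<close> keeps \<open>J\<close> comparable to \<open>v\<close>:
  where \<open>V z \<ge> v / 2\<close> and \<open>v \<ge> M\<close>, a negative \<open>J xs\<close>
  takes away at most \<open>M / 4\<close>, so \<open>J z \<ge> v / 4\<close>.\<close>

lemma averaging_data_exists:
  assumes M: "0 < M" "4 * max 0 (- J xs) \<le> M"
  shows "\<exists>P K. averaging_data J G b0 xs (exc_S r \<omega> b) (exc_R r \<omega> b)
    (\<lambda>y \<tau>. (1/2) *\<^sub>R exc_R r \<omega> b y \<tau> + exc_Ry r \<omega> b y \<tau>) (\<lambda>g. \<Sum>i=1..r. \<Sum>j=1..2. (b i j \<bullet> g)\<^sup>2) P K L L0 M \<kappa> \<gamma>"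
proof -
  have "\<exists>P>0. \<forall>i\<in>{1..r}. \<exists>m::int. \<omega> i * P = 2 * pi * of_int m"
    by (intro common_period omega_rat finite_atLeastAtMost)
  then obtain P where P0: "0 < P" and P1: "\<forall>i\<in>{1..r}. \<exists>m::int. \<omega> i * P = 2 * pi * of_int m"
    by (elim exE conjE, intro that)
  note P = P0 P1[rule_format]
  define BS where "BS = (\<Sum>i=1..r. norm (sqrt (2 * \<omega> i) *\<^sub>R b i 1) + norm (sqrt (2 * \<omega> i) *\<^sub>R b i 2))"
  define BR where "BR = (\<Sum>i=1..r. norm (- (sqrt (2 / \<omega> i) *\<^sub>R b i 2)) + norm (sqrt (2 / \<omega> i) *\<^sub>R b i 1))"
  define BY where "BY = (\<Sum>i=1..r. norm (sqrt (2 / \<omega> i) *\<^sub>R b i 1) + norm (sqrt (2 / \<omega> i) *\<^sub>R b i 2))"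
  \<comment> \<open>In the region \<open>V z \<ge> M / 2\<close>, so \<open>\<bar>J xs\<bar>\<close>
    is at most \<open>2 * \<bar>J xs\<bar> / M\<close> times \<open>V z\<close>; hence
    \<open>J z \<le> D * V z\<close>.\<close>
  define D where "D = 1 + 2 * \<bar>J xs\<bar> / M"
  define K where "K = 2 + BS + BR + BY + sqrt (8 * L) + \<kappa> * sqrt (8 * L) + sqrt (2 * D)"
  have D: "1 \<le> D" using M by (simp add: D_def)
  have nn: "0 \<le> BS" "0 \<le> BR" "0 \<le> BY" by (auto simp: BS_def BR_def BY_def intro!: sum_nonneg)
  have KB: "2 \<le> K" "BS \<le> K" "BR \<le> K" "BR / 2 + BY \<le> K" "sqrt (8 * L) \<le> K" "\<kappa> * sqrt (8 * L) \<le> K" "sqrt (2 * D) \<le> K"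
    using nn L kappa D by (auto simp: K_def)
  have S: "norm (exc_S r \<omega> b y \<tau>) \<le> BS" "norm (exc_S r \<omega> b y \<tau> - exc_S r \<omega> b y' \<tau>) \<le> BS * \<bar>y - y'\<bar>" for y y' \<tau>
    unfolding exc_S_def BS_def by (rule norm_trig_le, rule trig_Lipschitz)
  have R: "norm (exc_R r \<omega> b y \<tau>) \<le> BR" "norm (exc_R r \<omega> b y \<tau> - exc_R r \<omega> b y' \<tau>) \<le> BR * \<bar>y - y'\<bar>" for y y' \<tau>
    unfolding exc_R_def BR_def by (rule norm_trig_le, rule trig_Lipschitz)
  have Y: "norm (exc_Ry r \<omega> b y \<tau>) \<le> BY" "norm (exc_Ry r \<omega> b y \<tau> - exc_Ry r \<omega> b y' \<tau>) \<le> BY * \<bar>y - y'\<bar>" for y y' \<tau>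
    unfolding exc_Ry_def BY_def by (rule norm_trig_le, rule trig_Lipschitz)
  have "averaging_data J G b0 xs (exc_S r \<omega> b) (exc_R r \<omega> b)
    (\<lambda>y \<tau>. (1/2) *\<^sub>R exc_R r \<omega> b y \<tau> + exc_Ry r \<omega> b y \<tau>) (\<lambda>g. \<Sum>i=1..r. \<Sum>j=1..2. (b i j \<bullet> g)\<^sup>2) P K L L0 M \<kappa> \<gamma>"
  proof
    fix y y' \<tau> :: real
    show "norm (exc_S r \<omega> b y \<tau>) \<le> K" "norm (exc_R r \<omega> b y \<tau>) \<le> K"
      using S(1) R(1) KB order_trans by blast+
    have "norm ((1/2) *\<^sub>R exc_R r \<omega> b y \<tau> + exc_Ry r \<omega> b y \<tau>) \<le> norm ((1/2) *\<^sub>R exc_R r \<omega> b y \<tau>) + norm (exc_Ry r \<omega> b y \<tau>)"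
      by (rule norm_triangle_ineq)
    also have "\<dots> \<le> BR / 2 + BY" using R(1)[of y \<tau>] Y(1)[of y \<tau>] by simp
    finally show "norm ((1/2) *\<^sub>R exc_R r \<omega> b y \<tau> + exc_Ry r \<omega> b y \<tau>) \<le> K" using KB by linarith
    have KK: "BS * \<bar>y - y'\<bar> \<le> K * \<bar>y - y'\<bar>" "BR * \<bar>y - y'\<bar> \<le> K * \<bar>y - y'\<bar>" "(BR / 2 + BY) * \<bar>y - y'\<bar> \<le> K * \<bar>y - y'\<bar>"
      using KB by (auto intro!: mult_right_mono)
    show "norm (exc_S r \<omega> b y \<tau> - exc_S r \<omega> b y' \<tau>) \<le> K * \<bar>y - y'\<bar>" "norm (exc_R r \<omega> b y \<tau> - exc_R r \<omega> b y' \<tau>) \<le> K * \<bar>y - y'\<bar>"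
      using S(2)[of y \<tau> y'] R(2)[of y \<tau> y'] KK by linarith+
    have "(1/2) *\<^sub>R exc_R r \<omega> b y \<tau> + exc_Ry r \<omega> b y \<tau> - ((1/2) *\<^sub>R exc_R r \<omega> b y' \<tau> + exc_Ry r \<omega> b y' \<tau>)
        = (1/2) *\<^sub>R (exc_R r \<omega> b y \<tau> - exc_R r \<omega> b y' \<tau>) + (exc_Ry r \<omega> b y \<tau> - exc_Ry r \<omega> b y' \<tau>)"
      by (simp add: algebra_simps)
    then have "norm ((1/2) *\<^sub>R exc_R r \<omega> b y \<tau> + exc_Ry r \<omega> b y \<tau> - ((1/2) *\<^sub>R exc_R r \<omega> b y' \<tau> + exc_Ry r \<omega> b y' \<tau>))
        \<le> norm ((1/2) *\<^sub>R (exc_R r \<omega> b y \<tau> - exc_R r \<omega> b y' \<tau>)) + norm (exc_Ry r \<omega> b y \<tau> - exc_Ry r \<omega> b y' \<tau>)"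
      by (simp only: norm_triangle_ineq)
    also have "\<dots> \<le> BR * \<bar>y - y'\<bar> / 2 + BY * \<bar>y - y'\<bar>" using R(2)[of y \<tau> y'] Y(2)[of y \<tau> y'] by simp
    also have "\<dots> = (BR / 2 + BY) * \<bar>y - y'\<bar>" by (simp add: algebra_simps)
    finally show "norm ((1/2) *\<^sub>R exc_R r \<omega> b y \<tau> + exc_Ry r \<omega> b y \<tau> - ((1/2) *\<^sub>R exc_R r \<omega> b y' \<tau> + exc_Ry r \<omega> b y' \<tau>)) \<le> K * \<bar>y - y'\<bar>"
      using KK by linarith
    show "exc_R r \<omega> b y (\<tau> + P) = exc_R r \<omega> b y \<tau>" unfolding exc_R_def by (rule trig_periodic[OF P(2)])
  next
    fix y \<tau> :: "real \<Rightarrow> real" and y' \<tau>' s A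
    assume "(y has_real_derivative y') (at s within A)" "(\<tau> has_real_derivative \<tau>') (at s within A)"
    from exc_R_has_vector_derivative[OF omega_pos this, where b=b]
    show "((\<lambda>s. exc_R r \<omega> b (y s) (\<tau> s)) has_vector_derivative
        y' *\<^sub>R ((1/2) *\<^sub>R exc_R r \<omega> b (y s) (\<tau> s) + exc_Ry r \<omega> b (y s) (\<tau> s) - (1/2) *\<^sub>R exc_R r \<omega> b (y s) (\<tau> s)) + \<tau>' *\<^sub>R exc_S r \<omega> b (y s) (\<tau> s)) (at s within A)"
      by simp
  next
    fix v z assume v: "M \<le> v" "v / 2 \<le> J z - J xs" "J z - J xs \<le> 2 * v"
    have v0: "0 < v" using M v by linarith
    have "(norm (G z))\<^sup>2 \<le> 4 * L * (2 * v)"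
      using grad_sq_le[of z] v L mult_left_mono[of "V z" "2 * v" "4 * L"] by linarith
    also have "\<dots> = (sqrt (8 * L) * sqrt v)\<^sup>2" using L v0 by (simp add: power_mult_distrib)
    finally have g0: "norm (G z) \<le> sqrt (8 * L) * sqrt v" by (rule power2_le_imp_le) (use L v0 in simp)
    then have g: "norm (G z) \<le> K * sqrt v"
      using order_trans[OF _ mult_right_mono[OF KB(5)]] v0 by simp
    have "norm (b0 z) \<le> \<kappa> * (sqrt (8 * L) * sqrt v)"
      using b0_le[of z] mult_left_mono[OF g0, of \<kappa>] kappa by linarith
    then have b: "norm (b0 z) \<le> K * sqrt v"
      using order_trans[OF _ mult_right_mono[OF KB(6)]] v0 by (simp add: mult.assoc)
    have Jz: "v / 4 \<le> J z" using v M by (cases "0 \<le> J xs") auto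
    have "\<bar>J xs\<bar> = (2 * \<bar>J xs\<bar> / M) * (M / 2)" using M by simp
    also have "\<dots> \<le> (2 * \<bar>J xs\<bar> / M) * V z" using v M by (intro mult_left_mono) auto
    finally have "J z \<le> D * V z" by (simp add: D_def algebra_simps)
    also have "\<dots> \<le> D * (2 * v)" using v D by (intro mult_left_mono) auto
    finally have "sqrt (J z) \<le> sqrt (2 * D * v)" by simp
    also have "\<dots> = sqrt (2 * D) * sqrt v" by (simp add: real_sqrt_mult)
    also have "\<dots> \<le> K * sqrt v" using KB v0 by (intro mult_right_mono) auto
    finally have s1: "sqrt (J z) \<le> K * sqrt v" .
    have "sqrt v \<le> sqrt (4 * J z)" using Jz by simp
    also have "\<dots> = 2 * sqrt (J z)" by (simp add: real_sqrt_mult)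
    also have "\<dots> \<le> K * sqrt (J z)" using KB Jz v0 by (intro mult_right_mono) auto
    finally show "norm (G z) \<le> K * sqrt v \<and> norm (b0 z) \<le> K * sqrt v \<and> 0 < J z \<and> sqrt (J z) \<le> K * sqrt v \<and> sqrt v \<le> K * sqrt (J z)"
      using g b s1 Jz v0 by auto
  next
    fix g y
    show "\<exists>A. (\<forall>\<tau>. (A has_real_derivative
        (g \<bullet> exc_S r \<omega> b y \<tau>) * (g \<bullet> ((1/2) *\<^sub>R exc_R r \<omega> b y \<tau> + exc_Ry r \<omega> b y \<tau>)) - (\<Sum>i=1..r. \<Sum>j=1..2. (b i j \<bullet> g)\<^sup>2)) (at \<tau>)) \<and>
        (\<forall>\<tau>. A (\<tau> + P) = A \<tau>)"
      by (rule excitation_average[OF omega_pos omega_inj P(2)])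
  qed (use J_deriv G_lip b0_lip b0_le excitation L L0 P M KB in auto)
  then show ?thesis by (intro exI)
qed

text \<open>The threshold is chosen from \<open>\<nu>\<close> alone, yet the bound holds for all
  \<open>d\<close> above \<open>\<nu>\<close>: by monotonicity of \<open>rate_const\<close> the
  error is smallest relative to the gain at coarse resolutions, so the case \<open>\<nu>\<close> is
  decisive.\<close>

lemma trajectory_bound:
  assumes nu: "0 < \<nu>" and level: "4 * max 0 (- J xs) \<le> level \<nu>"
  shows "\<exists>\<epsilon>s>0. \<forall>\<epsilon> x0 \<tau>0 ts x \<tau> d t. 0 < \<epsilon> \<longrightarrow> \<epsilon> < \<epsilon>s \<longrightarrow> es_solution r b0 b \<omega> J xs \<epsilon> x0 \<tau>0 ts x \<tau> \<longrightarrow>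
     \<nu> \<le> d \<longrightarrow> t \<in> sol_dom ts \<longrightarrow> norm (x t) \<le> d + gain d * norm x0 * exp (- (rate d / 2) * t)"
proof -
  define S R N Q where "S = exc_S r \<omega> b" and "R = exc_R r \<omega> b"
    and "N = (\<lambda>y \<tau>. (1/2) *\<^sub>R exc_R r \<omega> b y \<tau> + exc_Ry r \<omega> b y \<tau>)"
    and "Q = (\<lambda>g. \<Sum>i=1..r. \<Sum>j=1..2. (b i j \<bullet> g)\<^sup>2)"
  have "\<exists>P K. averaging_data J G b0 xs S R N Q P K L L0 (level \<nu>) \<kappa> \<gamma>"
    unfolding S_def R_def N_def Q_def by (rule averaging_data_exists[OF level_pos[OF nu] level])
  then obtain P K where "averaging_data J G b0 xs S R N Q P K L L0 (level \<nu>) \<kappa> \<gamma>" by blast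
  then interpret A: averaging_data J G b0 xs S R N Q P K L L0 "level \<nu>" \<kappa> \<gamma> .
  \<comment> \<open>The first two entries are required by \<open>averaging_window\<close>. The third
    makes the cubic error at most half the gain; the fourth, with \<open>\<epsilon> \<le> 1\<close>,
    makes the window length at most \<open>ln 2\<close>.\<close>
  define e where "e = Min {1, 1 / (4 * A.c2), (\<gamma> - \<kappa>) * rate_const \<nu> * P / (2 * A.c9), ln 2 / P}"
  have e0: "0 < e"
    unfolding e_def using A.c_nonneg A.P rate_const_pos[OF nu] kappa by simp
  have bound: "norm (x t) \<le> d + gain d * norm x0 * exp (- (rate d / 2) * t)"
    if eps: "0 < \<epsilon>" "\<epsilon> < e" and sol: "es_solution r b0 b \<omega> J xs \<epsilon> x0 \<tau>0 ts x \<tau>" and d: "\<nu> \<le> d" and t: "t \<in> sol_dom ts"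
    for \<epsilon> x0 \<tau>0 ts x \<tau> d t
  proof -
    define X where "X = (\<lambda>s. x s + xs)"
    define T where "T = \<epsilon>\<^sup>2 * P"
    have d0: "0 < d" using d nu by simp
    have el: "\<epsilon> \<le> 1" "\<epsilon> \<le> 1 / (4 * A.c2)" "\<epsilon> \<le> (\<gamma> - \<kappa>) * rate_const \<nu> * P / (2 * A.c9)" "\<epsilon> \<le> ln 2 / P"
      using eps(2) unfolding e_def by auto
    have c2e: "A.c2 * \<epsilon> \<le> 1/4" using el(2) A.c_nonneg(2) by (simp add: field_simps)
    have c9e: "A.c9 * \<epsilon> \<le> (\<gamma> - \<kappa>) * rate_const \<nu> * P / 2" using el(3) A.c_nonneg(9) by (simp add: field_simps)
    have T0: "0 < T" using eps A.P by (simp add: T_def)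
    have "\<epsilon>\<^sup>2 \<le> \<epsilon>" using eps el(1) by (simp add: power2_eq_square mult_left_le)
    then have "T \<le> \<epsilon> * P" using A.P by (simp add: T_def)
    also have "\<dots> \<le> ln 2" using el(4) A.P by (simp add: field_simps)
    finally have Tln: "T \<le> ln 2" .
    have sub: "{0..t} \<subseteq> sol_dom ts"
      using t by (auto simp: sol_dom_def) (meson ereal_less_eq(3) le_less_trans)
    have t0: "0 \<le> t" using t by (simp add: sol_dom_def)
    have dX: "(X has_vector_derivative es_rhs r b0 b \<omega> J xs \<epsilon> (x s) (\<tau> s)) (at s within {0..t})" if "s \<in> {0..t}" for s
    proof -
      have "(x has_vector_derivative es_rhs r b0 b \<omega> J xs \<epsilon> (x s) (\<tau> s)) (at s within sol_dom ts)"
        using sol sub that by (auto simp: es_solution_def)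
      then have "(x has_vector_derivative es_rhs r b0 b \<omega> J xs \<epsilon> (x s) (\<tau> s)) (at s within {0..t})"
        using has_vector_derivative_within_subset sub by blast
      then show ?thesis unfolding X_def using has_vector_derivative_add[OF _ has_vector_derivative_const[of xs]] by fastforce
    qed
    have cX: "continuous_on {0..t} X" by (rule continuous_on_vector_derivative[OF dX])
    \<comment> \<open>The averaging constants belong to \<open>level \<nu>\<close>, while windows
      are started above the possibly higher \<open>level d\<close>.\<close>
    have window: "averaging_window J G b0 xs S R N Q P K L L0 (level \<nu>) \<kappa> \<gamma> \<epsilon> a c X \<tau>"
      if ac: "0 \<le> a" "a \<le> c" "c \<le> t" "c \<le> a + T" and Va: "level d \<le> V (X a)" for a c
    proof
      show "level \<nu> \<le> V (X a)" using Va level_mono[of \<nu> d] nu d by linarith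
      show "continuous_on {a..c} X" using ac by (intro continuous_on_subset[OF cX]) auto
      fix s assume s: "s \<in> {a..c}"
      then have st: "s \<in> sol_dom ts" and at: "a \<in> sol_dom ts" using ac sub by auto
      show "\<tau> s = \<tau> a + (s - a) / \<epsilon>\<^sup>2"
        unfolding es_solution_tau[OF sol st] es_solution_tau[OF sol at] by (simp add: diff_divide_distrib)
      assume J: "0 < J (X s)"
      have "es_rhs r b0 b \<omega> J xs \<epsilon> (x s) (\<tau> s) = b0 (X s) + (1/\<epsilon>) *\<^sub>R (sqrt (J (X s)) *\<^sub>R S (ln (J (X s))) (\<tau> s))"
        using sum_es_u_eq[OF J omega_pos, where \<tau>="\<tau> s" and b=b] by (simp add: es_rhs_def X_def S_def)
      then show "(X has_vector_derivative b0 (X s) + (1/\<epsilon>) *\<^sub>R (sqrt (J (X s)) *\<^sub>R S (ln (J (X s))) (\<tau> s))) (at s within {a..c})"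
        using has_vector_derivative_within_subset[OF dX, of s "{a..c}"] s ac by auto
    qed (use eps el c2e ac in \<open>auto simp: T_def\<close>)
    have "V (X t) \<le> 2 * level d \<or> V (X t) \<le> 4 * exp (- rate d * t) * V (X 0)"
    proof (rule window_decay[where V="\<lambda>s. V (X s)" and T=T])
      show "continuous_on {0..t} (\<lambda>s. V (X s))"
        by (intro continuous_intros continuous_on_compose2[OF J_continuous cX]) simp
      show "0 \<le> rate d" using rate_pos[OF d0] by simp
      have "rate d * T \<le> 1 * T" using T0 by (intro mult_right_mono) (auto simp: rate_def)
      then have "rate d * T \<le> ln 2" using Tln by simp
      then show "exp (rate d * T) \<le> 2" by (simp add: ln_ge_iff)
    next
      fix s u assume su: "0 \<le> s" "s \<le> u" "u \<le> t" "u \<le> s + T" "level d \<le> V (X s)"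
      interpret W: averaging_window J G b0 xs S R N Q P K L L0 "level \<nu>" \<kappa> \<gamma> \<epsilon> s u X \<tau>
        by (rule window[OF su])
      show "V (X u) \<le> 2 * V (X s)" using W.window_growth[of u] su by simp
    next
      fix s assume su: "0 \<le> s" "s + T \<le> t" "level d \<le> V (X s)"
      interpret W: averaging_window J G b0 xs S R N Q P K L L0 "level \<nu>" \<kappa> \<gamma> \<epsilon> s "s + T" X \<tau>
        by (rule window) (use su T0 in auto)
      define g2 where "g2 = (norm (G (X s)))\<^sup>2"
      define v where "v = V (X s)"
      have v0: "0 \<le> v" using V_nonneg by (simp add: v_def)
      have "V (X (s + T)) \<le> v - \<epsilon>\<^sup>2 * P * (\<gamma> - \<kappa>) * g2 + A.c9 * \<epsilon> ^ 3 * v"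
        using W.window_decrease by (simp add: T_def g2_def v_def)
      also have "A.c9 * \<epsilon> ^ 3 * v = \<epsilon>\<^sup>2 * v * (A.c9 * \<epsilon>)" by (simp add: power2_eq_square power3_eq_cube)
      also have "\<epsilon>\<^sup>2 * v * (A.c9 * \<epsilon>) \<le> \<epsilon>\<^sup>2 * v * ((\<gamma> - \<kappa>) * rate_const \<nu> * P / 2)"
        using v0 by (intro mult_left_mono c9e) auto
      \<comment> \<open>Here the error becomes at most half of the decrease
        \<open>T * (\<gamma> - \<kappa>) * g2\<close>, which explains the division by 2 in
        \<open>rate\<close>.\<close>
      also have "\<epsilon>\<^sup>2 * v * ((\<gamma> - \<kappa>) * rate_const \<nu> * P / 2) = (T * (\<gamma> - \<kappa>) / 2) * (rate_const \<nu> * v)"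
        by (simp add: T_def)
      also have "(T * (\<gamma> - \<kappa>) / 2) * (rate_const \<nu> * v) \<le> (T * (\<gamma> - \<kappa>) / 2) * g2"
      proof (rule mult_left_mono)
        have "rate_const \<nu> * v \<le> rate_const d * v" using rate_const_mono[OF nu d] v0 by (rule mult_right_mono)
        then show "rate_const \<nu> * v \<le> g2" using gradient_ge_of_level[OF d0 su(3)] unfolding v_def g2_def by linarith
      qed (use T0 kappa in simp)
      finally have "V (X (s + T)) \<le> v - (T * (\<gamma> - \<kappa>) / 2) * g2" 
        by (simp add: T_def field_simps)
      also have "\<dots> \<le> v - (T * (\<gamma> - \<kappa>) / 2) * (rate_const d * v)"
        using gradient_ge_of_level[OF d0 su(3)] T0 kappa unfolding v_def g2_def
        by (intro diff_left_mono mult_left_mono) auto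
      also have "\<dots> = v - T * v * ((\<gamma> - \<kappa>) * rate_const d / 2)" by simp
      also have "\<dots> \<le> v - T * v * rate d"
        using T0 v0 by (intro diff_left_mono mult_left_mono) (auto simp: rate_def)
      also have "\<dots> = (1 + - rate d * T) * v" by (simp add: algebra_simps)
      also have "\<dots> \<le> exp (- rate d * T) * v" using v0 by (intro mult_right_mono exp_ge_add_one_self) auto
      finally show "V (X (s + T)) \<le> exp (- rate d * T) * V (X s)" by (simp add: v_def)
    qed (use T0 t0 level_pos[OF d0] in auto)
    then have "norm (X t - xs) \<le> d + gain d * norm (X 0 - xs) * exp (- (rate d / 2) * t)"
    proof
      assume "V (X t) \<le> 2 * level d"
      then have "norm (X t - xs) \<le> d" by (rule dist_le_of_level[OF d0])
      moreover have "0 \<le> gain d * norm (X 0 - xs) * exp (- (rate d / 2) * t)" using gain_pos[OF d0] by simp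
      ultimately show ?thesis by linarith
    qed (rule dist_le_of_decay[OF d0])
    moreover have "x 0 = x0" using sol by (simp add: es_solution_def)
    ultimately show ?thesis by (simp add: X_def)
  qed
  show ?thesis by (intro exI[of _ e] conjI allI impI e0 bound)
qed

section \<open>Continuation of solutions to all positive times\<close>

lemma es_rhs_continuous: "continuous_on UNIV (\<lambda>(t, x). es_rhs r b0 b \<omega> J xs \<epsilon> x (\<tau>0 + t / \<epsilon>\<^sup>2))"
proof -
  have "continuous_on UNIV b0"
    unfolding continuous_on_eq_continuous_at[OF open_UNIV]
  proof
    fix x :: 'a
    have "((\<lambda>y. L0 * norm (y - x)) \<longlongrightarrow> L0 * norm (x - x)) (at x)" by (intro tendsto_intros)
    then have "((\<lambda>y. b0 y - b0 x) \<longlongrightarrow> 0) (at x)"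
      by (subst Lim_null_comparison[where g="\<lambda>y. L0 * norm (y - x)"]) (simp_all add: b0_lip)
    then show "isCont b0 x" unfolding isCont_def using LIM_zero_iff by blast
  qed
  then have b0: "continuous_on UNIV (\<lambda>p::real \<times> 'a. b0 (snd p + xs))"
    by (rule continuous_on_compose2) (auto intro!: continuous_intros)
  have u: "continuous_on UNIV (\<lambda>p::real \<times> 'a. es_u (\<omega> i) (J (snd p + xs)) (\<tau>0 + fst p / \<epsilon>\<^sup>2) j)" if "i \<in> {1..r}" for i j
  proof -
    have "continuous_on UNIV (\<lambda>p::real \<times> 'a. (J (snd p + xs), \<tau>0 + fst p / \<epsilon>\<^sup>2))"
      by (cases "\<epsilon> = 0") (auto intro!: continuous_intros continuous_on_compose2[OF J_continuous])
    from continuous_on_compose2[OF es_u_continuous[OF omega_pos[OF that], of j] this] show ?thesis by simp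
  qed
  show ?thesis unfolding es_rhs_def case_prod_beta
    by (intro continuous_intros b0 u)
qed

text \<open>By \<open>V_le\<close>, \<open>J\<close> grows at most quadratically, so its square root
  and with it the controls grow at most linearly. The constant may depend on
  \<open>\<epsilon>\<close>, because continuation takes place at a fixed
  \<open>\<epsilon>\<close>.\<close>

lemma es_rhs_linear_growth:
  "\<exists>C>0. \<forall>x \<tau>. norm (es_rhs r b0 b \<omega> J xs \<epsilon> x \<tau>) \<le> C * (1 + norm x)"
proof -
  define A where "A = sqrt \<bar>J xs\<bar> + sqrt L"
  define B where "B = (\<Sum>i=1..r. \<Sum>j=1..2. sqrt (2 * \<omega> i) * norm (b i j))"
  have A0: "0 \<le> A" using L by (simp add: A_def)
  have sJ: "sqrt (max (J (x + xs)) 0) \<le> A * (1 + norm x)" for x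
  proof -
    have "max (J (x + xs)) 0 \<le> \<bar>J xs\<bar> + L * (norm x)\<^sup>2" using V_le[of "x + xs"] L by auto
    then have "sqrt (max (J (x + xs)) 0) \<le> sqrt (\<bar>J xs\<bar> + L * (norm x)\<^sup>2)" by simp
    also have "\<dots> \<le> sqrt \<bar>J xs\<bar> + sqrt (L * (norm x)\<^sup>2)" using L by (intro sqrt_add_le_add_sqrt) auto
    also have "\<dots> = sqrt \<bar>J xs\<bar> + sqrt L * norm x" by (simp add: real_sqrt_mult)
    also have "\<dots> \<le> A * (1 + norm x)" using L by (simp add: A_def algebra_simps)
    finally show ?thesis .
  qed
  have main: "norm (es_rhs r b0 b \<omega> J xs \<epsilon> x \<tau>) \<le> (L0 + \<bar>1 / \<epsilon>\<bar> * (B * A)) * (1 + norm x)" for x \<tau>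
  proof -
    have "b0 xs = 0" using b0_le[of xs] G_xs by simp
    then have b: "norm (b0 (x + xs)) \<le> L0 * (1 + norm x)" using b0_lip[of "x + xs" xs] L0 by (simp add: algebra_simps)
    have "norm (\<Sum>i=1..r. \<Sum>j=1..2. es_u (\<omega> i) (J (x + xs)) \<tau> j *\<^sub>R b i j)
        \<le> (\<Sum>i=1..r. \<Sum>j=1..2. sqrt (2 * \<omega> i) * norm (b i j) * (A * (1 + norm x)))"
    proof (intro sum_norm_le)
      fix i j assume i: "i \<in> {1..r}"
      have "\<bar>es_u (\<omega> i) (J (x + xs)) \<tau> j\<bar> \<le> sqrt (2 * \<omega> i) * sqrt (max (J (x + xs)) 0)"
        using abs_es_u_le[OF omega_pos[OF i]] by (simp add: real_sqrt_mult)
      also have "\<dots> \<le> sqrt (2 * \<omega> i) * (A * (1 + norm x))" using sJ omega_pos[OF i] by (intro mult_left_mono) auto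
      finally have "\<bar>es_u (\<omega> i) (J (x + xs)) \<tau> j\<bar> * norm (b i j) \<le> sqrt (2 * \<omega> i) * (A * (1 + norm x)) * norm (b i j)"
        by (intro mult_right_mono) auto
      then show "norm (es_u (\<omega> i) (J (x + xs)) \<tau> j *\<^sub>R b i j) \<le> sqrt (2 * \<omega> i) * norm (b i j) * (A * (1 + norm x))"
        by (simp add: mult_ac)
    qed
    also have "\<dots> = B * (A * (1 + norm x))" by (simp add: B_def sum_distrib_right)
    finally have "\<bar>1 / \<epsilon>\<bar> * norm (\<Sum>i=1..r. \<Sum>j=1..2. es_u (\<omega> i) (J (x + xs)) \<tau> j *\<^sub>R b i j) \<le> \<bar>1 / \<epsilon>\<bar> * (B * (A * (1 + norm x)))"
      by (intro mult_left_mono) auto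
    then have "norm ((1 / \<epsilon>) *\<^sub>R (\<Sum>i=1..r. \<Sum>j=1..2. es_u (\<omega> i) (J (x + xs)) \<tau> j *\<^sub>R b i j)) \<le> \<bar>1 / \<epsilon>\<bar> * (B * A) * (1 + norm x)"
      by (simp only: norm_scaleR mult.assoc)
    then show ?thesis unfolding es_rhs_def distrib_right
      by (intro norm_triangle_le add_mono b)
  qed
  have "0 \<le> B" unfolding B_def using omega_pos by (intro sum_nonneg mult_nonneg_nonneg) (auto intro: less_imp_le)
  then have "0 < L0 + \<bar>1 / \<epsilon>\<bar> * (B * A)" using L0 A0 by (intro add_pos_nonneg mult_nonneg_nonneg) auto
  then show ?thesis using main by blast
qed

lemma solution_global:
  assumes sol: "es_solution r b0 b \<omega> J xs \<epsilon> x0 \<tau>0 ts x \<tau>"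
  shows "sol_global (es_solution r b0 b \<omega> J xs) \<epsilon> x0 \<tau>0 ts x \<tau>"
proof (cases ts)
  case PInf
  then show ?thesis using sol unfolding sol_global_def by auto
next
  case MInf
  then show ?thesis using sol by (simp add: es_solution_def)
next
  case (real T)
  have T: "0 < T" using sol real by (simp add: es_solution_def)
  have dom: "sol_dom ts = {0..<T}" using real by (auto simp: sol_dom_def)
  have inf: "sol_dom \<infinity> = {0..}" by (auto simp: sol_dom_def)
  define f where "f = (\<lambda>t x. es_rhs r b0 b \<omega> J xs \<epsilon> x (\<tau>0 + t / \<epsilon>\<^sup>2))"
  define \<tau>' where "\<tau>' = (\<lambda>t. \<tau>0 + t / \<epsilon>\<^sup>2)"
  have cont: "continuous_on UNIV (\<lambda>(t, x). f t x)" unfolding f_def by (rule es_rhs_continuous)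
  obtain C where C: "C > 0" "\<And>t x. norm (f t x) \<le> C * (1 + norm x)"
    using es_rhs_linear_growth[of \<epsilon>] unfolding f_def by blast
  have "(x has_vector_derivative f t (x t)) (at t within {0..<T})" if "t \<in> {0..<T}" for t
  proof -
    have "(x has_vector_derivative es_rhs r b0 b \<omega> J xs \<epsilon> (x t) (\<tau> t)) (at t within {0..<T})"
      using sol that unfolding es_solution_def dom by blast
    moreover have "\<tau> t = \<tau>0 + t / \<epsilon>\<^sup>2" using that by (intro es_solution_tau[OF sol]) (simp add: dom)
    ultimately show ?thesis by (simp only: f_def)
  qed
  from solution_extends_globally[OF cont C(2,1) T this]
  obtain y where y: "\<And>t. 0 \<le> t \<Longrightarrow> (y has_vector_derivative f t (y t)) (at t within {0..})" "\<And>t. t \<in> {0..<T} \<Longrightarrow> y t = x t"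
    by blast
  have "continuous_on {0..} y" by (rule continuous_on_vector_derivative) (use y(1) in auto)
  then have "continuous_on {0..} (\<lambda>t. es_rhs r b0 b \<omega> J xs \<epsilon> (y t) (\<tau>' t))"
    using continuous_on_comp_field[OF cont] by (simp add: f_def \<tau>'_def)
  moreover have "(\<tau>' has_vector_derivative 1 / \<epsilon>\<^sup>2) (at t within {0..})" for t
  proof -
    have "(\<tau>' has_real_derivative 0 + 1 / \<epsilon>\<^sup>2) (at t within {0..})"
      unfolding \<tau>'_def by (intro DERIV_add DERIV_const DERIV_cdivide DERIV_ident)
    then show ?thesis by (simp add: has_real_derivative_iff_has_vector_derivative)
  qed
  moreover have "y 0 = x0" using y(2)[of 0] T sol by (simp add: es_solution_def)
  ultimately have "es_solution r b0 b \<omega> J xs \<epsilon> x0 \<tau>0 \<infinity> y \<tau>'"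
    unfolding es_solution_def inf using y(1) by (auto simp: f_def \<tau>'_def)
  moreover have "\<forall>t\<in>sol_dom ts. y t = x t \<and> \<tau>' t = \<tau> t"
    using y(2) es_solution_tau[OF sol] dom by (simp add: \<tau>'_def)
  ultimately show ?thesis unfolding sol_global_def by blast
qed

section \<open>The class KL bound and the stability conclusions\<close>

definition \<beta> :: "real \<Rightarrow> real \<Rightarrow> real" where
  "\<beta> s t = (INF d\<in>{0<..}. d + gain d * s * exp (- (rate d / 2) * t)) + s * exp (- t)"

lemma beta_KL: "class_KL \<beta>"
proof -
  have "class_KL (\<lambda>s t. (INF d\<in>{0<..}. d + gain d * s * exp (- (rate d / 2) * t)) + s * exp (- t))"
    by (rule class_KL_INF[of gain "\<lambda>d. rate d / 2"]) (use gain_pos rate_pos in auto)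
  then show ?thesis by (simp add: \<beta>_def[abs_def])
qed

text \<open>The function \<open>\<beta>\<close> is the same for every \<open>\<nu>\<close>, as
  practical stability demands. The infimum in it also runs over resolutions finer than
  \<open>\<nu>\<close>, where \<open>trajectory_bound\<close> is silent; the additive
  \<open>\<nu>\<close> pays for those.\<close>

lemma ultimate_bound:
  assumes nu: "0 < \<nu>" and level: "4 * max 0 (- J xs) \<le> level \<nu>"
  shows "\<exists>\<epsilon>s>0. \<forall>\<epsilon>. 0 < \<epsilon> \<and> \<epsilon> < \<epsilon>s \<longrightarrow> (\<forall>x0 \<tau>0 ts x \<tau>. \<tau>0 \<ge> 0 \<and> es_solution r b0 b \<omega> J xs \<epsilon> x0 \<tau>0 ts x \<tau> \<longrightarrow>
     sol_global (es_solution r b0 b \<omega> J xs) \<epsilon> x0 \<tau>0 ts x \<tau> \<and> (\<forall>t\<in>sol_dom ts. norm (x t) \<le> \<beta> (norm x0) t + \<nu>))"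
proof -
  obtain e where e: "e > 0" and all: "\<forall>\<epsilon> x0 \<tau>0 ts x \<tau> d t. 0 < \<epsilon> \<longrightarrow> \<epsilon> < e \<longrightarrow> es_solution r b0 b \<omega> J xs \<epsilon> x0 \<tau>0 ts x \<tau> \<longrightarrow>
     \<nu> \<le> d \<longrightarrow> t \<in> sol_dom ts \<longrightarrow> norm (x t) \<le> d + gain d * norm x0 * exp (- (rate d / 2) * t)"
    using trajectory_bound[OF assms] by (elim exE conjE, intro that)
  note bound = all[rule_format]
  have main: "norm (x t) \<le> \<beta> (norm x0) t + \<nu>"
    if eps: "0 < \<epsilon>" "\<epsilon> < e" and sol: "es_solution r b0 b \<omega> J xs \<epsilon> x0 \<tau>0 ts x \<tau>" and t: "t \<in> sol_dom ts" for \<epsilon> x0 \<tau>0 ts x \<tau> t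
  proof -
    have t0: "0 \<le> t" using t by (simp add: sol_dom_def)
    have "norm (x t) - \<nu> \<le> (INF d\<in>{0<..}. d + gain d * norm x0 * exp (- (rate d / 2) * t))"
    proof (rule cINF_greatest)
      fix d :: real assume "d \<in> {0<..}"
      then have d: "0 < d" by simp
      show "norm (x t) - \<nu> \<le> d + gain d * norm x0 * exp (- (rate d / 2) * t)"
      proof (cases "\<nu> \<le> d")
        case True
        then show ?thesis using bound[OF eps sol _ t, of d] nu by linarith
      next
        case False
        \<comment> \<open>A finer resolution has larger gain and smaller rate, so its transient
          dominates the one at \<open>\<nu>\<close>.\<close>
        have "gain \<nu> * norm x0 * exp (- (rate \<nu> / 2) * t) \<le> gain d * norm x0 * exp (- (rate d / 2) * t)"
          using gain_antimono[OF d, of \<nu>] rate_mono[OF d, of \<nu>] gain_pos[OF d] False t0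
          by (intro mult_mono) (auto intro!: mult_right_mono)
        then show ?thesis using bound[OF eps sol _ t, of \<nu>] d by simp
      qed
    qed simp
    moreover have "0 \<le> norm x0 * exp (- t)" by simp
    ultimately show ?thesis unfolding \<beta>_def by linarith
  qed
  show ?thesis
    by (intro exI[of _ e] conjI allI impI ballI e; elim conjE;
      ((rule solution_global, assumption) | (rule main; assumption)))
qed

lemma exists_UGUB: "\<exists>\<Delta>>0. UGUB (es_solution r b0 b \<omega> J xs) \<Delta>"
proof -
  define m where "m = max 0 (- J xs)"
  \<comment> \<open>The 1 gives \<open>\<nu> \<ge> 1\<close>, hence
    \<open>\<nu>\<^sup>2 \<ge> \<nu>\<close> and \<open>\<alpha> \<nu> \<ge> \<alpha> 1\<close>. The
    other summand then lifts \<open>(\<nu> * \<alpha> \<nu>)\<^sup>2 / (8 * L)\<close> to at least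
    \<open>4 * m\<close>.\<close>
  define \<nu> where "\<nu> = 1 + 32 * L * m / (\<alpha> 1)\<^sup>2"
  have a1: "0 < \<alpha> 1" by (rule alpha_pos) simp
  have m0: "0 \<le> m" by (simp add: m_def)
  have nu: "1 \<le> \<nu>" using L m0 by (simp add: \<nu>_def)
  have "32 * L * m = (32 * L * m / (\<alpha> 1)\<^sup>2) * (\<alpha> 1)\<^sup>2" using a1 by simp
  also have "\<dots> \<le> \<nu> * (\<alpha> 1)\<^sup>2" by (intro mult_right_mono) (auto simp: \<nu>_def)
  also have "\<dots> \<le> \<nu>\<^sup>2 * (\<alpha> \<nu>)\<^sup>2"
    using nu a1 alpha_mono[of 1 \<nu>] by (intro mult_mono power_mono) (auto simp: power2_eq_square)
  finally have "4 * m \<le> level \<nu>" using L by (simp add: level_def power_mult_distrib field_simps)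
  then have "UGUB (es_solution r b0 b \<omega> J xs) \<nu>"
    unfolding UGUB_def using ultimate_bound[of \<nu>] nu beta_KL unfolding m_def by force
  then show ?thesis using nu by (intro exI[of _ \<nu>]) auto
qed

lemma UGPAS_of_nonneg:
  assumes "0 \<le> J xs"
  shows "UGPAS (es_solution r b0 b \<omega> J xs)"
proof -
  have "4 * max 0 (- J xs) \<le> level \<nu>" if "0 < \<nu>" for \<nu> using level_pos[OF that] assms by simp
  then show ?thesis unfolding UGPAS_def using ultimate_bound beta_KL by blast
qed

end

theorem theorem2:
  fixes r :: nat
    and b :: "nat \<Rightarrow> nat \<Rightarrow> real ^ 'n"
    and \<omega> :: "nat \<Rightarrow> real"
    and b0 :: "real ^ 'n \<Rightarrow> real ^ 'n"
    and J :: "real ^ 'n \<Rightarrow> real"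
    and gradJ :: "real ^ 'n \<Rightarrow> real ^ 'n"
    and H :: "real ^ 'n \<Rightarrow> ((real ^ 'n) \<Rightarrow>\<^sub>L (real ^ 'n))"
    and xs :: "real ^ 'n"
    and \<gamma> \<kappa>3 :: real
    and \<alpha>J :: "real \<Rightarrow> real"
  assumes r_pos: "r \<ge> 1"
    and r_dim: "2 * r \<ge> CARD('n)"
    and \<omega>_rat: "\<forall>i\<in>{1..r}. \<omega> i \<in> \<rat> \<and> \<omega> i > 0"
    and \<omega>_dist: "inj_on \<omega> {1..r}"
    \<comment> \<open>J is C^2 with gradient gradJ and Hessian H\<close>
    and J_grad: "\<forall>x. (J has_derivative (\<lambda>h. gradJ x \<bullet> h)) (at x)"
    and J_hess: "\<forall>x. (gradJ has_derivative blinfun_apply (H x)) (at x)"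
    and H_cont: "continuous_on UNIV H"
    \<comment> \<open>J^* = inf J attained at the unique x^*\<close>
    and xs_min: "\<forall>x. J xs \<le> J x"
    \<comment> \<open>radially unbounded\<close>
    and J_radunb: "filterlim J at_top at_infinity"
    \<comment> \<open>Excitation Assumption with constant gamma\<close>
    and \<gamma>_pos: "\<gamma> > 0"
    and excit: "\<forall>v. (\<Sum>i=1..r. \<Sum>j=1..2. (b i j \<bullet> v)\<^sup>2) \<ge> \<gamma> * (norm v)\<^sup>2"
    \<comment> \<open>Regularity Assumption with constant kappa3\<close>
    and reg_a: "\<forall>x. x \<noteq> xs \<longrightarrow> J x > J xs"
    and reg_b: "\<forall>x. gradJ x = 0 \<longleftrightarrow> x = xs"
    and reg_c: "\<exists>LJ>0. \<forall>x. norm (H x) \<le> LJ"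
    and \<kappa>3_pos: "\<kappa>3 > 0"
    and reg_d: "\<forall>x. norm (b0 x) \<le> \<kappa>3 * norm (gradJ x)"
    and reg_e: "\<exists>L0>0. \<forall>x1 x2. norm (b0 x1 - b0 x2) \<le> L0 * norm (x1 - x2)"
    and \<gamma>_gt: "\<gamma> > \<kappa>3"
    and \<alpha>J_K: "class_K \<alpha>J"
    and \<alpha>J_bound: "\<forall>x. (\<alpha>J (norm (x - xs)))\<^sup>2 * (norm (x - xs))\<^sup>2 \<le> (norm (gradJ x))\<^sup>2"
  shows "(\<exists>\<Delta>>0. UGUB (es_solution r b0 b \<omega> J xs) \<Delta>) \<and>
         (J xs \<ge> 0 \<longrightarrow> UGPAS (es_solution r b0 b \<omega> J xs))"
proof -
  obtain L where L: "L > 0" "\<And>x. norm (H x) \<le> L" using reg_c by blast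
  obtain L0 where L0: "L0 > 0" "\<And>x y. norm (b0 x - b0 y) \<le> L0 * norm (x - y)" using reg_e by blast
  have lip: "norm (gradJ x - gradJ y) \<le> L * norm (x - y)" for x y
    using gradient_Lipschitz[of gradJ H L] J_hess L(2) by blast
  interpret extremum_seeking r b \<omega> b0 J gradJ xs \<gamma> \<kappa>3 L L0 \<alpha>J
  proof
  qed (use \<omega>_rat \<omega>_dist J_grad lip L(1) xs_min reg_b excit \<kappa>3_pos \<gamma>_gt reg_d L0 \<alpha>J_K \<alpha>J_bound in blast)+
  show ?thesis using exists_UGUB UGPAS_of_nonneg by blast
qed

end
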